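(* Let $R(\lambda)\in\mathbb{C}(\lambda)^{m\times m}$ be an arbitrary rational matrix (regular or singular) which has one of the following structures: Hermitian, skew-Hermitian, para-Hermitian or para-skew-Hermitian. Let $R(\lambda)=P(\lambda)+R_{sp}(\lambda)$, where $P(\lambda)$ is the polynomial part of $R(\lambda)$ and $R_{sp}(\lambda)$ is the strictly proper part of $R(\lambda)$. Let $$\widehat L_s(\lambda):=\left[\begin{array}{c|c}\widehat A_s(\lambda)&-\widehat B_s(\lambda)\\ \hline \widehat C_s(\lambda)&\widehat D_s(\lambda)\end{array}\right]\quad\text{and}\quad L_{sp}(\lambda):=\left[\begin{array}{c|c}A_{sp}(\lambda)&-B_{sp}(\lambda)\\ \hline C_{sp}(\lambda)&0\end{array}\right]$$ be the strongly minimal linearizations of $P(\lambda)$ and $R_{sp}(\lambda)$, respectively, constructed according to the structure of $R(\lambda)$ as described in the context. Then $$L(\lambda):=\left[\begin{array}{cc|c}\widehat A_s(\lambda)&0&-\widehat B_s(\lambda)\\0&A_{sp}(\lambda)&-B_{sp}(\lambda)\\ \hline \widehat C_s(\lambda)&C_{sp}(\lambda)&\widehat D_s(\lambda)\end{array}\right]$$ is a strongly minimal linearization of $R(\lambda)$ with the same self-conjugate structure as $R(\lambda)$.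
   Context: **Self-conjugate structures.** A square rational matrix (in particular a polynomial matrix or pencil) $M(\lambda)$ is: Hermitian if $[M(\lambda)]^*=M(\overline\lambda)$; skew-Hermitian if $[M(\lambda)]^*=-M(\overline\lambda)$; para-Hermitian if $[M(\lambda)]^*=M(-\overline\lambda)$; para-skew-Hermitian if $[M(\lambda)]^*=-M(-\overline\lambda)$. Here $^*$ is the conjugate transpose. **Polynomial and strictly proper parts.** A rational matrix is strictly proper if each entry has numerator degree less than denominator degree. Every rational matrix is uniquely $R(\lambda)=P(\lambda)+R_{sp}(\lambda)$ with $P(\lambda)$ a polynomial matrix (the polynomial part) and $R_{sp}(\lambda)$ strictly proper (the strictly proper part); both parts inherit the self-conjugate structure of $R(\lambda)$. **Strongly minimal linearization.** A square polynomial matrix is regular if its determinant is not identically zero. A linear polynomial system matrix is a block-partitioned pencil $$L(\lambda)=\begin{bmatrix}A(\lambda)&-B(\lambda)\\C(\lambda)&D(\lambda)\end{bmatrix}=\begin{bmatrix}\lambda A_1-A_0&-\lambda B_1+B_0\\ \lambda C_1-C_0&\lambda D_1-D_0\end{bmatrix}\in\mathbb{C}[\lambda]^{(p+m)\times(p+n)}$$ with $A(\lambda)\in\mathbb{C}[\lambda]^{p\times p}$ regular; its transfer function matrix is $D(\lambda)+C(\lambda)A(\lambda)^{-1}B(\lambda)$. It is strongly minimal if the pencils $[A(\lambda)\ \ -B(\lambda)]$ and $\begin{bmatrix}A(\lambda)\\C(\lambda)\end{bmatrix}$ have degree exactly 1 (when $p\ge1$) and no finite or infinite eigenvalues; that is,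 for every $\lambda_0\in\mathbb{C}$ the matrices $[A(\lambda_0)\ \ -B(\lambda_0)]$ and $\begin{bmatrix}A(\lambda_0)\\C(\lambda_0)\end{bmatrix}$ have rank $p$, and $[A_1\ \ -B_1]$ and $\begin{bmatrix}A_1\\C_1\end{bmatrix}$ have rank $p$. $L(\lambda)$ is a strongly minimal linearization of a rational matrix $R(\lambda)\in\mathbb{C}(\lambda)^{m\times n}$ if it is strongly minimal and its transfer function matrix is $R(\lambda)$. **Construction of $\widehat L_s(\lambda)$ from $P(\lambda)$.** Write $P(\lambda)=P_0+P_1\lambda+\cdots+P_d\lambda^d$, of degree $d>1$, and set $P_k:=0$ for $k>d$. Let $T\in\mathbb{C}^{m(d-1)\times m(d-1)}$ be the $(d-1)\times(d-1)$ block matrix with $(i,j)$ block $P_{2d-i-j}$. Let $L_s(\lambda)=\begin{bmatrix}A_s(\lambda)&-B_s(\lambda)\\C_s(\lambda)&D_s(\lambda)\end{bmatrix}$, where $A_s(\lambda)$ is the $(d-1)\times(d-1)$ block matrix with $(i,j)$ block $\lambda P_{2d+1-i-j}-P_{2d-i-j}$; $-B_s(\lambda)$ is the block column with blocks (top to bottom) $\lambda P_d,\ldots,\lambda P_2$; $C_s(\lambda)$ is the block row with blocks (left to right) $\lambda P_d,\ldots,\lambda P_2$; and $D_s(\lambda)=\lambda P_1+P_0$. With $r=\operatorname{rank}T$, let $U,V$ be unitary with $U^*TV=\begin{bmatrix}0&0\\0&\widehat T\end{bmatrix}$, $\widehat T\in\mathbb{C}^{r\times r}$ invertible, where $U=V$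 in the Hermitian and skew-Hermitian cases, and $U=SV$ with $S=\operatorname{diag}((-1)^{d-1}I_m,\ldots,(-1)^2I_m,-I_m)$ in the para-Hermitian and para-skew-Hermitian cases. Then $\widehat L_s(\lambda)$, with $\widehat A_s(\lambda)$ of size $r\times r$, is obtained from $\operatorname{diag}(U^*,I_m)L_s(\lambda)\operatorname{diag}(V,I_m)$ by deleting its first $m(d-1)-r$ rows and columns (which are zero). If $P(\lambda)$ has degree at most 1 (or is zero), $\widehat A_s,\widehat B_s,\widehat C_s$ are empty and $\widehat L_s(\lambda)=\widehat D_s(\lambda)=P(\lambda)$. **Construction of $L_{sp}(\lambda)$ from $R_{sp}(\lambda)$.** Write $R_{sp}(\lambda)=\sum_{i\ge1}R_{-i}\lambda^{-i}$ (Laurent expansion around infinity). Let $H$ and $H_\sigma$ be the $k\times k$ block matrices whose $(i,j)$ blocks are $R_{-(i+j-1)}$ and $R_{-(i+j)}$, respectively, with $k$ large enough that $r_f:=\operatorname{rank}H$ equals the sum of the degrees of the denominators in the Smith–McMillan form of $R_{sp}(\lambda)$. Let $U,V$ be unitary (a separate choice from the $U,V$ above) with $U^*HV=\begin{bmatrix}\widehat H&0\\0&0\end{bmatrix}$, $\widehat H\in\mathbb{C}^{r_f\times r_f}$ invertible, where $U=V$ in the Hermitian and skew-Hermitian cases and $U=SV$ with $S=\operatorname{diag}(-I_m,(-1)^2I_m,\ldots,(-1)^kI_m)$ in the para-Hermitian and para-skew-Hermitian cases. Let $V_1$ be the first $r_f$ columns of $V$ and $V_{11}$ the first $m$ rows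 of $V_1$. Then $$L_{sp}(\lambda)=\left[\begin{array}{c|c}V_1^*H_\sigma V_1-\lambda\widehat H&\widehat HV_{11}^*\\ \hline V_{11}\widehat H&0\end{array}\right]\ \text{(Hermitian, skew-Hermitian)},\quad L_{sp}(\lambda)=\left[\begin{array}{c|c}V_1^*SH_\sigma V_1-\lambda\widehat H&\widehat HV_{11}^*\\ \hline -V_{11}\widehat H&0\end{array}\right]\ \text{(para-Hermitian, para-skew-Hermitian)}.$$ If $R_{sp}(\lambda)=0$, then $r_f=0$ and the blocks $A_{sp},B_{sp},C_{sp}$ are empty. *)

theory Defs
  imports
    "HOL-Computational_Algebra.Computational_Algebra"
    "HOL-Computational_Algebra.Field_as_Ring"
    "Jordan_Normal_Form.DL_Rank"
    "Jordan_Normal_Form.Gauss_Jordan_Elimination"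
    "Jordan_Normal_Form.Schur_Decomposition"
begin

section \<open>Polynomial and rational matrices\<close>

text \<open>Polynomial matrices have type \<^typ>\<open>complex poly mat\<close>, rational matrices have type
  \<^typ>\<open>complex poly fract mat\<close>. The function \<^const>\<open>quot_of_fract\<close> returns the reduced fraction
  with monic denominator.\<close>

abbreviation rat_mat :: "complex poly mat \<Rightarrow> complex poly fract mat" where
  "rat_mat M \<equiv> map_mat to_fract M"

abbreviation const_mat :: "complex mat \<Rightarrow> complex poly mat" where
  "const_mat M \<equiv> map_mat (\<lambda>c. [:c:]) M"

abbreviation lam :: "complex poly" where
  "lam \<equiv> [:0, 1:]"

abbreviation coeff_mat :: "complex poly mat \<Rightarrow> nat \<Rightarrow> complex mat" where
  "coeff_mat M k \<equiv> map_mat (\<lambda>p. coeff p k) M"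

abbreviation poly_mat_at :: "complex poly mat \<Rightarrow> complex \<Rightarrow> complex mat" where
  "poly_mat_at M z \<equiv> map_mat (\<lambda>p. poly p z) M"

text \<open>The degree of a zero (or empty) polynomial matrix is 0 by convention.\<close>

definition poly_mat_degree :: "complex poly mat \<Rightarrow> nat" where
  "poly_mat_degree M = Max (insert 0 (degree ` elements_mat M))"

definition mat_rank :: "complex mat \<Rightarrow> nat" where
  "mat_rank M = vec_space.rank (dim_row M) M"

definition append_cols :: "'a :: zero mat \<Rightarrow> 'a mat \<Rightarrow> 'a mat"  (infixr \<open>@\<^sub>c\<close> 65) where
  "M @\<^sub>c N = four_block_mat M N (0\<^sub>m 0 (dim_col M)) (0\<^sub>m 0 (dim_col N))"

definition diag2 :: "'a :: zero mat \<Rightarrow> 'a mat \<Rightarrow> 'a mat" where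
  "diag2 M N = four_block_mat M (0\<^sub>m (dim_row M) (dim_col N)) (0\<^sub>m (dim_row N) (dim_col M)) N"

text \<open>The \<open>k \<times> l\<close> block matrix whose blocks \<open>F i j\<close> are \<open>m \<times> n\<close>; the block indices start at 1.\<close>

definition mat_of_blocks ::
    "nat \<Rightarrow> nat \<Rightarrow> nat \<Rightarrow> nat \<Rightarrow> (nat \<Rightarrow> nat \<Rightarrow> 'a mat) \<Rightarrow> 'a mat" where
  "mat_of_blocks k l m n F =
     mat (k * m) (l * n) (\<lambda>(i, j). F (i div m + 1) (j div n + 1) $$ (i mod m, j mod n))"

definition unitary_mat :: "complex mat \<Rightarrow> bool" where
  "unitary_mat U \<longleftrightarrow> square_mat U \<and> mat_adjoint U * U = 1\<^sub>m (dim_row U)"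

definition strictly_proper :: "complex poly fract mat \<Rightarrow> bool" where
  "strictly_proper M \<longleftrightarrow> (\<forall>r \<in> elements_mat M.
     r = 0 \<or> degree (fst (quot_of_fract r)) < degree (snd (quot_of_fract r)))"

section \<open>Self-conjugate structures\<close>

definition rat_at :: "complex poly fract \<Rightarrow> complex \<Rightarrow> complex" where
  "rat_at r z = poly (fst (quot_of_fract r)) z / poly (snd (quot_of_fract r)) z"

abbreviation rat_mat_at :: "complex poly fract mat \<Rightarrow> complex \<Rightarrow> complex mat" where
  "rat_mat_at M z \<equiv> map_mat (\<lambda>r. rat_at r z) M"

definition no_pole_at :: "complex poly fract mat \<Rightarrow> complex \<Rightarrow> bool" where
  "no_pole_at M z \<longleftrightarrow> (\<forall>r \<in> elements_mat M. poly (snd (quot_of_fract r)) z \<noteq> 0)"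

datatype conj_kind = Hermitian | Skew_Hermitian | Para_Hermitian | Para_Skew_Hermitian

text \<open>The identities between values are required wherever both sides are defined, which is what
  equality of the two rational functions of \<open>z\<close> means.\<close>

fun self_conj :: "conj_kind \<Rightarrow> complex poly fract mat \<Rightarrow> bool" where
  "self_conj Hermitian M \<longleftrightarrow> square_mat M \<and>
     (\<forall>z. no_pole_at M z \<and> no_pole_at M (cnj z) \<longrightarrow>
        mat_adjoint (rat_mat_at M z) = rat_mat_at M (cnj z))"
| "self_conj Skew_Hermitian M \<longleftrightarrow> square_mat M \<and>
     (\<forall>z. no_pole_at M z \<and> no_pole_at M (cnj z) \<longrightarrow>
        mat_adjoint (rat_mat_at M z) = - rat_mat_at M (cnj z))"
| "self_conj Para_Hermitian M \<longleftrightarrow> square_mat M \<and>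
     (\<forall>z. no_pole_at M z \<and> no_pole_at M (- cnj z) \<longrightarrow>
        mat_adjoint (rat_mat_at M z) = rat_mat_at M (- cnj z))"
| "self_conj Para_Skew_Hermitian M \<longleftrightarrow> square_mat M \<and>
     (\<forall>z. no_pole_at M z \<and> no_pole_at M (- cnj z) \<longrightarrow>
        mat_adjoint (rat_mat_at M z) = - rat_mat_at M (- cnj z))"

fun is_para :: "conj_kind \<Rightarrow> bool" where
  "is_para Hermitian \<longleftrightarrow> False"
| "is_para Skew_Hermitian \<longleftrightarrow> False"
| "is_para Para_Hermitian \<longleftrightarrow> True"
| "is_para Para_Skew_Hermitian \<longleftrightarrow> True"

section \<open>Strongly minimal linearizations\<close>

text \<open>The blocks \<open>A, B, C, D\<close> are those of the partitioned pencil \<open>[A, -B; C, D]\<close>.\<close>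

definition linear_system_matrix ::
    "nat \<Rightarrow> nat \<Rightarrow> nat \<Rightarrow> complex poly mat \<Rightarrow> complex poly mat \<Rightarrow> complex poly mat \<Rightarrow>
     complex poly mat \<Rightarrow> bool" where
  "linear_system_matrix p m n A B C D \<longleftrightarrow>
     A \<in> carrier_mat p p \<and> B \<in> carrier_mat p n \<and> C \<in> carrier_mat m p \<and> D \<in> carrier_mat m n \<and>
     poly_mat_degree (four_block_mat A (- B) C D) \<le> 1 \<and> det A \<noteq> 0"

definition transfer_function ::
    "complex poly mat \<Rightarrow> complex poly mat \<Rightarrow> complex poly mat \<Rightarrow> complex poly mat \<Rightarrow>
     complex poly fract mat" where
  "transfer_function A B C D =
     rat_mat D + rat_mat C * the (mat_inverse (rat_mat A)) * rat_mat B"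

text \<open>For a pencil of degree exactly 1, having no finite (respectively infinite) eigenvalues means
  that its values (respectively its leading coefficient) have full rank \<open>p\<close>.\<close>

definition strongly_minimal ::
    "nat \<Rightarrow> complex poly mat \<Rightarrow> complex poly mat \<Rightarrow> complex poly mat \<Rightarrow> bool" where
  "strongly_minimal p A B C \<longleftrightarrow>
     (1 \<le> p \<longrightarrow> poly_mat_degree (A @\<^sub>c - B) = 1 \<and> poly_mat_degree (A @\<^sub>r C) = 1) \<and>
     (\<forall>z. mat_rank (poly_mat_at (A @\<^sub>c - B) z) = p \<and> mat_rank (poly_mat_at (A @\<^sub>r C) z) = p) \<and>
     mat_rank (coeff_mat (A @\<^sub>c - B) 1) = p \<and> mat_rank (coeff_mat (A @\<^sub>r C) 1) = p"

definition strongly_minimal_linearization ::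
    "nat \<Rightarrow> nat \<Rightarrow> nat \<Rightarrow> complex poly mat \<Rightarrow> complex poly mat \<Rightarrow> complex poly mat \<Rightarrow>
     complex poly mat \<Rightarrow> complex poly fract mat \<Rightarrow> bool" where
  "strongly_minimal_linearization p m n A B C D R \<longleftrightarrow>
     linear_system_matrix p m n A B C D \<and> strongly_minimal p A B C \<and>
     R \<in> carrier_mat m n \<and> transfer_function A B C D = R"

section \<open>The linearization of the polynomial part\<close>

text \<open>The diagonal matrix with diagonal blocks \<open>(-1)\<^bsup>e i\<^esup> I\<^sub>m\<close> for \<open>i = 1, \<dots>, k\<close>.\<close>

definition sign_diag :: "nat \<Rightarrow> nat \<Rightarrow> (nat \<Rightarrow> nat) \<Rightarrow> complex mat" where
  "sign_diag k m e =
     mat_of_blocks k k m m (\<lambda>i j. if i = j then (- 1) ^ e i \<cdot>\<^sub>m 1\<^sub>m m else 0\<^sub>m m m)"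

definition T_poly :: "nat \<Rightarrow> nat \<Rightarrow> complex poly mat \<Rightarrow> complex mat" where
  "T_poly m d P = mat_of_blocks (d - 1) (d - 1) m m (\<lambda>i j. coeff_mat P (2 * d - i - j))"

definition L_poly :: "nat \<Rightarrow> nat \<Rightarrow> complex poly mat \<Rightarrow> complex poly mat" where
  "L_poly m d P = four_block_mat
     (mat_of_blocks (d - 1) (d - 1) m m (\<lambda>i j.
        lam \<cdot>\<^sub>m const_mat (coeff_mat P (2 * d + 1 - i - j))
        - const_mat (coeff_mat P (2 * d - i - j))))
     (mat_of_blocks (d - 1) 1 m m (\<lambda>i j. lam \<cdot>\<^sub>m const_mat (coeff_mat P (d + 1 - i))))
     (mat_of_blocks 1 (d - 1) m m (\<lambda>i j. lam \<cdot>\<^sub>m const_mat (coeff_mat P (d + 1 - j))))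
     (lam \<cdot>\<^sub>m const_mat (coeff_mat P 1) + const_mat (coeff_mat P 0))"

definition delete_leading :: "nat \<Rightarrow> 'a mat \<Rightarrow> 'a mat" where
  "delete_leading c M = mat (dim_row M - c) (dim_col M - c) (\<lambda>(i, j). M $$ (i + c, j + c))"

text \<open>Some \<open>[A, -B; C, D]\<close>, partitioned with \<open>A\<close> of size \<open>r \<times> r\<close>, is an outcome of the construction
  from \<open>P\<close>; it is a relation because the unitary matrices \<open>U, V\<close> can be chosen in several ways.\<close>

definition constructed_from_poly_part ::
    "conj_kind \<Rightarrow> nat \<Rightarrow> complex poly mat \<Rightarrow> nat \<Rightarrow> complex poly mat \<Rightarrow> complex poly mat \<Rightarrow>
     complex poly mat \<Rightarrow> complex poly mat \<Rightarrow> bool" where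
  "constructed_from_poly_part kind m P r A B C D \<longleftrightarrow>
     A \<in> carrier_mat r r \<and> B \<in> carrier_mat r m \<and> C \<in> carrier_mat m r \<and> D \<in> carrier_mat m m \<and>
     (let d = poly_mat_degree P; N = m * (d - 1); T = T_poly m d P;
          S = sign_diag (d - 1) m (\<lambda>i. d - i)
      in if d \<le> 1 then r = 0 \<and> D = P
         else r = mat_rank T \<and>
           (\<exists>U V That.
              U \<in> carrier_mat N N \<and> V \<in> carrier_mat N N \<and> unitary_mat U \<and> unitary_mat V \<and>
              (if is_para kind then U = S * V else U = V) \<and>
              That \<in> carrier_mat r r \<and> invertible_mat That \<and>
              mat_adjoint U * T * V = diag2 (0\<^sub>m (N - r) (N - r)) That \<and>
              four_block_mat A (- B) C D =
                delete_leading (N - r)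
                  (const_mat (diag2 (mat_adjoint U) (1\<^sub>m m)) * L_poly m d P
                   * const_mat (diag2 V (1\<^sub>m m)))))"

section \<open>The linearization of the strictly proper part\<close>

text \<open>The expansion around infinity is the image in the field of formal Laurent series in the
  variable \<open>\<lambda>\<^sup>-\<^sup>1\<close>, so \<open>\<lambda>\<close> itself is \<^const>\<open>fls_X_inv\<close>, and the coefficient of \<open>\<lambda>\<^bsup>-i\<^esup>\<close> is the one at \<open>i\<close>.\<close>

definition laurent_at_infinity :: "complex poly fract \<Rightarrow> complex fls" where
  "laurent_at_infinity r =
     poly (map_poly fls_const (fst (quot_of_fract r))) fls_X_inv
     / poly (map_poly fls_const (snd (quot_of_fract r))) fls_X_inv"

definition laurent_coeff_mat :: "complex poly fract mat \<Rightarrow> nat \<Rightarrow> complex mat" where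
  "laurent_coeff_mat R i = map_mat (\<lambda>r. fls_nth (laurent_at_infinity r) (int i)) R"

definition unimodular :: "complex poly mat \<Rightarrow> bool" where
  "unimodular W \<longleftrightarrow> square_mat W \<and> is_unit (det W)"

definition smith_mcmillan_form ::
    "complex poly fract mat \<Rightarrow> complex poly list \<Rightarrow> complex poly list \<Rightarrow> bool" where
  "smith_mcmillan_form R eps psi \<longleftrightarrow>
     length eps = length psi \<and> length psi \<le> min (dim_row R) (dim_col R) \<and>
     (\<forall>i < length psi. lead_coeff (eps ! i) = 1 \<and> lead_coeff (psi ! i) = 1 \<and>
        coprime (eps ! i) (psi ! i)) \<and>
     (\<forall>i. i + 1 < length psi \<longrightarrow>
        eps ! i dvd eps ! (i + 1) \<and> psi ! (i + 1) dvd psi ! i) \<and>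
     (\<exists>W Z. W \<in> carrier_mat (dim_row R) (dim_row R) \<and> Z \<in> carrier_mat (dim_col R) (dim_col R) \<and>
        unimodular W \<and> unimodular Z \<and>
        rat_mat W * R * rat_mat Z =
          mat (dim_row R) (dim_col R) (\<lambda>(i, j).
            if i = j \<and> i < length psi then Fract (eps ! i) (psi ! i) else 0))"

definition H_sp :: "nat \<Rightarrow> nat \<Rightarrow> complex poly fract mat \<Rightarrow> complex mat" where
  "H_sp m k R = mat_of_blocks k k m m (\<lambda>i j. laurent_coeff_mat R (i + j - 1))"

definition H_sigma_sp :: "nat \<Rightarrow> nat \<Rightarrow> complex poly fract mat \<Rightarrow> complex mat" where
  "H_sigma_sp m k R = mat_of_blocks k k m m (\<lambda>i j. laurent_coeff_mat R (i + j))"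

definition leading_block :: "nat \<Rightarrow> nat \<Rightarrow> 'a mat \<Rightarrow> 'a mat" where
  "leading_block a b M = mat a b (\<lambda>(i, j). M $$ (i, j))"

text \<open>Some \<open>[A, -B; C, 0]\<close>, partitioned with \<open>A\<close> of size \<open>r \<times> r\<close>, is an outcome of the construction
  from the strictly proper matrix \<open>R\<close> for some admissible \<open>k, U, V\<close>. The Smith--McMillan form is
  unique, so the existential quantifier over it only names it.\<close>

definition constructed_from_sp_part ::
    "conj_kind \<Rightarrow> nat \<Rightarrow> complex poly fract mat \<Rightarrow> nat \<Rightarrow> complex poly mat \<Rightarrow> complex poly mat \<Rightarrow>
     complex poly mat \<Rightarrow> bool" where
  "constructed_from_sp_part kind m R r A B C \<longleftrightarrow>
     A \<in> carrier_mat r r \<and> B \<in> carrier_mat r m \<and> C \<in> carrier_mat m r \<and>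
     (\<exists>k eps psi U V Hhat.
        let H = H_sp m k R; Hs = H_sigma_sp m k R; N = k * m;
            S = sign_diag k m (\<lambda>i. i);
            V1 = leading_block N r V; V11 = leading_block m r V
        in 1 \<le> k \<and> r = mat_rank H \<and>
           smith_mcmillan_form R eps psi \<and> r = sum_list (map degree psi) \<and>
           U \<in> carrier_mat N N \<and> V \<in> carrier_mat N N \<and> unitary_mat U \<and> unitary_mat V \<and>
           (if is_para kind then U = S * V else U = V) \<and>
           Hhat \<in> carrier_mat r r \<and> invertible_mat Hhat \<and>
           mat_adjoint U * H * V = diag2 Hhat (0\<^sub>m (N - r) (N - r)) \<and>
           A = const_mat (mat_adjoint V1 * (if is_para kind then S * Hs else Hs) * V1)
               - lam \<cdot>\<^sub>m const_mat Hhat \<and>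
           - B = const_mat (Hhat * mat_adjoint V11) \<and>
           C = const_mat (if is_para kind then - (V11 * Hhat) else V11 * Hhat))"

end

theory Submission
  imports Defs
begin

text \<open>Both constructions compress a block Hankel matrix with blocks \<open>h (i + j)\<close>: for the strictly
  proper part \<open>h n\<close> is the coefficient of \<open>\<lambda>\<^bsup>-(n+1)\<^esup>\<close>, for the polynomial part it is \<open>P\<^bsub>n+2\<^esub>\<close> once the
  order of the blocks is reversed. With \<open>H\<close> and \<open>F\<close> the compressions of the Hankel matrix and of its
  shift, the infinite Hankel matrix factors through a space of the dimension of \<open>H\<close>, which gives
  row blocks \<open>u n\<close> with \<open>u (n + 1) H = u n F\<close> and \<open>h n = u n H v\<close>. The polynomial part is the
  pencil \<open>\<lambda> F - H\<close> and the strictly proper part the pencil \<open>F - \<lambda> H\<close>. The recursion shows that the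
  pair \<open>(F, H)\<close> is observable through \<open>u 0 H\<close>, and that \<open>\<Sum> u n \<lambda>\<^bsup>n+1\<^esup>\<close> (respectively
  \<open>\<Sum> u n \<lambda>\<^bsup>-(n+1)\<^esup>\<close>) times the pencil telescopes to \<open>- \<lambda> u 0 H\<close> (respectively \<open>- u 0 H\<close>), which
  yields the transfer function without inverting the pencil. In the polynomial part
  \<open>u n\<close> vanishes for large \<open>n\<close>, so its pencil has no finite eigenvalue, and hence the direct sum of
  the two pencils remains observable. Controllability then follows from observability, because
  the adjoint of the system pencil at \<open>z\<close> is the pencil itself at \<open>\<plusminus>\<close> the conjugate of \<open>z\<close>, up to sign.\<close>

section \<open>Adjoints, ranks and self-conjugate structures\<close>

text \<open>The finite block matrices of the construction show only part of the infinite Hankel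
  matrix, while the transfer function involves all of it. The link is a coincidence of dimensions:
  the infinite matrix factors through dimension r, for one part because r is the sum of the
  denominator degrees in the Smith-McMillan form, for the other because its support is finite, and
  the nonsingular compression H has the same size r. The basis of the left factor can therefore be
  chosen so that it agrees with U on the finite window, and this defines u n beyond the window.

  The four structures are treated at once through two signs, e = \<open>kind_sign kind\<close> and s
  = \<open>kind_twist kind\<close>: the coefficient of lambda^n has conjugate transpose e s^n times
  itself. The diagonal matrix S absorbs the factor s^n, which is why U = S V is the right pairing
  and why the compressed matrices are self-adjoint up to a constant sign.\<close>

lemma mat_adjoint_carrier [simp, intro]:
  "A \<in> carrier_mat n m \<Longrightarrow> mat_adjoint A \<in> carrier_mat m n"
  unfolding mat_adjoint_def by (auto intro!: mat_of_rows_carrier)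

lemma dim_mat_adjoint [simp]:
  "dim_row (mat_adjoint A) = dim_col A" "dim_col (mat_adjoint A) = dim_row A"
  by (simp_all add: mat_adjoint_def)

lemma index_mat_adjoint [simp]:
  fixes A :: "complex mat"
  assumes "i < dim_col A" "j < dim_row A"
  shows "mat_adjoint A $$ (i, j) = cnj (A $$ (j, i))"
  using assms unfolding mat_adjoint_def by (simp add: mat_of_rows_index conjugate_complex_def)

lemma mat_adjoint_adjoint [simp]: "mat_adjoint (mat_adjoint A) = (A :: complex mat)"
  by (rule eq_matI) auto

lemma mat_adjoint_mult:
  fixes A B :: "complex mat"
  assumes "A \<in> carrier_mat n m" "B \<in> carrier_mat m k"
  shows "mat_adjoint (A * B) = mat_adjoint B * mat_adjoint A"
  using assms by (intro eq_matI) (auto simp: scalar_prod_def mult.commute intro!: sum.cong)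

lemma mat_adjoint_smult:
  fixes A :: "complex mat"
  shows "mat_adjoint (c \<cdot>\<^sub>m A) = cnj c \<cdot>\<^sub>m mat_adjoint A"
  by (intro eq_matI) auto

lemma mat_adjoint_add:
  fixes A B :: "complex mat"
  assumes "A \<in> carrier_mat n m" "B \<in> carrier_mat n m"
  shows "mat_adjoint (A + B) = mat_adjoint A + mat_adjoint B"
  using assms by (intro eq_matI) auto

lemma mat_adjoint_zero [simp]: "mat_adjoint (0\<^sub>m n m) = (0\<^sub>m m n :: complex mat)"
  by (intro eq_matI) auto

lemma mat_adjoint_four_block:
  fixes A B C D :: "complex mat"
  assumes "A \<in> carrier_mat nr1 nc1" "B \<in> carrier_mat nr1 nc2"
    "C \<in> carrier_mat nr2 nc1" "D \<in> carrier_mat nr2 nc2"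
  shows "mat_adjoint (four_block_mat A B C D) =
    four_block_mat (mat_adjoint A) (mat_adjoint C) (mat_adjoint B) (mat_adjoint D)"
  using assms by (intro eq_matI) auto

lemma unitary_mat_mult_adjoint:
  assumes "unitary_mat U" "U \<in> carrier_mat n n"
  shows "U * mat_adjoint U = 1\<^sub>m n" "mat_adjoint U * U = 1\<^sub>m n"
  using assms mat_mult_left_right_inverse[of "mat_adjoint U" n U]
  by (auto simp: unitary_mat_def)

section \<open>Rank criteria from kernels and adjoints\<close>

lemma mat_rank_injective:
  assumes M: "M \<in> carrier_mat n p"
    and inj: "\<And>y. y \<in> carrier_vec p \<Longrightarrow> M *\<^sub>v y = 0\<^sub>v n \<Longrightarrow> y = 0\<^sub>v p"
  shows "mat_rank M = p"
proof -
  interpret vec_space "TYPE(complex)" n .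
  \<comment> \<open>Independence concerns the set of columns, so repeated columns are excluded
    first: a repetition puts a difference of two unit vectors into the kernel.\<close>
  have dist: "distinct (cols M)"
  proof (rule ccontr)
    assume "\<not> distinct (cols M)"
    then obtain i j where ij: "i < p" "j < p" "i \<noteq> j" "col M i = col M j"
      using M by (auto simp: distinct_conv_nth)
    let ?y = "unit_vec p i - unit_vec p j :: complex vec"
    have "M *\<^sub>v ?y = col M i - col M j"
      using M ij(1-3) by (intro eq_vecI) (auto simp: mult_minus_distrib_mat_vec[OF M])
    then have "M *\<^sub>v ?y = 0\<^sub>v n" using ij M by auto
    then have "?y = 0\<^sub>v p" by (intro inj) auto
    then have "?y $ i = 0" using ij by simp
    then show False using ij by simp
  qed
  have "lin_indpt (set (cols M))"
  proof (rule ccontr)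
    assume "\<not> lin_indpt (set (cols M))"
    then obtain y where "y \<in> carrier_vec p" "y \<noteq> 0\<^sub>v p" "M *\<^sub>v y = 0\<^sub>v n"
      using lin_depE[OF M _ dist] by blast
    then show False using inj by blast
  qed
  then show ?thesis
    using lin_indpt_full_rank[OF M dist] M by (simp add: mat_rank_def)
qed

text \<open>The rank is the dimension of the column span, and a surjective \<open>M\<close> has the
  same column span as the identity matrix, whose rank is known.\<close>

lemma mat_rank_surjective:
  assumes M: "M \<in> carrier_mat n q"
    and surj: "\<And>x. x \<in> carrier_vec n \<Longrightarrow> \<exists>y \<in> carrier_vec q. M *\<^sub>v y = x"
  shows "mat_rank M = n"
proof -
  interpret vec_space "TYPE(complex)" n .
  have full: "span (set (cols N)) = carrier_vec n"
    if N: "N \<in> carrier_mat n k"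
      and surj: "\<And>x. x \<in> carrier_vec n \<Longrightarrow> \<exists>y \<in> carrier_vec k. N *\<^sub>v y = x" for N k
  proof
    have c: "set (cols N) \<subseteq> carrier_vec n" using N cols_dim by blast
    then show "span (set (cols N)) \<subseteq> carrier_vec n" using span_closed by blast
    show "carrier_vec n \<subseteq> span (set (cols N))"
    proof
      fix x :: "complex vec" assume "x \<in> carrier_vec n"
      then obtain y where y: "y \<in> carrier_vec k" "N *\<^sub>v y = x" using surj by blast
      have "lincomb_list (\<lambda>i. y $ i) (cols N) =
          mat_of_cols n (cols N) *\<^sub>v vec (length (cols N)) (\<lambda>i. y $ i)"
        by (rule lincomb_list_as_mat_mult) (use c in auto)
      also have "mat_of_cols n (cols N) = N" using N by auto
      also have "vec (length (cols N)) (\<lambda>i. y $ i) = y" using N y by auto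
      finally have "x \<in> span_list (cols N)" using y by (metis in_span_listI)
      then show "x \<in> span (set (cols N))" by (simp add: span_list_as_span[OF c])
    qed
  qed
  have "span (set (cols (1\<^sub>m n))) = carrier_vec n" by (rule full[of _ n]) auto
  then have "rank M = rank (1\<^sub>m n)"
    unfolding rank_def using full[OF M surj] by simp
  also have "\<dots> = n" by (rule low_rank_det_zero) auto
  finally show ?thesis using M by (simp add: mat_rank_def)
qed

text \<open>The inner product of \<open>M M^* x\<close> with \<open>x\<close> is the squared norm of
  \<open>M^* x\<close>.\<close>

lemma mult_adjoint_vec_eq_0:
  fixes M :: "complex mat"
  assumes M: "M \<in> carrier_mat n q" and x: "x \<in> carrier_vec n"
    and z: "M *\<^sub>v (mat_adjoint M *\<^sub>v x) = 0\<^sub>v n"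
  shows "mat_adjoint M *\<^sub>v x = 0\<^sub>v q"
proof -
  let ?y = "mat_adjoint M *\<^sub>v x"
  have y: "?y \<in> carrier_vec q" using M x by (meson mat_adjoint_carrier mult_mat_vec_carrier)
  have "(M *\<^sub>v ?y) \<bullet>c x = ?y \<bullet>c ?y"
  proof -
    have "(M *\<^sub>v ?y) \<bullet>c x = (\<Sum>i<n. (\<Sum>j<q. M $$ (i,j) * ?y $ j) * cnj (x $ i))"
      using M x y by (auto simp: scalar_prod_def lessThan_atLeast0 conjugate_complex_def intro!: sum.cong)
    also have "\<dots> = (\<Sum>j<q. ?y $ j * (\<Sum>i<n. M $$ (i,j) * cnj (x $ i)))"
      by (simp add: sum_distrib_left sum_distrib_right) (subst sum.swap, simp add: mult_ac)
    also have "\<dots> = (\<Sum>j<q. ?y $ j * cnj (?y $ j))"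
      using M x by (auto simp: scalar_prod_def lessThan_atLeast0 intro!: sum.cong)
    also have "\<dots> = ?y \<bullet>c ?y"
      using M x by (auto simp: scalar_prod_def lessThan_atLeast0 conjugate_complex_def intro!: sum.cong)
    finally show ?thesis .
  qed
  then have "?y \<bullet>c ?y = 0" using z x by simp
  then show ?thesis using conjugate_square_eq_0_vec[OF y] by simp
qed

text \<open>The Gram matrix \<open>M M^*\<close> has trivial kernel by the preceding lemma, so it is
  invertible, and \<open>M^*\<close> applied to its solutions gives preimages under
  \<open>M\<close>.\<close>

lemma mat_rank_adjoint_injective:
  fixes M :: "complex mat"
  assumes M: "M \<in> carrier_mat n q"
    and inj: "\<And>y. y \<in> carrier_vec n \<Longrightarrow> mat_adjoint M *\<^sub>v y = 0\<^sub>v q \<Longrightarrow> y = 0\<^sub>v n"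
  shows "mat_rank M = n"
proof (rule mat_rank_surjective[OF M])
  fix x :: "complex vec" assume x: "x \<in> carrier_vec n"
  let ?G = "M * mat_adjoint M"
  have G: "?G \<in> carrier_mat n n" using M by auto
  have "det ?G \<noteq> 0"
  proof
    assume "det ?G = 0"
    then obtain y where y: "y \<in> carrier_vec n" "y \<noteq> 0\<^sub>v n" "?G *\<^sub>v y = 0\<^sub>v n"
      using det_0_iff_vec_prod_zero_field[OF G] by auto
    then have "M *\<^sub>v (mat_adjoint M *\<^sub>v y) = 0\<^sub>v n"
      using M by (metis assoc_mult_mat_vec mat_adjoint_carrier)
    then show False using mult_adjoint_vec_eq_0[OF M y(1)] inj y by blast
  qed
  then obtain G' where G': "G' \<in> carrier_mat n n" "?G * G' = 1\<^sub>m n"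
    using det_non_zero_imp_unit[OF G] G by (auto simp: Units_def ring_mat_def)
  have "?G *\<^sub>v (G' *\<^sub>v x) = x"
    using G G' x by (metis assoc_mult_mat_vec one_mult_mat_vec)
  then have "M *\<^sub>v (mat_adjoint M *\<^sub>v (G' *\<^sub>v x)) = x"
    using M G' x by (metis assoc_mult_mat_vec mat_adjoint_carrier mult_mat_vec_carrier)
  moreover have "mat_adjoint M *\<^sub>v (G' *\<^sub>v x) \<in> carrier_vec q"
    using M G' x by (meson mat_adjoint_carrier mult_mat_vec_carrier)
  ultimately show "\<exists>y\<in>carrier_vec q. M *\<^sub>v y = x" by blast
qed

section \<open>One form for the four self-conjugate structures\<close>

fun kind_sign :: "conj_kind \<Rightarrow> complex" where
  "kind_sign Hermitian = 1"
| "kind_sign Skew_Hermitian = -1"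
| "kind_sign Para_Hermitian = 1"
| "kind_sign Para_Skew_Hermitian = -1"

definition kind_twist :: "conj_kind \<Rightarrow> complex" where
  "kind_twist kind = (if is_para kind then -1 else 1)"

lemma kind_sign_twist [simp]:
  "kind_sign kind * kind_sign kind = 1" "kind_twist kind * kind_twist kind = 1"
  "cnj (kind_sign kind) = kind_sign kind" "cnj (kind_twist kind) = kind_twist kind"
  "kind_sign kind \<noteq> 0" "kind_twist kind \<noteq> 0"
  by (cases kind; simp add: kind_twist_def)+

text \<open>Two signs replace the case distinction. Both are real with square 1, and these
  properties carry most of the later sign computations.\<close>

lemma self_conj_iff:
  "self_conj kind M \<longleftrightarrow> square_mat M \<and>
    (\<forall>z. no_pole_at M z \<and> no_pole_at M (kind_twist kind * cnj z) \<longrightarrow>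
      mat_adjoint (rat_mat_at M z) = kind_sign kind \<cdot>\<^sub>m rat_mat_at M (kind_twist kind * cnj z))"
proof -
  have "(1 :: complex) \<cdot>\<^sub>m A = A" "(-1 :: complex) \<cdot>\<^sub>m A = - A" for A
    by (auto intro!: eq_matI)
  then show ?thesis by (cases kind) (simp_all add: kind_twist_def)
qed

section \<open>The expansion around infinity\<close>

definition fls_of_poly :: "complex poly \<Rightarrow> complex fls" where
  "fls_of_poly p = poly (map_poly fls_const p) fls_X_inv"

lemma fls_of_poly_simps [simp]:
  "fls_of_poly 0 = 0" "fls_of_poly 1 = 1"
  "fls_of_poly (pCons c p) = fls_const c + fls_X_inv * fls_of_poly p"
  by (simp_all add: fls_of_poly_def Polynomial.map_poly_pCons)

lemma fls_of_poly_add: "fls_of_poly (p + q) = fls_of_poly p + fls_of_poly q"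
proof (induction p arbitrary: q)
  case (pCons a p)
  then show ?case
    by (cases q) (simp_all add: algebra_simps fls_plus_const[symmetric] del: fls_plus_const)
qed simp

lemma fls_of_poly_smult: "fls_of_poly (Polynomial.smult c p) = fls_const c * fls_of_poly p"
  by (induction p) (simp_all add: algebra_simps fls_const_mult_const[symmetric] del: fls_const_mult_const)

lemma fls_of_poly_mult: "fls_of_poly (p * q) = fls_of_poly p * fls_of_poly q"
  by (induction p) (simp_all add: algebra_simps fls_of_poly_add fls_of_poly_smult)

lemma fls_nth_fls_of_poly_mult:
  assumes "degree p < N"
  shows "fls_nth (fls_of_poly p * f) n = (\<Sum>j<N. coeff p j * fls_nth f (n + int j))"
  using assms
proof (induction p arbitrary: f n N)
  case (pCons a p)
  have shift: "fls_nth (fls_X_inv * g) n = fls_nth g (n + 1)" for g :: "complex fls" and n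
    by (simp add: fls_X_inv_times_conv_shift)
  obtain N' where N: "N = Suc N'" using pCons.prems by (cases N) auto
  have "fls_nth (fls_of_poly (pCons a p) * f) n =
      a * fls_nth f n + fls_nth (fls_of_poly p * f) (n + 1)"
    by (simp add: algebra_simps shift)
  also have "fls_nth (fls_of_poly p * f) (n + 1) = (\<Sum>j<N'. coeff p j * fls_nth f (n + 1 + int j))"
  proof (cases "p = 0")
    case False
    then show ?thesis using pCons N by simp
  qed simp
  also have "a * fls_nth f n + \<dots> = (\<Sum>j<N. coeff (pCons a p) j * fls_nth f (n + int j))"
    unfolding N by (subst sum.lessThan_Suc_shift) (simp add: algebra_simps)
  finally show ?case .
qed simp

lemma fls_nth_fls_of_poly: "fls_nth (fls_of_poly p) n = (if n \<le> 0 then coeff p (nat (- n)) else 0)"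
proof -
  have "fls_nth (fls_of_poly p * 1) n = (\<Sum>j<Suc (degree p). if int j = - n then coeff p j else 0)"
    by (subst fls_nth_fls_of_poly_mult[of p "Suc (degree p)"]) (auto intro!: sum.cong)
  also have "\<dots> = (if n \<le> 0 then coeff p (nat (- n)) else 0)"
  proof (cases "n \<le> 0")
    case True
    then have "int j = - n \<longleftrightarrow> nat (- n) = j" for j by auto
    then have "(\<Sum>j<Suc (degree p). if int j = - n then coeff p j else 0) =
        (\<Sum>j<Suc (degree p). if nat (- n) = j then coeff p j else 0)" by simp
    also have "\<dots> = coeff p (nat (- n))"
      by (subst sum.delta') (auto simp: coeff_eq_0)
    finally show ?thesis using True by simp
  next
    case False
    then show ?thesis by (intro trans[OF sum.neutral]) auto
  qed
  finally show ?thesis by simp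
qed

lemma fls_of_poly_eq_0_iff [simp]: "fls_of_poly p = 0 \<longleftrightarrow> p = 0"
proof
  assume "fls_of_poly p = 0"
  then have "coeff p n = 0" for n
    using fls_nth_fls_of_poly[of p "- int n"] by simp
  then show "p = 0" by (intro poly_eqI) simp
qed simp

text \<open>The expansion is defined through the reduced fraction; cross-multiplication makes it
  independent of the representative.\<close>

lemma laurent_at_infinity_Fract:
  assumes "b \<noteq> 0"
  shows "laurent_at_infinity (Fract a b) = fls_of_poly a / fls_of_poly b"
proof -
  let ?r = "Fract a b"
  let ?c = "fst (quot_of_fract ?r)" and ?d = "snd (quot_of_fract ?r)"
  have "Fract ?c ?d = Fract a b" by simp
  then have "?c * b = a * ?d" using assms by (subst (asm) eq_fract) auto
  then have "fls_of_poly ?c * fls_of_poly b = fls_of_poly a * fls_of_poly ?d"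
    by (metis fls_of_poly_mult)
  then show ?thesis using assms
    by (simp add: laurent_at_infinity_def flip: fls_of_poly_def) (simp add: frac_eq_eq)
qed

lemma laurent_at_infinity_to_fract [simp]: "laurent_at_infinity (to_fract p) = fls_of_poly p"
  unfolding to_fract_def by (simp add: laurent_at_infinity_Fract)

text \<open>A homomorphism of fields is injective, which later allows an identity of rational
  functions to be proved coefficient by coefficient.\<close>

interpretation laurent: field_hom laurent_at_infinity
proof
  show "laurent_at_infinity 0 = 0" "laurent_at_infinity 1 = 1"
    using laurent_at_infinity_to_fract[of 0] laurent_at_infinity_to_fract[of 1] by simp_all
  fix x y :: "complex poly fract"
  obtain a b where x: "x = Fract a b" "b \<noteq> 0" by (cases x) auto
  obtain c d where y: "y = Fract c d" "d \<noteq> 0" by (cases y) auto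
  show "laurent_at_infinity (x * y) = laurent_at_infinity x * laurent_at_infinity y"
    using x y by (simp add: laurent_at_infinity_Fract fls_of_poly_mult)
  show "laurent_at_infinity (x + y) = laurent_at_infinity x + laurent_at_infinity y"
    using x y by (simp add: laurent_at_infinity_Fract fls_of_poly_mult fls_of_poly_add add_frac_eq)
qed

text \<open>With f = a / b starting at index k, the product b f starts at k - degree b, with the
  leading coefficient of b times that of f. For k \<le> 0 this forces degree a \<ge> degree
  b.\<close>

lemma fls_nth_laurent_strictly_proper:
  assumes "r = 0 \<or> degree (fst (quot_of_fract r)) < degree (snd (quot_of_fract r))" "n \<le> 0"
  shows "fls_nth (laurent_at_infinity r) n = 0"
proof (rule ccontr)
  define f where "f = laurent_at_infinity r"
  define a where "a = fst (quot_of_fract r)"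
  define b where "b = snd (quot_of_fract r)"
  assume "fls_nth (laurent_at_infinity r) n \<noteq> 0"
  then have f: "fls_nth f n \<noteq> 0" "f \<noteq> 0" by (auto simp: f_def)
  have b: "b \<noteq> 0" by (simp add: b_def)
  have eq: "fls_of_poly b * f = fls_of_poly a"
    unfolding f_def laurent_at_infinity_def using b
    by (simp add: a_def b_def flip: fls_of_poly_def)
  define k where "k = fls_subdegree f"
  have k: "k \<le> n" using f unfolding k_def by (simp add: fls_subdegree_leI)
  have "fls_nth (fls_of_poly b * f) (k - int (degree b)) =
      (\<Sum>j<Suc (degree b). coeff b j * fls_nth f (k - int (degree b) + int j))"
    by (rule fls_nth_fls_of_poly_mult) simp
  also have "\<dots> = coeff b (degree b) * fls_nth f k"
    by (auto simp: k_def intro!: sum.neutral)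
  also have "\<dots> \<noteq> 0" using b f by (simp add: k_def)
  finally have "fls_nth (fls_of_poly a) (k - int (degree b)) \<noteq> 0" by (simp add: eq)
  then have "degree b \<le> degree a" using k assms(2)
    by (auto simp: fls_nth_fls_of_poly split: if_splits dest!: le_degree)
  then have "r = 0" using assms a_def b_def by auto
  then show False using f by (simp add: f_def)
qed

section \<open>Self-conjugate structure of the Laurent coefficients\<close>

text \<open>For real \<open>s\<close> the value at w is the conjugate of p (s conj w). This turns an
  identity involving conjugation into one between polynomials.\<close>

definition twist_poly :: "complex \<Rightarrow> complex poly \<Rightarrow> complex poly" where
  "twist_poly s p = pcompose (map_poly cnj p) [:0, s:]"

lemma coeff_twist_poly [simp]: "coeff (twist_poly s p) j = s ^ j * cnj (coeff p j)"
  by (simp add: twist_poly_def coeff_pcompose_linear coeff_map_poly)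

lemma poly_map_cnj: "poly (map_poly cnj p) (cnj z) = cnj (poly p z)"
  by (induction p) (simp_all add: Polynomial.map_poly_pCons)

lemma poly_twist_poly:
  assumes "s * s = 1"
  shows "poly (twist_poly s p) (s * cnj z) = cnj (poly p z)"
proof -
  have "(s * cnj z) * s = cnj z" using assms by (metis mult.assoc mult.commute mult_1)
  moreover have "poly [:0, s:] (s * cnj z) = (s * cnj z) * s" by simp
  ultimately show ?thesis unfolding twist_poly_def poly_pcompose by (simp only: poly_map_cnj)
qed

lemma twist_poly_eq_0_iff [simp]: "s \<noteq> 0 \<Longrightarrow> twist_poly s p = 0 \<longleftrightarrow> p = 0"
  by (auto simp: poly_eq_iff)

lemma ex_twist_fls:
  fixes f :: "complex fls"
  obtains g where "\<And>n. fls_nth g n = s powi n * cnj (fls_nth f n)"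
proof
  fix n
  show "fls_nth (Abs_fls (\<lambda>n. s powi n * cnj (fls_nth f n))) n = s powi n * cnj (fls_nth f n)"
    by (rule nth_Abs_fls_lower_bound[where N = "fls_subdegree f"]) auto
qed

text \<open>The twist respects products because the coefficient of lambda^j sits at index -j and s^j
  = s^(-j): hence s^j s^(n+j) = s^n, and the sign leaves the convolution.\<close>

lemma fls_of_poly_twist_mult:
  assumes s: "s * s = 1"
    and g: "\<And>n. fls_nth g n = s powi n * cnj (fls_nth f n)"
    and f: "fls_of_poly y * f = fls_of_poly x"
  shows "fls_of_poly (twist_poly s y) * g = fls_of_poly (twist_poly s x)"
proof (rule fls_eqI)
  fix n
  have s0: "s \<noteq> 0" using s by auto
  have sinv: "inverse s = s" using s s0 by (simp add: field_simps)
  have pw: "s ^ j * s ^ j = 1" for j by (simp add: s flip: power_mult_distrib)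
  define N where "N = Suc (max (degree y) (degree (twist_poly s y)))"
  have "fls_nth (fls_of_poly (twist_poly s y) * g) n =
      (\<Sum>j<N. s ^ j * cnj (coeff y j) * (s powi (n + int j) * cnj (fls_nth f (n + int j))))"
    by (subst fls_nth_fls_of_poly_mult[of _ N]) (auto simp: g N_def)
  also have "\<dots> = (\<Sum>j<N. s powi n * cnj (coeff y j * fls_nth f (n + int j)))"
  proof (rule sum.cong)
    fix j
    have "s ^ j * s powi (n + int j) = s powi n"
      using s0 pw[of j] by (simp add: power_int_add mult_ac)
    then show "s ^ j * cnj (coeff y j) * (s powi (n + int j) * cnj (fls_nth f (n + int j))) =
        s powi n * cnj (coeff y j * fls_nth f (n + int j))"
      by (metis (no_types, lifting) complex_cnj_mult mult.commute mult.left_commute)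
  qed simp
  also have "\<dots> = s powi n * cnj (fls_nth (fls_of_poly y * f) n)"
    by (subst fls_nth_fls_of_poly_mult[of _ N]) (simp_all add: N_def sum_distrib_left del: sum.lessThan_Suc)
  also have "\<dots> = fls_nth (fls_of_poly (twist_poly s x)) n"
    unfolding f by (auto simp: fls_nth_fls_of_poly power_int_def sinv)
  finally show "fls_nth (fls_of_poly (twist_poly s y) * g) n = fls_nth (fls_of_poly (twist_poly s x)) n" .
qed

lemma finite_poles: "finite {z. \<not> no_pole_at R z}"
proof -
  have "finite (\<Union>r \<in> elements_mat R. {z. poly (snd (quot_of_fract r)) z = 0})"
    by (intro finite_UN_I poly_roots_finite) (auto simp: elements_mat_def)
  moreover have "{z. \<not> no_pole_at R z} = (\<Union>r \<in> elements_mat R. {z. poly (snd (quot_of_fract r)) z = 0})"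
    by (auto simp: no_pole_at_def)
  ultimately show ?thesis by simp
qed

text \<open>Values are known only off the poles, but these are finite in number. After clearing
  denominators the identity is one between polynomials that agree at infinitely many points, so it
  holds formally and passes to the Laurent expansions.\<close>

lemma laurent_self_conj:
  assumes R: "R \<in> carrier_mat m m" and sc: "self_conj kind R" and ab: "a < m" "b < m"
  shows "cnj (fls_nth (laurent_at_infinity (R $$ (a, b))) n) =
    kind_sign kind * kind_twist kind powi n * fls_nth (laurent_at_infinity (R $$ (b, a))) n"
proof -
  define s where "s = kind_twist kind"
  define e where "e = kind_sign kind"
  have s: "s * s = 1" "cnj s = s" "s \<noteq> 0" and e: "cnj e = e" by (auto simp: s_def e_def)
  define x where "x = fst (quot_of_fract (R $$ (a, b)))"
  define y where "y = snd (quot_of_fract (R $$ (a, b)))"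
  define x' where "x' = fst (quot_of_fract (R $$ (b, a)))"
  define y' where "y' = snd (quot_of_fract (R $$ (b, a)))"
  have nz: "y \<noteq> 0" "y' \<noteq> 0" by (auto simp: y_def y'_def)
  define B where "B = {z. \<not> no_pole_at R z}"
  \<comment> \<open>Both w and its mirror point s conj w have to avoid the poles, as
    \<open>self_conj\<close> asserts nothing elsewhere.\<close>
  have finB: "finite (B \<union> (\<lambda>z. s * cnj z) -` B)"
  proof (rule finite_UnI)
    show "finite B" unfolding B_def by (rule finite_poles)
    then show "finite ((\<lambda>z. s * cnj z) -` B)"
      by (rule finite_vimageI) (use s in \<open>simp add: inj_def\<close>)
  qed
  have root: "poly (twist_poly s x * y' - Polynomial.smult e (x' * twist_poly s y)) w = 0"
    if w: "w \<notin> B \<union> (\<lambda>z. s * cnj z) -` B" for w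
  proof -
    define z where "z = s * cnj w"
    have "s * cnj z = s * s * w" using s by (simp add: z_def)
    then have wz: "w = s * cnj z" using s by simp
    have good: "no_pole_at R w" "no_pole_at R z" using w by (auto simp: B_def z_def)
    then have "mat_adjoint (rat_mat_at R z) = e \<cdot>\<^sub>m rat_mat_at R w"
      using sc[unfolded self_conj_iff, folded s_def e_def] wz by metis
    then have "mat_adjoint (rat_mat_at R z) $$ (b, a) = (e \<cdot>\<^sub>m rat_mat_at R w) $$ (b, a)" by simp
    then have eq: "cnj (poly x z / poly y z) = e * (poly x' w / poly y' w)"
      using R ab by (simp add: rat_at_def x_def y_def x'_def y'_def)
    have "R $$ (a, b) \<in> elements_mat R" "R $$ (b, a) \<in> elements_mat R" using R ab by auto
    then have ny: "poly y z \<noteq> 0" "poly y' w \<noteq> 0"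
      using good unfolding no_pole_at_def y_def y'_def by auto
    have "cnj (poly x z) * poly y' w = e * poly x' w * cnj (poly y z)"
      using eq ny by (simp add: field_simps)
    moreover have "poly (twist_poly s x) w = cnj (poly x z)" "poly (twist_poly s y) w = cnj (poly y z)"
      by (simp_all add: wz poly_twist_poly[OF s(1)])
    ultimately show ?thesis by simp
  qed
  have id: "twist_poly s x * y' = Polynomial.smult e (x' * twist_poly s y)"
  proof (rule ccontr)
    assume "\<not> ?thesis"
    then have "finite {w. poly (twist_poly s x * y' - Polynomial.smult e (x' * twist_poly s y)) w = 0}"
      by (intro poly_roots_finite) simp
    moreover have "UNIV = (B \<union> (\<lambda>z. s * cnj z) -` B) \<union>
        {w. poly (twist_poly s x * y' - Polynomial.smult e (x' * twist_poly s y)) w = 0}"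
      using root by auto
    ultimately have "finite (UNIV :: complex set)" using finB by (metis finite_UnI)
    then show False by (simp add: infinite_UNIV_char_0)
  qed
  define f where "f = laurent_at_infinity (R $$ (a, b))"
  define f' where "f' = laurent_at_infinity (R $$ (b, a))"
  have f: "fls_of_poly y * f = fls_of_poly x" and f': "fls_of_poly y' * f' = fls_of_poly x'"
    unfolding f_def f'_def laurent_at_infinity_def using nz
    by (simp_all add: x_def y_def x'_def y'_def flip: fls_of_poly_def)
  obtain g where g: "\<And>n. fls_nth g n = s powi n * cnj (fls_nth f n)" using ex_twist_fls by blast
  have tw: "fls_of_poly (twist_poly s y) * g = fls_of_poly (twist_poly s x)"
    by (rule fls_of_poly_twist_mult[OF s(1) g f])
  have "fls_of_poly (twist_poly s y) * fls_of_poly y' * g = fls_of_poly (twist_poly s x * y')"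
    using tw by (simp add: fls_of_poly_mult mult_ac)
  also have "\<dots> = fls_of_poly (twist_poly s y) * fls_of_poly y' * (fls_const e * f')"
    unfolding id fls_of_poly_smult fls_of_poly_mult f'[symmetric] by (simp add: mult_ac)
  finally have "g = fls_const e * f'" using nz s by simp
  then have "fls_nth g n = e * fls_nth f' n" by simp
  then have "s powi n * (s powi n * cnj (fls_nth f n)) = s powi n * (e * fls_nth f' n)" by (simp add: g)
  moreover have "s powi n * s powi n = 1" by (simp add: s flip: power_int_mult_distrib)
  ultimately show ?thesis
    unfolding f_def f'_def s_def e_def by (metis mult.assoc mult.commute mult_1)
qed

text \<open>The strictly proper summand contributes nothing at index -k, so coefficients of
  \<open>P\<close> are Laurent coefficients of the whole sum; the structure is inherited without
  comparing values of the two parts.\<close>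

lemma coeff_self_conj:
  assumes P: "P \<in> carrier_mat m m" and Q: "Q \<in> carrier_mat m m" and sp: "strictly_proper Q"
    and sc: "self_conj kind (rat_mat P + Q)" and ab: "a < m" "b < m"
  shows "cnj (coeff (P $$ (a, b)) k) = kind_sign kind * kind_twist kind ^ k * coeff (P $$ (b, a)) k"
proof -
  have "fls_nth (laurent_at_infinity ((rat_mat P + Q) $$ (i, j))) (- int k) = coeff (P $$ (i, j)) k"
    if "i < m" "j < m" for i j
  proof -
    have "Q $$ (i, j) \<in> elements_mat Q" using Q that by auto
    then have "fls_nth (laurent_at_infinity (Q $$ (i, j))) (- int k) = 0"
      using sp by (intro fls_nth_laurent_strictly_proper) (auto simp: strictly_proper_def)
    then show ?thesis using P Q that by (simp add: laurent.hom_add fls_nth_fls_of_poly)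
  qed
  moreover have "inverse (kind_twist kind) = kind_twist kind"
    by (cases "is_para kind") (simp_all add: kind_twist_def)
  ultimately show ?thesis
    using laurent_self_conj[of "rat_mat P + Q" m kind a b "- int k"] P Q sc ab
    by (simp add: power_int_minus flip: power_inverse)
qed

lemma laurent_coeff_self_conj:
  assumes P: "P \<in> carrier_mat m m" and Q: "Q \<in> carrier_mat m m"
    and sc: "self_conj kind (rat_mat P + Q)" and ab: "a < m" "b < m" and k: "0 < k"
  shows "cnj (laurent_coeff_mat Q k $$ (a, b)) =
    kind_sign kind * kind_twist kind ^ k * laurent_coeff_mat Q k $$ (b, a)"
proof -
  have "fls_nth (laurent_at_infinity ((rat_mat P + Q) $$ (i, j))) (int k) = laurent_coeff_mat Q k $$ (i, j)"
    if "i < m" "j < m" for i j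
    using P Q that k by (simp add: laurent.hom_add fls_nth_fls_of_poly laurent_coeff_mat_def)
  then show ?thesis
    using laurent_self_conj[of "rat_mat P + Q" m kind a b "int k"] P Q sc ab by simp
qed

section \<open>Compressed block Hankel matrices\<close>

lemma mult_mat_assoc:
  fixes A B C :: "'a :: semiring_0 mat"
  assumes "dim_col A = dim_row B" "dim_col B = dim_row C"
  shows "A * B * C = A * (B * C)"
  using assms by (intro assoc_mult_mat) auto

lemma smult_mat_mult:
  fixes A B :: "'a :: comm_semiring_0 mat"
  assumes "dim_col A = dim_row B"
  shows "(c \<cdot>\<^sub>m A) * B = c \<cdot>\<^sub>m (A * B)" "A * (c \<cdot>\<^sub>m B) = c \<cdot>\<^sub>m (A * B)"
  using assms
  by (intro mult_smult_assoc_mat mult_smult_distrib carrier_matI; simp)+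

lemma ex_inverse_mat:
  fixes A :: "'a :: field mat"
  assumes A: "A \<in> carrier_mat n n" and d: "det A \<noteq> 0"
  obtains B where "B \<in> carrier_mat n n" "A * B = 1\<^sub>m n" "B * A = 1\<^sub>m n"
  using det_non_zero_imp_unit[OF A d] by (auto simp: Units_def ring_mat_def)

text \<open>The map \<open>\<beta>\<close> orders the blocks: the identity for the strictly proper part and the reversal
  for the polynomial part. With \<open>s = -1\<close>, the diagonal sign matrix \<open>S\<close> of the para structures is
  \<open>twist_diag\<close>; with \<open>s = 1\<close> it is the identity, so that \<open>U = S V\<close> in all four cases.\<close>

definition block_hankel :: "nat \<Rightarrow> nat \<Rightarrow> (nat \<Rightarrow> nat) \<Rightarrow> (nat \<Rightarrow> nat \<Rightarrow> nat \<Rightarrow> complex) \<Rightarrow> complex mat" where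
  "block_hankel m k \<beta> h =
    mat (k * m) (k * m) (\<lambda>(x, y). h (\<beta> (x div m) + \<beta> (y div m)) (x mod m) (y mod m))"

definition twist_diag :: "nat \<Rightarrow> nat \<Rightarrow> (nat \<Rightarrow> nat) \<Rightarrow> complex \<Rightarrow> complex mat" where
  "twist_diag m k \<beta> s = mat (k * m) (k * m) (\<lambda>(x, y). if x = y then s ^ Suc (\<beta> (x div m)) else 0)"

lemma block_hankel_carrier [simp]: "block_hankel m k \<beta> h \<in> carrier_mat (k * m) (k * m)"
  and dim_block_hankel [simp]: "dim_row (block_hankel m k \<beta> h) = k * m" "dim_col (block_hankel m k \<beta> h) = k * m"
  and twist_diag_carrier [simp]: "twist_diag m k \<beta> s \<in> carrier_mat (k * m) (k * m)"
  and dim_twist_diag [simp]: "dim_row (twist_diag m k \<beta> s) = k * m" "dim_col (twist_diag m k \<beta> s) = k * m"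
  by (simp_all add: block_hankel_def twist_diag_def)

lemma index_block_mat:
  assumes "x < k * m"
  shows "x div m < k" "x mod m < (m :: nat)"
proof -
  show "x div m < k" using assms by (rule less_mult_imp_div_less)
  show "x mod m < m" using assms by (cases "m = 0") auto
qed

lemma index_twist_diag_mult:
  assumes "V \<in> carrier_mat (k * m) r" "x < k * m" "w < r"
  shows "(twist_diag m k \<beta> s * V) $$ (x, w) = s ^ Suc (\<beta> (x div m)) * V $$ (x, w)"
proof -
  have "(twist_diag m k \<beta> s * V) $$ (x, w) =
      (\<Sum>y = 0..<k * m. (if x = y then s ^ Suc (\<beta> (x div m)) else 0) * V $$ (y, w))"
    using assms by (auto simp: scalar_prod_def twist_diag_def intro!: sum.cong)
  also have "\<dots> = (\<Sum>y = 0..<k * m. if x = y then s ^ Suc (\<beta> (x div m)) * V $$ (x, w) else 0)"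
    by (intro sum.cong) auto
  also have "\<dots> = s ^ Suc (\<beta> (x div m)) * V $$ (x, w)" using assms by simp
  finally show ?thesis .
qed

text \<open>Since \<open>U = S V\<close>, the compression is \<open>V^* (S H) V\<close>, and the
  signs in \<open>S\<close> make \<open>S H\<close> self-adjoint up to \<open>e\<close>: conjugating
  the block at (x, y) produces s^(\<beta> x + \<beta> y), which turns the row sign of y into that of
  x.\<close>

lemma mat_adjoint_compression:
  assumes V: "V \<in> carrier_mat (k * m) r" and s: "s * s = 1" "cnj s = s"
    and h: "\<And>n a b. a < m \<Longrightarrow> b < m \<Longrightarrow> cnj (h n a b) = e * s ^ n * h n b a"
    and U: "U = twist_diag m k \<beta> s * V"
    and K: "K = mat_adjoint U * block_hankel m k \<beta> h * V"
  shows "mat_adjoint K = e \<cdot>\<^sub>m K"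
proof -
  let ?S = "twist_diag m k \<beta> s" and ?H = "block_hankel m k \<beta> h"
  note [simp] = carrier_matD[OF V]
  have S: "mat_adjoint ?S = ?S" using s by (intro eq_matI) (auto simp: twist_diag_def)
  have SH: "mat_adjoint (?S * ?H) = e \<cdot>\<^sub>m (?S * ?H)"
  proof (rule eq_matI)
    fix x y assume "x < dim_row (e \<cdot>\<^sub>m (?S * ?H))" "y < dim_col (e \<cdot>\<^sub>m (?S * ?H))"
    then have xy: "x < k * m" "y < k * m" by auto
    note xy' = index_block_mat[OF xy(1)] index_block_mat[OF xy(2)]
    have SHi: "(?S * ?H) $$ (i, j) = s ^ Suc (\<beta> (i div m)) * h (\<beta> (i div m) + \<beta> (j div m)) (i mod m) (j mod m)"
      if "i < k * m" "j < k * m" for i j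
      using index_twist_diag_mult[OF block_hankel_carrier that] that by (simp add: block_hankel_def)
    have pw: "s ^ j * s ^ j = 1" for j by (simp add: s flip: power_mult_distrib)
    have "mat_adjoint (?S * ?H) $$ (x, y) = s ^ Suc (\<beta> (y div m)) *
        (e * s ^ (\<beta> (y div m) + \<beta> (x div m)) * h (\<beta> (x div m) + \<beta> (y div m)) (x mod m) (y mod m))"
      using xy xy' by (simp add: SHi h s add.commute del: index_mult_mat(1))
    also have "\<dots> = s * s ^ \<beta> (x div m) * (s ^ \<beta> (y div m) * s ^ \<beta> (y div m)) *
        (e * h (\<beta> (x div m) + \<beta> (y div m)) (x mod m) (y mod m))"
      by (simp add: power_add mult_ac)
    also have "\<dots> = (e \<cdot>\<^sub>m (?S * ?H)) $$ (x, y)"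
      unfolding pw using xy by (simp add: SHi mult_ac del: index_mult_mat(1))
    finally show "mat_adjoint (?S * ?H) $$ (x, y) = (e \<cdot>\<^sub>m (?S * ?H)) $$ (x, y)" .
  qed auto
  have K': "K = mat_adjoint V * (?S * ?H) * V"
    unfolding K U by (subst mat_adjoint_mult[of _ "k * m" "k * m" _ r]) (simp_all add: S V mult_mat_assoc)
  have "mat_adjoint K = mat_adjoint V * (mat_adjoint (?S * ?H) * V)"
    unfolding K'
    by (subst mat_adjoint_mult[of _ r "k * m" _ r], (use V in auto)[2],
        subst mat_adjoint_mult[of _ r "k * m" _ "k * m"]) (use V in \<open>auto simp: mult_mat_assoc\<close>)
  also have "\<dots> = e \<cdot>\<^sub>m K"
    unfolding SH K' using V
    by (simp add: mult_mat_assoc smult_mat_mult)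
  finally show ?thesis .
qed

text \<open>The common outcome of both compressions, freed of \<open>U\<close>, \<open>V\<close> and
  the block order. \<open>v\<close> is the adjoint of the block of \<open>V\<close> at Hankel index
  0, and the block of \<open>U\<close> at that index is \<open>u 0\<close>, so
  \<open>adjoint_v\<close> is the relation \<open>U = S V\<close> there. The additional
  \<open>s\<close> in \<open>adjoint_F\<close> comes from the index shift.\<close>

locale hankel_realization =
  fixes m r :: nat and s e :: complex and h :: "nat \<Rightarrow> nat \<Rightarrow> nat \<Rightarrow> complex"
    and H F v :: "complex mat" and u :: "nat \<Rightarrow> complex mat"
  assumes H_carrier: "H \<in> carrier_mat r r" and F_carrier: "F \<in> carrier_mat r r"
    and v_carrier: "v \<in> carrier_mat r m" and u_carrier: "u n \<in> carrier_mat m r"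
    and det_H: "det H \<noteq> 0"
    and step: "u (Suc n) * H = u n * F"
    and val: "a < m \<Longrightarrow> b < m \<Longrightarrow> h n a b = (u n * H * v) $$ (a, b)"
    and observable: "y \<in> carrier_vec r \<Longrightarrow> (\<And>n. u n *\<^sub>v y = 0\<^sub>v m) \<Longrightarrow> y = 0\<^sub>v r"
    and adjoint_v: "mat_adjoint v = s \<cdot>\<^sub>m u 0"
    and adjoint_H: "mat_adjoint H = e \<cdot>\<^sub>m H"
    and adjoint_F: "mat_adjoint F = (e * s) \<cdot>\<^sub>m F"

text \<open>The functions \<open>o'\<close> and \<open>c\<close> factor the infinite Hankel matrix, and \<open>u n\<close> is the \<open>n\<close>-th block row
  of the left factor after the change of basis \<open>(U\<^sup>* O)\<^sup>-\<^sup>1\<close>, which makes it extend the blocks of \<open>U\<close>.\<close>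

lemma hankel_realizationI:
  fixes h :: "nat \<Rightarrow> nat \<Rightarrow> nat \<Rightarrow> complex" and o' c :: "nat \<Rightarrow> nat \<Rightarrow> nat \<Rightarrow> complex"
  assumes s: "s * s = 1" "cnj s = s"
    and h: "\<And>n a b. a < m \<Longrightarrow> b < m \<Longrightarrow> cnj (h n a b) = e * s ^ n * h n b a"
    and factor: "\<And>n n' a b. a < m \<Longrightarrow> b < m \<Longrightarrow> h (n + n') a b = (\<Sum>w = 0..<r. o' n a w * c w n' b)"
    and V: "V \<in> carrier_mat (k * m) r" and U: "U = twist_diag m k \<beta> s * V"
    and orth: "mat_adjoint U * U = 1\<^sub>m r" "mat_adjoint V * V = 1\<^sub>m r"
    and H: "H \<in> carrier_mat r r" "det H \<noteq> 0"
    and HV: "block_hankel m k \<beta> h * V = U * H"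
    and UH: "mat_adjoint U * block_hankel m k \<beta> h = H * mat_adjoint V"
    and F: "F = mat_adjoint U * block_hankel m k \<beta> (\<lambda>n. h (Suc n)) * V"
    and z: "z < k" "\<beta> z = 0"
    and v: "v = mat r m (\<lambda>(w, b). cnj (V $$ (z * m + b, w)))"
  shows "\<exists>u. hankel_realization m r s e h H F v u \<and>
    (\<forall>x<k * m. \<forall>w<r. U $$ (x, w) = u (\<beta> (x div m)) $$ (x mod m, w)) \<and>
    (\<forall>n. (\<forall>a<m. \<forall>w<r. o' n a w = 0) \<longrightarrow> u n = 0\<^sub>m m r)"
proof -
  let ?N = "k * m"
  let ?H = "block_hankel m k \<beta> h" and ?Hs = "block_hankel m k \<beta> (\<lambda>n. h (Suc n))"
  have U_carrier: "U \<in> carrier_mat ?N r" unfolding U using V by (rule mult_carrier_mat[OF twist_diag_carrier])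
  define Ob where "Ob = mat ?N r (\<lambda>(x, w). o' (\<beta> (x div m)) (x mod m) w)"
  define Co where "Co = mat r ?N (\<lambda>(w, y). c w (\<beta> (y div m)) (y mod m))"
  define Co' where "Co' = mat r ?N (\<lambda>(w, y). c w (Suc (\<beta> (y div m))) (y mod m))"
  define ob where "ob n = mat m r (\<lambda>(a, w). o' n a w)" for n
  define co where "co = mat r m (\<lambda>(w, b). c w 0 b)"
  have carr [simp]: "Ob \<in> carrier_mat ?N r" "Co \<in> carrier_mat r ?N" "Co' \<in> carrier_mat r ?N"
    "ob n \<in> carrier_mat m r" "co \<in> carrier_mat r m" "v \<in> carrier_mat r m" for n
    by (simp_all add: Ob_def Co_def Co'_def ob_def co_def v)
  have dims [simp]: "dim_row V = ?N" "dim_col V = r" "dim_row U = ?N" "dim_col U = r"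
    "dim_row H = r" "dim_col H = r" "dim_row F = r" "dim_col F = r"
    "dim_row Ob = ?N" "dim_col Ob = r" "dim_row Co = r" "dim_col Co = ?N"
    "dim_row Co' = r" "dim_col Co' = ?N" "dim_row (ob n) = m" "dim_col (ob n) = r"
    "dim_row co = r" "dim_col co = m" "dim_row v = r" "dim_col v = m" for n
    using V U_carrier H by (auto simp: F Ob_def Co_def Co'_def ob_def co_def v)
  note assoc = mult_mat_assoc
  note idx = index_block_mat
  have zb: "z * m + b < ?N" "(z * m + b) div m = z" "(z * m + b) mod m = b" if "b < m" for b
  proof -
    have "z * m + b < Suc z * m" using that by simp
    also have "\<dots> \<le> ?N" using z by (intro mult_right_mono) auto
    finally show "z * m + b < ?N" .
  qed (use that in auto)
  have HOC: "?H = Ob * Co"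
    by (rule eq_matI) (auto simp: block_hankel_def Ob_def Co_def scalar_prod_def factor idx)
  have HsOC: "?Hs = Ob * Co'"
    by (rule eq_matI)
      (auto simp: block_hankel_def Ob_def Co'_def scalar_prod_def idx simp flip: factor)
  have shift: "ob (Suc n) * Co = ob n * Co'" for n
    by (rule eq_matI)
      (auto simp: ob_def Co_def Co'_def scalar_prod_def idx simp flip: factor)
  have Oc: "(Ob * co) $$ (x, b) = ?H $$ (x, z * m + b)" if "x < ?N" "b < m" for x b
    using that zb[of b] z
    by (auto simp: block_hankel_def Ob_def co_def scalar_prod_def idx simp flip: factor)
  define X where "X = mat_adjoint U * Ob"
  define Y where "Y = Co * V"
  have X: "X \<in> carrier_mat r r" and Y: "Y \<in> carrier_mat r r"
    unfolding X_def Y_def by (auto intro!: carrier_matI)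
  \<comment> \<open>\<open>X\<close> and \<open>Y\<close> are square because the factorization has
    the inner dimension of \<open>H\<close>, so \<open>det H \<noteq> 0\<close> will make
    \<open>X\<close> invertible.\<close>
  have XY: "X * Y = H"
  proof -
    have "X * Y = mat_adjoint U * (?H * V)" by (simp add: X_def Y_def HOC assoc)
    also have "\<dots> = mat_adjoint U * U * H" by (simp add: HV assoc)
    finally show ?thesis using orth H by simp
  qed
  have "det X * det Y = det H" using det_mult[OF X Y] XY by simp
  then have "det X \<noteq> 0" using H by auto
  then obtain Xi where Xi: "Xi \<in> carrier_mat r r" "X * Xi = 1\<^sub>m r" "Xi * X = 1\<^sub>m r"
    using ex_inverse_mat[OF X] by blast
  obtain Hi where Hi: "Hi \<in> carrier_mat r r" "H * Hi = 1\<^sub>m r"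
    using ex_inverse_mat[OF H] by blast
  have dims' [simp]: "dim_row X = r" "dim_col X = r" "dim_row Y = r" "dim_col Y = r"
    "dim_row Xi = r" "dim_col Xi = r" "dim_row Hi = r" "dim_col Hi = r"
    using X Y Xi Hi by auto
  have XiH: "Xi * H = Y"
  proof -
    have "Xi * H = Xi * X * Y" by (simp add: XY[symmetric] assoc)
    then show ?thesis using Xi Y by simp
  qed
  define u where "u n = ob n * Xi" for n
  have u_carrier: "u n \<in> carrier_mat m r" for n by (auto simp: u_def intro!: carrier_matI)
  \<comment> \<open>Both \<open>H = X Co V\<close> and \<open>F = X Co' V\<close> begin with
    \<open>X\<close>, which \<open>Xi\<close> cancels; the shift relation between \<open>Co\<close>
    and \<open>Co'\<close> remains.\<close>
  have step: "u (Suc n) * H = u n * F" for n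
  proof -
    have "u (Suc n) * H = ob (Suc n) * Co * V" by (simp add: u_def assoc XiH Y_def)
    also have "\<dots> = ob n * (1\<^sub>m r * (Co' * V))" by (simp add: shift assoc)
    also have "\<dots> = u n * F" unfolding Xi(3)[symmetric] by (simp add: u_def F HsOC X_def assoc)
    finally show ?thesis .
  qed
  \<comment> \<open>The basis was chosen for this: over the finite block range the left factor
    becomes \<open>U\<close>, whose orthonormal columns then give observability.\<close>
  have UO: "U = Ob * Xi"
  proof -
    have "U = U * (H * Hi)" using Hi U_carrier by simp
    also have "\<dots> = ?H * V * Hi" by (simp add: HV assoc)
    also have "\<dots> = Ob * (Xi * H) * Hi" unfolding XiH by (simp add: HOC Y_def assoc)
    also have "\<dots> = Ob * Xi * (H * Hi)" by (simp add: assoc)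
    also have "\<dots> = Ob * Xi" using Hi Xi by (simp add: assoc)
    finally show ?thesis .
  qed
  have Uu: "U $$ (x, w) = u (\<beta> (x div m)) $$ (x mod m, w)" if "x < ?N" "w < r" for x w
    unfolding UO u_def using that idx[OF that(1)] by (simp add: scalar_prod_def Ob_def ob_def)
  \<comment> \<open>As \<beta> vanishes at \<open>z\<close>, block column \<open>z\<close> of the
    Hankel matrix is \<open>Ob co\<close>. Multiplied by \<open>U^*\<close> it is also block column
    \<open>z\<close> of \<open>H V^*\<close>, which is \<open>H v\<close>.\<close>
  have Xc: "X * co = H * v"
  proof (rule eq_matI)
    fix w b assume "w < dim_row (H * v)" "b < dim_col (H * v)"
    then have wb: "w < r" "b < m" by auto
    have "(X * co) $$ (w, b) = (mat_adjoint U * (Ob * co)) $$ (w, b)" by (simp add: X_def assoc)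
    also have "\<dots> = (mat_adjoint U * ?H) $$ (w, z * m + b)"
      using wb zb by (auto simp: scalar_prod_def Oc simp del: index_mult_mat(1) intro!: sum.cong)
        (auto simp: scalar_prod_def Oc[symmetric] intro!: sum.cong)
    also have "\<dots> = (H * v) $$ (w, b)"
      unfolding UH using wb zb by (simp add: scalar_prod_def v)
    finally show "(X * co) $$ (w, b) = (H * v) $$ (w, b)" .
  qed auto
  have val: "h n a b = (u n * H * v) $$ (a, b)" if "a < m" "b < m" for n a b
  proof -
    have "u n * H * v = ob n * ((Xi * X) * co)" by (simp add: u_def assoc Xc)
    then have "u n * H * v = ob n * co" using Xi by simp
    then show ?thesis using factor[OF that, of n 0] that by (simp add: ob_def co_def scalar_prod_def)
  qed
  have obs: "y = 0\<^sub>v r" if y: "y \<in> carrier_vec r" and 0: "\<And>n. u n *\<^sub>v y = 0\<^sub>v m" for y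
  proof -
    have "U *\<^sub>v y = 0\<^sub>v ?N"
    proof (rule eq_vecI)
      fix x assume "x < dim_vec (0\<^sub>v ?N)"
      then have x: "x < ?N" by simp
      have "(U *\<^sub>v y) $ x = (u (\<beta> (x div m)) *\<^sub>v y) $ (x mod m)"
        using x y idx[OF x] u_carrier[of "\<beta> (x div m)"] by (auto simp: scalar_prod_def Uu)
      then show "(U *\<^sub>v y) $ x = 0\<^sub>v ?N $ x" using x idx[OF x] by (simp add: 0)
    qed simp
    then have "(mat_adjoint U * U) *\<^sub>v y = mat_adjoint U *\<^sub>v 0\<^sub>v ?N"
      using y U_carrier by (simp add: assoc_mult_mat_vec[of _ r ?N _ r])
    also have "\<dots> = 0\<^sub>v r" using U_carrier by (intro eq_vecI) (auto simp: scalar_prod_def)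
    finally show ?thesis using y by (simp add: orth)
  qed
  \<comment> \<open>At block \<open>z\<close> the exponent \<open>Suc (\<beta> z)\<close> is 1, so
    \<open>U\<close> and \<open>V\<close> differ there by the factor \<open>s\<close>.\<close>
  have vadj: "mat_adjoint v = s \<cdot>\<^sub>m u 0"
  proof (rule eq_matI)
    fix a w assume "a < dim_row (s \<cdot>\<^sub>m u 0)" "w < dim_col (s \<cdot>\<^sub>m u 0)"
    then have aw: "a < m" "w < r" using u_carrier[of 0] by auto
    have "u 0 $$ (a, w) = U $$ (z * m + a, w)" using Uu zb[OF aw(1)] aw z by simp
    also have "\<dots> = s * V $$ (z * m + a, w)"
      unfolding U using index_twist_diag_mult[OF V zb(1)[OF aw(1)] aw(2)] zb[OF aw(1)] z by simp
    finally show "mat_adjoint v $$ (a, w) = (s \<cdot>\<^sub>m u 0) $$ (a, w)"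
      using aw u_carrier[of 0] s by (simp add: v mult.assoc[symmetric])
  qed (use u_carrier[of 0] in auto)
  have F_carrier: "F \<in> carrier_mat r r" by (rule carrier_matI) simp_all
  have HK: "H = mat_adjoint U * block_hankel m k \<beta> h * V"
    using XY by (simp add: X_def Y_def HOC assoc)
  have Hadj: "mat_adjoint H = e \<cdot>\<^sub>m H"
    by (rule mat_adjoint_compression[OF V s h U HK])
  have Fadj: "mat_adjoint F = (e * s) \<cdot>\<^sub>m F"
    by (rule mat_adjoint_compression[OF V s _ U F]) (simp add: h mult_ac)
  have "hankel_realization m r s e h H F v u"
    by (rule hankel_realization.intro) (fact H F_carrier carr u_carrier step val obs vadj Hadj Fadj)+
  moreover have "u n = 0\<^sub>m m r" if "\<forall>a<m. \<forall>w<r. o' n a w = 0" for n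
  proof -
    have "ob n = 0\<^sub>m m r" using that by (auto simp: ob_def)
    then show ?thesis using Xi by (simp add: u_def)
  qed
  ultimately show ?thesis using Uu by blast
qed

section \<open>Pencils\<close>

lemma smult_zero_vec [simp]: "c \<cdot>\<^sub>v 0\<^sub>v n = (0\<^sub>v n :: 'a :: mult_zero vec)"
  by (intro eq_vecI) auto

context hankel_realization
begin

lemmas dims [simp] = carrier_matD[OF H_carrier] carrier_matD[OF F_carrier] carrier_matD[OF v_carrier]
  carrier_matD[OF u_carrier]

lemma H_injective:
  assumes "y \<in> carrier_vec r" "H *\<^sub>v y = 0\<^sub>v r"
  shows "y = 0\<^sub>v r"
  using assms det_H det_0_iff_vec_prod_zero_field[OF H_carrier] by blast

lemma step_vec:
  assumes "y \<in> carrier_vec r"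
  shows "u (Suc n) *\<^sub>v (H *\<^sub>v y) = u n *\<^sub>v (F *\<^sub>v y)"
  using assms H_carrier F_carrier u_carrier step by (metis assoc_mult_mat_vec)

lemma pencil_observable:
  assumes y: "y \<in> carrier_vec r" and F: "F *\<^sub>v y = c \<cdot>\<^sub>v (H *\<^sub>v y)" and 0: "u 0 *\<^sub>v (H *\<^sub>v y) = 0\<^sub>v m"
  shows "y = 0\<^sub>v r"
proof -
  have Hy: "H *\<^sub>v y \<in> carrier_vec r" using H_carrier y by simp
  have "u n *\<^sub>v (H *\<^sub>v y) = 0\<^sub>v m" for n
  proof (induction n)
    case (Suc n)
    have "u (Suc n) *\<^sub>v (H *\<^sub>v y) = c \<cdot>\<^sub>v (u n *\<^sub>v (H *\<^sub>v y))"
      using mult_mat_vec[OF u_carrier Hy] by (simp add: step_vec[OF y] F)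
    then show ?case by (simp add: Suc)
  qed (rule 0)
  then show ?thesis using H_injective[OF y] observable[OF Hy] by blast
qed

text \<open>The recursion is read backwards: on \<open>H y\<close>, \<open>u n\<close> is
  \<open>c\<close> times \<open>u (Suc n)\<close>, so the induction descends from \<open>k\<close>
  and no output condition enters. As \<open>c\<close> is arbitrary, \<open>\<lambda> F - H\<close>
  has no finite eigenvalue.\<close>

lemma pencil_nilpotent:
  assumes u: "\<And>n. n \<ge> k \<Longrightarrow> u n = 0\<^sub>m m r"
    and y: "y \<in> carrier_vec r" and F: "H *\<^sub>v y = c \<cdot>\<^sub>v (F *\<^sub>v y)"
  shows "y = 0\<^sub>v r"
proof -
  have Hy: "H *\<^sub>v y \<in> carrier_vec r" and Fy: "F *\<^sub>v y \<in> carrier_vec r"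
    using H_carrier F_carrier y by simp_all
  have pull: "u n *\<^sub>v (H *\<^sub>v y) = c \<cdot>\<^sub>v (u (Suc n) *\<^sub>v (H *\<^sub>v y))" for n
    by (metis F mult_mat_vec[OF u_carrier Fy] step_vec[OF y])
  have "u n *\<^sub>v (H *\<^sub>v y) = 0\<^sub>v m" for n
  proof (induction "k - n" arbitrary: n)
    case 0
    then have "u n = 0\<^sub>m m r" by (intro u) simp
    then show ?case using Hy by (intro eq_vecI) (auto simp: scalar_prod_def)
  next
    case (Suc d)
    have "u n *\<^sub>v (H *\<^sub>v y) = c \<cdot>\<^sub>v (u (Suc n) *\<^sub>v (H *\<^sub>v y))" by (rule pull)
    also have "u (Suc n) *\<^sub>v (H *\<^sub>v y) = 0\<^sub>v m" using Suc by (intro Suc(1)) simp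
    finally show ?case by simp
  qed
  then show ?thesis using H_injective[OF y] observable[OF Hy] by blast
qed

end

text \<open>The coefficient of lambda comes first. Keeping the two coefficients apart reduces
  values, leading coefficients and adjoints of pencils to constant matrices.\<close>

definition pencil :: "complex mat \<Rightarrow> complex mat \<Rightarrow> complex poly mat" where
  "pencil M1 M0 = mat (dim_row M1) (dim_col M1) (\<lambda>(i, j). [:M0 $$ (i, j), M1 $$ (i, j):])"

lemma dim_pencil [simp]: "dim_row (pencil M1 M0) = dim_row M1" "dim_col (pencil M1 M0) = dim_col M1"
  by (simp_all add: pencil_def)

lemma index_pencil [simp]:
  "i < dim_row M1 \<Longrightarrow> j < dim_col M1 \<Longrightarrow> pencil M1 M0 $$ (i, j) = [:M0 $$ (i, j), M1 $$ (i, j):]"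
  by (simp add: pencil_def)

lemma pencil_carrier [simp, intro]: "M1 \<in> carrier_mat n k \<Longrightarrow> pencil M1 M0 \<in> carrier_mat n k"
  by (auto intro!: carrier_matI)

text \<open>The factor 1 is kept so that this and the next lemma are both instances of
  \<open>a \<cdot>\<^sub>m M1 + b \<cdot>\<^sub>m M0\<close>, at \<open>(z, 1)\<close> and at
  \<open>(1, 0)\<close>.\<close>

lemma poly_mat_at_pencil:
  assumes "M1 \<in> carrier_mat n k" "M0 \<in> carrier_mat n k"
  shows "poly_mat_at (pencil M1 M0) z = z \<cdot>\<^sub>m M1 + 1 \<cdot>\<^sub>m M0"
  using assms by (intro eq_matI) auto

lemma coeff_mat_pencil:
  assumes "M1 \<in> carrier_mat n k" "M0 \<in> carrier_mat n k"
  shows "coeff_mat (pencil M1 M0) 1 = 1 \<cdot>\<^sub>m M1 + 0 \<cdot>\<^sub>m M0"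
  using assms by (intro eq_matI) auto

lemma finite_degrees: "finite (insert 0 (degree ` elements_mat M))"
  by (simp add: elements_mat_def)

lemma poly_mat_degree_pencil_le: "poly_mat_degree (pencil M1 M0) \<le> 1"
  unfolding poly_mat_degree_def
  by (subst Max_le_iff[OF finite_degrees]) (auto simp: elements_mat_def)

lemma poly_mat_degree_pencil:
  assumes M: "M1 \<in> carrier_mat n k" and nz: "M1 \<noteq> 0\<^sub>m n k"
  shows "poly_mat_degree (pencil M1 M0) = 1"
proof -
  obtain i j where ij: "i < n" "j < k" "M1 $$ (i, j) \<noteq> 0"
  proof (rule ccontr)
    assume "\<not> thesis"
    then have "M1 = 0\<^sub>m n k" using M that by (intro eq_matI) auto
    then show False using nz by simp
  qed
  have "pencil M1 M0 $$ (i, j) \<in> elements_mat (pencil M1 M0)" using M ij by auto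
  then have "degree (pencil M1 M0 $$ (i, j)) \<le> poly_mat_degree (pencil M1 M0)"
    unfolding poly_mat_degree_def by (intro Max_ge[OF finite_degrees]) auto
  then show ?thesis using ij M poly_mat_degree_pencil_le[of M1 M0] by simp
qed

lemma four_block_pencil:
  assumes "A1 \<in> carrier_mat nr1 nc1" "B1 \<in> carrier_mat nr1 nc2" "C1 \<in> carrier_mat nr2 nc1" "D1 \<in> carrier_mat nr2 nc2"
    "A0 \<in> carrier_mat nr1 nc1" "B0 \<in> carrier_mat nr1 nc2" "C0 \<in> carrier_mat nr2 nc1" "D0 \<in> carrier_mat nr2 nc2"
  shows "four_block_mat (pencil A1 A0) (pencil B1 B0) (pencil C1 C0) (pencil D1 D0) =
    pencil (four_block_mat A1 B1 C1 D1) (four_block_mat A0 B0 C0 D0)"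
  using assms by (intro eq_matI) auto

lemma append_cols_carrier [simp, intro]:
  "A \<in> carrier_mat n k \<Longrightarrow> B \<in> carrier_mat n l \<Longrightarrow> A @\<^sub>c B \<in> carrier_mat n (k + l)"
  unfolding append_cols_def by (auto intro!: carrier_matI)

lemma append_pencil:
  assumes "A1 \<in> carrier_mat n k" "B1 \<in> carrier_mat n l" "A0 \<in> carrier_mat n k" "B0 \<in> carrier_mat n l"
  shows "pencil A1 A0 @\<^sub>c pencil B1 B0 = pencil (A1 @\<^sub>c B1) (A0 @\<^sub>c B0)"
  using assms unfolding append_cols_def by (intro eq_matI) auto

lemma append_rows_pencil:
  assumes "A1 \<in> carrier_mat k n" "B1 \<in> carrier_mat l n" "A0 \<in> carrier_mat k n" "B0 \<in> carrier_mat l n"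
  shows "pencil A1 A0 @\<^sub>r pencil B1 B0 = pencil (A1 @\<^sub>r B1) (A0 @\<^sub>r B0)"
  using assms unfolding append_rows_def by (intro eq_matI) auto

lemma zero_pencil: "pencil (0\<^sub>m n k) (0\<^sub>m n k) = 0\<^sub>m n k"
  by (intro eq_matI) auto

text \<open>Replacing z by s conj z puts an additional factor s on the coefficient of lambda, which
  accounts for the two different signs in the hypotheses.\<close>

lemma self_conj_pencil:
  assumes "M1 \<in> carrier_mat n n" "M0 \<in> carrier_mat n n"
    and "mat_adjoint M1 = (kind_sign kind * kind_twist kind) \<cdot>\<^sub>m M1"
    and "mat_adjoint M0 = kind_sign kind \<cdot>\<^sub>m M0"
  shows "self_conj kind (rat_mat (pencil M1 M0))"
  unfolding self_conj_iff
proof (intro conjI allI impI)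
  show "square_mat (rat_mat (pencil M1 M0))" using assms by simp
  fix z
  have 1: "cnj (M1 $$ (j, i)) = kind_sign kind * kind_twist kind * M1 $$ (i, j)" if "i < n" "j < n" for i j
    using arg_cong[OF assms(3), of "\<lambda>M. M $$ (i, j)"] assms(1) that by simp
  have 0: "cnj (M0 $$ (j, i)) = kind_sign kind * M0 $$ (i, j)" if "i < n" "j < n" for i j
    using arg_cong[OF assms(4), of "\<lambda>M. M $$ (i, j)"] assms(2) that by simp
  show "mat_adjoint (rat_mat_at (rat_mat (pencil M1 M0)) z) =
      kind_sign kind \<cdot>\<^sub>m rat_mat_at (rat_mat (pencil M1 M0)) (kind_twist kind * cnj z)"
    using assms(1,2) by (intro eq_matI) (auto simp: rat_at_def 1 0 algebra_simps)
qed

section \<open>Inverses and determinants of pencils\<close>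

lemma mat_inverse_eqI:
  fixes A :: "'a :: field mat"
  assumes A: "A \<in> carrier_mat n n" and G: "G \<in> carrier_mat n n" "A * G = 1\<^sub>m n"
  shows "the (mat_inverse A) = G"
proof -
  have "G * A = 1\<^sub>m n" using mat_mult_left_right_inverse[OF A G] .
  then have "A \<in> Units (ring_mat TYPE('a) n ())"
    using A G by (auto simp: Units_def ring_mat_def intro!: bexI[of _ G])
  then obtain B where B: "mat_inverse A = Some B" using mat_inverse(1)[OF A, of "()"] by blast
  then have "A * B = 1\<^sub>m n" "B * A = 1\<^sub>m n" "B \<in> carrier_mat n n" using mat_inverse(2)[OF A] by blast+
  note B' = this
  have "B = B * (A * G)" using G B' by simp
  also have "\<dots> = B * A * G" by (rule mult_mat_assoc[symmetric]) (use A B' G in auto)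
  also have "\<dots> = G" unfolding B'(2) using G by simp
  finally show ?thesis using B by simp
qed

lemma det_pencil_neq_0:
  assumes M: "M1 \<in> carrier_mat n n" "M0 \<in> carrier_mat n n" and d: "det M0 \<noteq> 0"
  shows "det (pencil M1 M0) \<noteq> 0"
proof -
  have "poly (det (pencil M1 M0)) 0 = det M0"
    using M by (intro poly_det_cong[of _ n]) auto
  then show ?thesis using d by auto
qed

text \<open>Factoring out \<open>M1\<close> leaves lambda - N with \<open>N = - M1^-1 M0\<close>,
  whose determinant is a characteristic polynomial and hence monic.\<close>

lemma det_pencil_neq_0':
  assumes M: "M1 \<in> carrier_mat n n" "M0 \<in> carrier_mat n n" and d: "det M1 \<noteq> 0"
  shows "det (pencil M1 M0) \<noteq> 0"
proof -
  obtain Mi where Mi: "Mi \<in> carrier_mat n n" "M1 * Mi = 1\<^sub>m n" "Mi * M1 = 1\<^sub>m n"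
    using ex_inverse_mat[OF M(1) d] by blast
  define N where "N = - (Mi * M0)"
  have N: "N \<in> carrier_mat n n" using Mi M by (simp add: N_def)
  interpret c: comm_ring_hom "\<lambda>c :: complex. [:c:]" by unfold_locales auto
  have MN: "M1 * N = - M0"
  proof -
    have "M1 * N = - (M1 * (Mi * M0))" using M Mi by (simp add: N_def)
    also have "M1 * (Mi * M0) = M1 * Mi * M0"
      by (rule mult_mat_assoc[symmetric]) (use M Mi in auto)
    finally show ?thesis unfolding Mi(2) using M by simp
  qed
  have "const_mat M1 * char_poly_matrix N = pencil M1 M0"
  proof (rule eq_matI)
    fix i j assume "i < dim_row (pencil M1 M0)" "j < dim_col (pencil M1 M0)"
    then have ij: "i < n" "j < n" using M by auto
    have "(M1 * N) $$ (i, j) = - M0 $$ (i, j)" using MN M ij by simp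
    then have s: "(\<Sum>k = 0..<n. M1 $$ (i, k) * N $$ (k, j)) = - M0 $$ (i, j)"
      using M N ij by (simp add: scalar_prod_def)
    have "(const_mat M1 * char_poly_matrix N) $$ (i, j) =
        (\<Sum>k = 0..<n. [:M1 $$ (i, k):] * ((if k = j then lam else 0) + [:- N $$ (k, j):]))"
      using M N ij by (auto simp: char_poly_matrix_def scalar_prod_def intro!: sum.cong)
    also have "\<dots> = (\<Sum>k = 0..<n. (if k = j then [:0, M1 $$ (i, j):] else 0) - [:M1 $$ (i, k) * N $$ (k, j):])"
      by (rule sum.cong) auto
    also have "\<dots> = [:0, M1 $$ (i, j):] - (\<Sum>k = 0..<n. [:M1 $$ (i, k) * N $$ (k, j):])"
      using ij by (subst sum_subtractf) (subst sum.delta, auto)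
    also have "(\<Sum>k = 0..<n. [:M1 $$ (i, k) * N $$ (k, j):]) = [:\<Sum>k = 0..<n. M1 $$ (i, k) * N $$ (k, j):]"
      by (rule c.hom_sum[symmetric])
    also have "[:0, M1 $$ (i, j):] - [:\<Sum>k = 0..<n. M1 $$ (i, k) * N $$ (k, j):] = pencil M1 M0 $$ (i, j)"
      unfolding s using M ij by simp
    finally show "(const_mat M1 * char_poly_matrix N) $$ (i, j) = pencil M1 M0 $$ (i, j)" .
  qed (use M N in \<open>simp_all add: char_poly_matrix_def\<close>)
  then have "det (pencil M1 M0) = det (const_mat M1) * char_poly N"
    using det_mult[of "const_mat M1" n "char_poly_matrix N"] M N by (simp add: char_poly_def)
  moreover have "det (const_mat M1) = [:det M1:]" by (rule c.hom_det)
  moreover have "char_poly N \<noteq> 0" using degree_monic_char_poly[OF N] by auto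
  ultimately show ?thesis using d by (metis mult_eq_0_iff pCons_eq_0_iff)
qed

section \<open>Transfer functions\<close>

lemma ex_fls_of_coeffs:
  fixes k :: "int \<Rightarrow> complex"
  assumes "\<And>j. j < N \<Longrightarrow> k j = 0"
  obtains f where "\<And>j. fls_nth f j = k j"
proof
  fix j
  show "fls_nth (Abs_fls k) j = k j"
    by (rule nth_Abs_fls_lower_bound[where N = N]) (use assms in auto)
qed

text \<open>Multiplication by lambda lowers the index by one, so the coefficient at \<open>j\<close>
  pairs \<open>M1\<close> with \<open>k (j + 1)\<close>.\<close>

lemma fls_nth_mult_pencil:
  assumes K: "K \<in> carrier_mat m n" and k: "\<And>j. k j \<in> carrier_mat m n"
    and Kk: "\<And>j a w. a < m \<Longrightarrow> w < n \<Longrightarrow> fls_nth (K $$ (a, w)) j = k j $$ (a, w)"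
    and M: "M1 \<in> carrier_mat n l" "M0 \<in> carrier_mat n l" and ab: "a < m" "b < l"
  shows "fls_nth ((K * map_mat fls_of_poly (pencil M1 M0)) $$ (a, b)) j =
    (k j * M0 + k (j + 1) * M1) $$ (a, b)"
proof -
  note [simp] = carrier_matD[OF K] carrier_matD[OF k] carrier_matD[OF M(1)] carrier_matD[OF M(2)]
  have "fls_nth (f * (fls_const c0 + fls_X_inv * fls_const c1)) j =
      fls_nth f j * c0 + fls_nth f (j + 1) * c1" for f :: "complex fls" and c0 c1
  proof -
    have "f * (fls_const c0 + fls_X_inv * fls_const c1) = fls_const c0 * f + fls_X_inv * (fls_const c1 * f)"
      by (simp only: distrib_left mult.commute mult.left_commute)
    then show ?thesis by (simp add: fls_X_inv_times_conv_shift(1) mult.commute)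
  qed
  then show ?thesis
    using ab by (simp add: scalar_prod_def fls_nth_sum Kk sum.distrib)
qed

text \<open>The Laurent series \<open>K\<close> with coefficients \<open>k j\<close> satisfies \<open>K A = - C\<close>, so \<open>C A\<^sup>-\<^sup>1 B = - K B\<close>.
  The power \<open>\<lambda>\<close> sits at index \<open>-1\<close>.\<close>

lemma transfer_function_pencil:
  assumes A: "A1 \<in> carrier_mat n n" "A0 \<in> carrier_mat n n" and C: "C1 \<in> carrier_mat m n" "C0 \<in> carrier_mat m n"
    and N: "N1 \<in> carrier_mat n l" "N0 \<in> carrier_mat n l" and D: "D1 \<in> carrier_mat m l" "D0 \<in> carrier_mat m l"
    and det: "det (pencil A1 A0) \<noteq> 0"
    and B: "B \<in> carrier_mat n l" "- B = pencil N1 N0"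
    and k: "\<And>j. k j \<in> carrier_mat m n" and bound: "\<And>j. j < bd \<Longrightarrow> k j = 0\<^sub>m m n"
    and kA: "\<And>j. k j * A0 + k (j + 1) * A1 =
      - (if j = -1 then C1 else if j = 0 then C0 else 0\<^sub>m m n)"
    and R: "R \<in> carrier_mat m l"
    and kN: "\<And>j a b. a < m \<Longrightarrow> b < l \<Longrightarrow> fls_nth (laurent_at_infinity (R $$ (a, b))) j =
      (k j * N0 + k (j + 1) * N1) $$ (a, b) +
      (if j = -1 then D1 $$ (a, b) else if j = 0 then D0 $$ (a, b) else 0)"
  shows "transfer_function (pencil A1 A0) B (pencil C1 C0) (pencil D1 D0) = R"
proof -
  note [simp] = carrier_matD[OF A(1)] carrier_matD[OF A(2)] carrier_matD[OF C(1)] carrier_matD[OF C(2)]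
    carrier_matD[OF N(1)] carrier_matD[OF N(2)] carrier_matD[OF D(1)] carrier_matD[OF D(2)]
    carrier_matD[OF B(1)] carrier_matD[OF k] carrier_matD[OF R]
  let ?L = "map_mat laurent_at_infinity"
  define RA where "RA = rat_mat (pencil A1 A0)"
  have RA: "RA \<in> carrier_mat n n" by (rule carrier_matI) (simp_all add: RA_def)
  have "det RA = to_fract (det (pencil A1 A0))"
    unfolding RA_def by (rule comm_ring_hom.hom_det) (unfold_locales, auto)
  then have "det RA \<noteq> 0" using det by simp
  then obtain G where G: "G \<in> carrier_mat n n" "RA * G = 1\<^sub>m n"
    using ex_inverse_mat[OF RA] by blast
  have GI: "the (mat_inverse RA) = G" by (rule mat_inverse_eqI[OF RA G])
  have "\<exists>f. \<forall>j. fls_nth f j = k j $$ (a, w)" if "a < m" "w < n" for a w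
    using ex_fls_of_coeffs[of bd "\<lambda>j. k j $$ (a, w)"] bound that by (metis index_zero_mat(1))
  then obtain f where f: "\<And>a w j. a < m \<Longrightarrow> w < n \<Longrightarrow> fls_nth (f a w) j = k j $$ (a, w)"
    by metis
  define K where "K = mat m n (\<lambda>(a, w). f a w)"
  have K: "K \<in> carrier_mat m n" by (simp add: K_def)
  have Kk: "fls_nth (K $$ (a, w)) j = k j $$ (a, w)" if "a < m" "w < n" for a w j
    using that by (simp add: K_def f)
  have LR: "?L (rat_mat M) = map_mat fls_of_poly M" for M
    by (intro eq_matI) auto
  have KA: "K * ?L RA = - ?L (rat_mat (pencil C1 C0))"
  proof (rule eq_matI)
    fix a w assume "a < dim_row (- ?L (rat_mat (pencil C1 C0)))" "w < dim_col (- ?L (rat_mat (pencil C1 C0)))"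
    then have aw: "a < m" "w < n" by auto
    show "(K * ?L RA) $$ (a, w) = (- ?L (rat_mat (pencil C1 C0))) $$ (a, w)"
    proof (rule fls_eqI)
      fix j
      have "fls_nth ((K * ?L RA) $$ (a, w)) j = (k j * A0 + k (j + 1) * A1) $$ (a, w)"
        unfolding RA_def LR by (rule fls_nth_mult_pencil[OF K k Kk A aw])
      also have "\<dots> = fls_nth ((- ?L (rat_mat (pencil C1 C0))) $$ (a, w)) j"
        unfolding kA using aw by (auto simp: fls_X_inv_times_conv_shift)
      finally show "fls_nth ((K * ?L RA) $$ (a, w)) j = fls_nth ((- ?L (rat_mat (pencil C1 C0))) $$ (a, w)) j" .
    qed
  qed (use K in \<open>auto simp: RA_def\<close>)
  have RC: "rat_mat (pencil C1 C0) \<in> carrier_mat m n" and RB: "rat_mat B \<in> carrier_mat n l"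
    by (auto intro!: carrier_matI)
  have LG: "?L RA * ?L G = 1\<^sub>m n"
    unfolding laurent.mat_hom_mult[OF RA G(1), symmetric] G(2) by (rule laurent.mat_hom_one)
  have "?L (rat_mat (pencil C1 C0) * G * rat_mat B) =
      ?L (rat_mat (pencil C1 C0)) * ?L G * ?L (rat_mat B)"
    using laurent.mat_hom_mult[OF RC G(1)] laurent.mat_hom_mult[OF mult_carrier_mat[OF RC G(1)] RB] by simp
  also have "?L (rat_mat (pencil C1 C0)) = - (K * ?L RA)" unfolding KA using RC by simp
  also have "- (K * ?L RA) * ?L G = - (K * (?L RA * ?L G))"
    using K RA G by (simp add: mult_mat_assoc)
  also have "\<dots> = - K" by (simp only: LG right_mult_one_mat[OF K])
  \<comment> \<open>The given pencil is that of \<open>- B\<close>, so its sign absorbs the sign of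
    \<open>- K\<close>.\<close>
  also have "- K * ?L (rat_mat B) = K * ?L (rat_mat (- B))"
  proof -
    have "?L (rat_mat (- B)) = - ?L (rat_mat B)"
      by (intro eq_matI) (simp_all add: laurent.hom_uminus)
    then show ?thesis using K RB by simp
  qed
  also have "\<dots> = K * map_mat fls_of_poly (pencil N1 N0)" by (simp add: LR B(2))
  finally have main: "?L (rat_mat (pencil C1 C0) * G * rat_mat B) = K * map_mat fls_of_poly (pencil N1 N0)" .
  have [simp]: "dim_row K = m" "dim_col K = n" "dim_row G = n" "dim_col G = n"
    using K G by auto
  show ?thesis unfolding transfer_function_def RA_def[symmetric] GI
  proof (rule eq_matI)
    fix a b assume "a < dim_row R" "b < dim_col R"
    then have ab: "a < m" "b < l" by auto
    let ?CGB = "rat_mat (pencil C1 C0) * G * rat_mat B"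
    have "laurent_at_infinity (?CGB $$ (a, b)) = (?L ?CGB) $$ (a, b)" using ab by simp
    also have "\<dots> = (K * map_mat fls_of_poly (pencil N1 N0)) $$ (a, b)" unfolding main ..
    finally have L: "laurent_at_infinity (?CGB $$ (a, b)) = (K * map_mat fls_of_poly (pencil N1 N0)) $$ (a, b)" .
    have "laurent_at_infinity ((rat_mat (pencil D1 D0) + ?CGB) $$ (a, b)) =
        fls_of_poly (pencil D1 D0 $$ (a, b)) + laurent_at_infinity (?CGB $$ (a, b))"
      using ab by (simp add: laurent.hom_add del: index_mult_mat(1))
    also have "\<dots> = laurent_at_infinity (R $$ (a, b))"
    proof (rule fls_eqI)
      fix j
      have "fls_nth ((K * map_mat fls_of_poly (pencil N1 N0)) $$ (a, b)) j = (k j * N0 + k (j + 1) * N1) $$ (a, b)"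
        by (rule fls_nth_mult_pencil[OF K k Kk N ab])
      then show "fls_nth (fls_of_poly (pencil D1 D0 $$ (a, b)) + laurent_at_infinity (?CGB $$ (a, b))) j =
          fls_nth (laurent_at_infinity (R $$ (a, b))) j"
        unfolding L kN[OF ab] fls_plus_nth
        using ab by (auto simp: fls_X_inv_times_conv_shift simp del: index_mult_mat(1) index_add_mat(1))
    qed
    finally show "(rat_mat (pencil D1 D0) + ?CGB) $$ (a, b) = R $$ (a, b)"
      by (rule laurent.injectivity)
  qed simp_all
qed

section \<open>Strong minimality\<close>

lemma mat_adjoint_append_cols:
  fixes A B :: "complex mat"
  assumes "A \<in> carrier_mat n k" "B \<in> carrier_mat n l"
  shows "mat_adjoint (A @\<^sub>c B) = mat_adjoint A @\<^sub>r mat_adjoint B"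
  using assms unfolding append_cols_def append_rows_def by (intro eq_matI) auto

lemma smult_append_rows:
  assumes "A \<in> carrier_mat k n" "B \<in> carrier_mat l n"
  shows "c \<cdot>\<^sub>m (A @\<^sub>r B) = (c \<cdot>\<^sub>m A) @\<^sub>r (c \<cdot>\<^sub>m (B :: complex mat))"
  using assms unfolding append_rows_def by (intro eq_matI) auto

lemma add_append_rows:
  assumes "A \<in> carrier_mat k n" "B \<in> carrier_mat l n" "A' \<in> carrier_mat k n" "B' \<in> carrier_mat l n"
  shows "(A @\<^sub>r B) + (A' @\<^sub>r B') = (A + A') @\<^sub>r (B + (B' :: complex mat))"
  using assms unfolding append_rows_def by (intro eq_matI) auto

lemma append_eq_zero_vec_iff:
  assumes "x \<in> carrier_vec k" "w \<in> carrier_vec l"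
  shows "x @\<^sub>v w = 0\<^sub>v (k + l) \<longleftrightarrow> x = 0\<^sub>v k \<and> w = 0\<^sub>v (l :: nat)"
proof -
  have "0\<^sub>v (k + l) = 0\<^sub>v k @\<^sub>v 0\<^sub>v l" by (intro eq_vecI) auto
  then show ?thesis using assms by (metis append_vec_eq zero_carrier_vec)
qed

lemma smult_mat_mult_vec:
  fixes M :: "complex mat"
  assumes "dim_col M = dim_vec y"
  shows "(c \<cdot>\<^sub>m M) *\<^sub>v y = c \<cdot>\<^sub>v (M *\<^sub>v y)"
  using assms by (intro eq_vecI) (auto simp: scalar_prod_def sum_distrib_left mult.assoc)

text \<open>The pair \<open>(a, b)\<close> runs through the finite points \<open>(z, 1)\<close> and the point \<open>(1, 0)\<close> at infinity.\<close>

lemma strongly_minimal_pencilI: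
  fixes s e :: complex
  assumes A: "A1 \<in> carrier_mat n n" "A0 \<in> carrier_mat n n"
    and N: "N1 \<in> carrier_mat n m" "N0 \<in> carrier_mat n m"
    and C: "C1 \<in> carrier_mat m n" "C0 \<in> carrier_mat m n"
    and B: "- B = pencil N1 N0"
    and s: "s * s = 1" "cnj s = s" and e: "e \<noteq> 0"
    and adjA: "mat_adjoint A1 = (e * s) \<cdot>\<^sub>m A1" "mat_adjoint A0 = e \<cdot>\<^sub>m A0"
    and adjN: "mat_adjoint N1 = (e * s) \<cdot>\<^sub>m C1" "mat_adjoint N0 = e \<cdot>\<^sub>m C0"
    and inj: "\<And>a b y. \<lbrakk>(a, b) \<noteq> (0, 0); y \<in> carrier_vec n; (a \<cdot>\<^sub>m A1 + b \<cdot>\<^sub>m A0) *\<^sub>v y = 0\<^sub>v n;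
      (a \<cdot>\<^sub>m C1 + b \<cdot>\<^sub>m C0) *\<^sub>v y = 0\<^sub>v m\<rbrakk> \<Longrightarrow> y = 0\<^sub>v n"
  shows "strongly_minimal n (pencil A1 A0) B (pencil C1 C0)"
proof -
  note [simp] = carrier_matD[OF A(1)] carrier_matD[OF A(2)] carrier_matD[OF C(1)] carrier_matD[OF C(2)]
    carrier_matD[OF N(1)] carrier_matD[OF N(2)]
  have s0: "s \<noteq> 0" using s by auto
  let ?M = "\<lambda>a b. a \<cdot>\<^sub>m (A1 @\<^sub>r C1) + b \<cdot>\<^sub>m (A0 @\<^sub>r C0)"
  let ?W = "\<lambda>a b. a \<cdot>\<^sub>m (A1 @\<^sub>c N1) + b \<cdot>\<^sub>m (A0 @\<^sub>c N0)"
  have AC: "A1 @\<^sub>r C1 \<in> carrier_mat (n + m) n" "A0 @\<^sub>r C0 \<in> carrier_mat (n + m) n"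
    and AN: "A1 @\<^sub>c N1 \<in> carrier_mat n (n + m)" "A0 @\<^sub>c N0 \<in> carrier_mat n (n + m)"
    using A C N by auto
  have M: "?M a b \<in> carrier_mat (n + m) n" for a b using AC by simp
  have W: "?W a b \<in> carrier_mat n (n + m)" for a b using AN by simp
  have injM: "y = 0\<^sub>v n" if ab: "(a, b) \<noteq> (0, 0)" and y: "y \<in> carrier_vec n" "?M a b *\<^sub>v y = 0\<^sub>v (n + m)" for a b y
  proof (rule inj[OF ab y(1)])
    have "?M a b = (a \<cdot>\<^sub>m A1 + b \<cdot>\<^sub>m A0) @\<^sub>r (a \<cdot>\<^sub>m C1 + b \<cdot>\<^sub>m C0)"
      using A C by (simp add: smult_append_rows[of _ n n _ m] add_append_rows[of _ n n _ m])
    then have "((a \<cdot>\<^sub>m A1 + b \<cdot>\<^sub>m A0) *\<^sub>v y) @\<^sub>v ((a \<cdot>\<^sub>m C1 + b \<cdot>\<^sub>m C0) *\<^sub>v y) = 0\<^sub>v (n + m)"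
      using y mat_mult_append[of "a \<cdot>\<^sub>m A1 + b \<cdot>\<^sub>m A0" n n "a \<cdot>\<^sub>m C1 + b \<cdot>\<^sub>m C0" m y] A C by simp
    moreover have "(a \<cdot>\<^sub>m A1 + b \<cdot>\<^sub>m A0) *\<^sub>v y \<in> carrier_vec n" "(a \<cdot>\<^sub>m C1 + b \<cdot>\<^sub>m C0) *\<^sub>v y \<in> carrier_vec m"
      by (auto intro!: carrier_vecI)
    ultimately show "(a \<cdot>\<^sub>m A1 + b \<cdot>\<^sub>m A0) *\<^sub>v y = 0\<^sub>v n" "(a \<cdot>\<^sub>m C1 + b \<cdot>\<^sub>m C0) *\<^sub>v y = 0\<^sub>v m"
      using append_eq_zero_vec_iff by blast+
  qed
  have rankM: "mat_rank (?M a b) = n" if "(a, b) \<noteq> (0, 0)" for a b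
    by (rule mat_rank_injective[OF M injM[OF that]])
  have rankW: "mat_rank (?W a b) = n" if ab: "(a, b) \<noteq> (0, 0)" for a b
  proof (rule mat_rank_adjoint_injective[OF W])
    fix y assume y: "y \<in> carrier_vec n" "mat_adjoint (?W a b) *\<^sub>v y = 0\<^sub>v (n + m)"
    \<comment> \<open>The adjoint moves the point (a, b) to (s conj a, conj b), again nonzero, and
      fixes the point at infinity up to scaling; hence \<open>inj\<close> is stated for all
      pairs.\<close>
    have "mat_adjoint (?W a b) = e \<cdot>\<^sub>m ?M (s * cnj a) (cnj b)"
    proof -
      have "mat_adjoint (?W a b) = cnj a \<cdot>\<^sub>m (((e * s) \<cdot>\<^sub>m A1) @\<^sub>r ((e * s) \<cdot>\<^sub>m C1)) +
          cnj b \<cdot>\<^sub>m ((e \<cdot>\<^sub>m A0) @\<^sub>r (e \<cdot>\<^sub>m C0))"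
        using A N AN
        by (subst mat_adjoint_add[of _ n "n + m"])
           (simp_all add: mat_adjoint_smult mat_adjoint_append_cols[of _ n n _ m] adjA adjN)
      also have "\<dots> = e \<cdot>\<^sub>m ?M (s * cnj a) (cnj b)"
        unfolding append_rows_def by (intro eq_matI) (auto simp: algebra_simps)
      finally show ?thesis .
    qed
    moreover have "(e \<cdot>\<^sub>m ?M (s * cnj a) (cnj b)) *\<^sub>v y = e \<cdot>\<^sub>v (?M (s * cnj a) (cnj b) *\<^sub>v y)"
      by (rule smult_mat_mult_vec) (simp only: carrier_matD(2)[OF M] carrier_vecD[OF y(1)])
    ultimately have "e \<cdot>\<^sub>v (?M (s * cnj a) (cnj b) *\<^sub>v y) = 0\<^sub>v (n + m)"
      using y(2) by (simp only:)
    moreover have "?M (s * cnj a) (cnj b) *\<^sub>v y \<in> carrier_vec (n + m)"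
      using M y by (meson mult_mat_vec_carrier)
    ultimately have "?M (s * cnj a) (cnj b) *\<^sub>v y = 0\<^sub>v (n + m)"
      using e by (auto simp: vec_eq_iff)
    moreover have "(s * cnj a, cnj b) \<noteq> (0, 0)" using ab s by auto
    ultimately show "y = 0\<^sub>v n" using injM y by blast
  qed
  have cols: "pencil A1 A0 @\<^sub>c - B = pencil (A1 @\<^sub>c N1) (A0 @\<^sub>c N0)"
    unfolding B by (rule append_pencil) (use A N in auto)
  have rows: "pencil A1 A0 @\<^sub>r pencil C1 C0 = pencil (A1 @\<^sub>r C1) (A0 @\<^sub>r C0)"
    by (rule append_rows_pencil) (use A C in auto)
  \<comment> \<open>Degree exactly 1 comes from the point at infinity: a zero leading coefficient
    would annihilate a unit vector, against injectivity at (1, 0).\<close>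
  have nz: "A1 @\<^sub>c N1 \<noteq> 0\<^sub>m n (n + m)" "A1 @\<^sub>r C1 \<noteq> 0\<^sub>m (n + m) n" if n: "1 \<le> n"
  proof -
    have *: False if "A1 @\<^sub>r C1 = 0\<^sub>m (n + m) n"
    proof -
      have "?M 1 0 *\<^sub>v unit_vec n 0 = 0\<^sub>v (n + m)"
        using AC unfolding that by (intro eq_vecI) (auto simp: scalar_prod_def)
      then have "(unit_vec n 0 :: complex vec) = 0\<^sub>v n" by (intro injM[of 1 0]) auto
      then have "(unit_vec n 0 :: complex vec) $ 0 = 0" using n by simp
      then show False using n by simp
    qed
    then show "A1 @\<^sub>r C1 \<noteq> 0\<^sub>m (n + m) n" by blast
    show "A1 @\<^sub>c N1 \<noteq> 0\<^sub>m n (n + m)"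
    proof
      assume "A1 @\<^sub>c N1 = 0\<^sub>m n (n + m)"
      then have "mat_adjoint A1 @\<^sub>r mat_adjoint N1 = 0\<^sub>m (n + m) n"
        by (metis A(1) N(1) mat_adjoint_append_cols mat_adjoint_zero)
      then have "(e * s) \<cdot>\<^sub>m (A1 @\<^sub>r C1) = 0\<^sub>m (n + m) n"
        unfolding adjA adjN using A C by (simp add: smult_append_rows[of _ n n _ m])
      then have "A1 @\<^sub>r C1 = 0\<^sub>m (n + m) n"
        using AC e s0 by (auto simp: mat_eq_iff)
      then show False by (rule *)
    qed
  qed
  show ?thesis
    unfolding strongly_minimal_def cols rows poly_mat_at_pencil[OF AC] poly_mat_at_pencil[OF AN]
      coeff_mat_pencil[OF AC] coeff_mat_pencil[OF AN]
    using poly_mat_degree_pencil[OF AC(1)] poly_mat_degree_pencil[OF AN(1)] nz rankM rankW by auto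
qed


section \<open>Products of blocks placed side by side\<close>

lemma mat_adjoint_uminus: "mat_adjoint (- A) = - mat_adjoint (A :: complex mat)"
  by (intro eq_matI) auto

lemma append_cols_mult_four_block:
  fixes X Y :: "complex mat"
  assumes "X \<in> carrier_mat m p" "Y \<in> carrier_mat m q"
    and "A \<in> carrier_mat p k" "B \<in> carrier_mat p l" "C \<in> carrier_mat q k" "D \<in> carrier_mat q l"
  shows "(X @\<^sub>c Y) * four_block_mat A B C D = (X * A + Y * C) @\<^sub>c (X * B + Y * D)"
proof -
  have "X @\<^sub>c Y = four_block_mat X Y (0\<^sub>m 0 p) (0\<^sub>m 0 q)" using assms by (simp add: append_cols_def)
  then have "(X @\<^sub>c Y) * four_block_mat A B C D = four_block_mat X Y (0\<^sub>m 0 p) (0\<^sub>m 0 q) * four_block_mat A B C D"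
    by simp
  also have "\<dots> = four_block_mat (X * A + Y * C) (X * B + Y * D)
      (0\<^sub>m 0 p * A + 0\<^sub>m 0 q * C) (0\<^sub>m 0 p * B + 0\<^sub>m 0 q * D)"
    by (rule mult_four_block_mat[OF assms(1,2) zero_carrier_mat zero_carrier_mat assms(3-)])
  also have "\<dots> = (X * A + Y * C) @\<^sub>c (X * B + Y * D)"
    using assms unfolding append_cols_def by (intro cong_four_block_mat eq_matI) auto
  finally show ?thesis .
qed

lemma append_cols_mult_append_rows:
  fixes X Y :: "complex mat"
  assumes "X \<in> carrier_mat m p" "Y \<in> carrier_mat m q"
    and "A \<in> carrier_mat p k" "C \<in> carrier_mat q k"
  shows "(X @\<^sub>c Y) * (A @\<^sub>r C) = X * A + Y * C"
proof -
  have "A @\<^sub>r C = four_block_mat A (0\<^sub>m p 0) C (0\<^sub>m q 0)" using assms by (simp add: append_rows_def)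
  then have "(X @\<^sub>c Y) * (A @\<^sub>r C) = (X * A + Y * C) @\<^sub>c (X * 0\<^sub>m p 0 + Y * 0\<^sub>m q 0)"
    using assms by (simp only: append_cols_mult_four_block[OF assms(1,2,3) zero_carrier_mat assms(4) zero_carrier_mat])
  also have "\<dots> = X * A + Y * C"
    using assms unfolding append_cols_def by (intro eq_matI) auto
  finally show ?thesis .
qed

lemma mult_append_cols_vec:
  fixes X Y :: "complex mat"
  assumes "X \<in> carrier_mat m p" "Y \<in> carrier_mat m q" "x \<in> carrier_vec p" "w \<in> carrier_vec q"
  shows "(X @\<^sub>c Y) *\<^sub>v (x @\<^sub>v w) = X *\<^sub>v x + Y *\<^sub>v w"
proof (rule eq_vecI)
  fix i assume "i < dim_vec (X *\<^sub>v x + Y *\<^sub>v w)"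
  then have i: "i < m" using assms by auto
  then have row: "row (X @\<^sub>c Y) i = row X i @\<^sub>v row Y i"
    using row_four_block_mat(1)[OF assms(1,2) zero_carrier_mat[of 0 p] zero_carrier_mat[of 0 q] i] assms
    by (simp add: append_cols_def)
  have "((X @\<^sub>c Y) *\<^sub>v (x @\<^sub>v w)) $ i = row (X @\<^sub>c Y) i \<bullet> (x @\<^sub>v w)"
    using i assms by (simp add: append_cols_def)
  also have "\<dots> = row X i \<bullet> x + row Y i \<bullet> w"
    unfolding row using assms by (intro scalar_prod_append[of _ p _ q]) auto
  finally show "((X @\<^sub>c Y) *\<^sub>v (x @\<^sub>v w)) $ i = (X *\<^sub>v x + Y *\<^sub>v w) $ i"
    using assms i by simp
qed (use assms in \<open>auto simp: append_cols_def\<close>)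

section \<open>Generating series of the rows \<open>u n\<close>\<close>

context hankel_realization
begin

text \<open>The coefficient of lambda^(n+1) sits at index -(n+1), hence the argument
  \<open>- j - 1\<close>. At j = -1 the term with \<open>k (j + 1)\<close> already lies outside the
  series, so \<open>- u 0 H\<close> is left uncancelled.\<close>

lemma nilpotent_coeffs:
  defines "k \<equiv> \<lambda>j :: int. if j < 0 then u (nat (- j - 1)) else 0\<^sub>m m r"
  shows "k j * (- H) + k (j + 1) * F = - (if j = -1 then u 0 * H else 0\<^sub>m m r)"
proof -
  have "j \<ge> 0 \<or> j = -1 \<or> (\<exists>n. j = - int n - 2)"
    by (cases "j < -1") (auto intro: exI[of _ "nat (- j - 2)"])
  then consider "j \<ge> 0" | "j = -1" | n where "j = - int n - 2" by blast
  then show ?thesis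
  proof cases
    case 3
    have "nat (- j - 1) = Suc n" "nat (- (j + 1) - 1) = n" using 3 by auto
    then have "k j = u (Suc n)" "k (j + 1) = u n" "j \<noteq> -1" using 3 by (auto simp: k_def)
    moreover have "u (Suc n) * (- H) = - (u n * F)" by (simp flip: step)
    moreover have "- (u n * F) + u n * F = 0\<^sub>m m r" by (intro eq_matI) auto
    moreover have "- 0\<^sub>m m r = (0\<^sub>m m r :: complex mat)" by (intro eq_matI) auto
    ultimately show ?thesis by simp
  qed (intro eq_matI; auto simp: k_def)+
qed

text \<open>The coefficient of lambda^(-(n+1)) sits at index n+1. The uncancelled term is now at j =
  0, where \<open>k 0\<close> is zero and \<open>k 1\<close> is \<open>u 0\<close>.\<close>

lemma causal_coeffs:
  defines "k \<equiv> \<lambda>j :: int. if j > 0 then u (nat (j - 1)) else 0\<^sub>m m r"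
  shows "k j * F + k (j + 1) * (- H) = - (if j = 0 then u 0 * H else 0\<^sub>m m r)"
proof -
  have "j < 0 \<or> j = 0 \<or> (\<exists>n. j = int n + 1)"
    by (cases "j > 0") (auto intro: exI[of _ "nat (j - 1)"])
  then consider "j < 0" | "j = 0" | n where "j = int n + 1" by blast
  then show ?thesis
  proof cases
    case 3
    have "nat (j - 1) = n" "nat (j + 1 - 1) = Suc n" using 3 by auto
    then have "k j = u n" "k (j + 1) = u (Suc n)" "j \<noteq> 0" using 3 by (auto simp: k_def)
    moreover have "u (Suc n) * (- H) = - (u n * F)" by (simp flip: step)
    moreover have "u n * F + - (u n * F) = 0\<^sub>m m r" by (intro eq_matI) auto
    moreover have "- 0\<^sub>m m r = (0\<^sub>m m r :: complex mat)" by (intro eq_matI) auto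
    ultimately show ?thesis by simp
  qed (intro eq_matI; auto simp: k_def)+
qed

end

lemma smult_eq_zero_vec:
  "c \<noteq> 0 \<Longrightarrow> c \<cdot>\<^sub>v x = 0\<^sub>v n \<Longrightarrow> x = (0\<^sub>v n :: complex vec)"
  by (auto simp: vec_eq_iff)

lemma smult_eq_smult_vec:
  fixes x y :: "complex vec"
  assumes "b \<noteq> 0" "b \<cdot>\<^sub>v x = a \<cdot>\<^sub>v y"
  shows "x = (a / b) \<cdot>\<^sub>v y"
  using assms by (auto simp: vec_eq_iff field_simps)

text \<open>At each point one of the two blocks is nonsingular, so the shared output row never has
  to separate them. At infinity (\<open>b = 0\<close>) the strictly proper block is a multiple of
  \<open>H2\<close>; at finite points the polynomial block has trivial kernel by nilpotency. That
  component vanishes, and the output row then observes the other one.\<close>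

lemma block_pencil_injective:
  assumes h1: "hankel_realization m p s1 e1 g1 H1 F1 v1 u1" and nil: "\<And>n. n \<ge> k \<Longrightarrow> u1 n = 0\<^sub>m m p"
    and h2: "hankel_realization m q s2 e2 g2 H2 F2 v2 u2"
    and ab: "(a, b) \<noteq> (0, 0)" and x: "x \<in> carrier_vec p" and w: "w \<in> carrier_vec q"
    and e1: "a \<cdot>\<^sub>v (F1 *\<^sub>v x) = b \<cdot>\<^sub>v (H1 *\<^sub>v x)" and e2: "b \<cdot>\<^sub>v (F2 *\<^sub>v w) = a \<cdot>\<^sub>v (H2 *\<^sub>v w)"
    and e3: "a \<cdot>\<^sub>v (u1 0 *\<^sub>v (H1 *\<^sub>v x)) + b \<cdot>\<^sub>v (u2 0 *\<^sub>v (H2 *\<^sub>v w)) = 0\<^sub>v m"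
  shows "x = 0\<^sub>v p \<and> w = 0\<^sub>v q"
proof -
  interpret p: hankel_realization m p s1 e1 g1 H1 F1 v1 u1 by fact
  interpret q: hankel_realization m q s2 e2 g2 H2 F2 v2 u2 by fact
  have H0: "M *\<^sub>v 0\<^sub>v n = 0\<^sub>v l" if "M \<in> carrier_mat l n" for M :: "complex mat" and n l
    using that by (auto intro!: eq_vecI simp: scalar_prod_def)
  have z: "0 \<cdot>\<^sub>v y = 0\<^sub>v n" if "y \<in> carrier_vec n" for y :: "complex vec" and n
    using that by (auto intro!: eq_vecI)
  have cv: "F1 *\<^sub>v x \<in> carrier_vec p" "H1 *\<^sub>v x \<in> carrier_vec p" "F2 *\<^sub>v w \<in> carrier_vec q" "H2 *\<^sub>v w \<in> carrier_vec q"
    "u1 0 *\<^sub>v (H1 *\<^sub>v x) \<in> carrier_vec m" "u2 0 *\<^sub>v (H2 *\<^sub>v w) \<in> carrier_vec m"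
    by (auto intro!: carrier_vecI)
  show ?thesis
  proof (cases "b = 0")
    case True
    then have a: "a \<noteq> 0" using ab by simp
    have "H2 *\<^sub>v w = 0\<^sub>v q"
      by (rule smult_eq_zero_vec[OF a]) (metis True e2 z[OF cv(3)])
    then have w0: "w = 0\<^sub>v q" using q.H_injective w by blast
    have "F1 *\<^sub>v x = (0 / a) \<cdot>\<^sub>v (H1 *\<^sub>v x)"
      using smult_eq_smult_vec[OF a e1] by (simp add: True)
    moreover have "a \<cdot>\<^sub>v (u1 0 *\<^sub>v (H1 *\<^sub>v x)) = 0\<^sub>v m"
      using e3 z[OF cv(6)] cv(5) by (simp add: True)
    then have "u1 0 *\<^sub>v (H1 *\<^sub>v x) = 0\<^sub>v m" using smult_eq_zero_vec[OF a] by blast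
    ultimately show ?thesis using p.pencil_observable[OF x] w0 by blast
  next
    case False
    have x0: "x = 0\<^sub>v p"
      by (rule p.pencil_nilpotent[OF nil x smult_eq_smult_vec[OF False e1[symmetric]]])
    have "u1 0 *\<^sub>v (H1 *\<^sub>v x) = 0\<^sub>v m"
      unfolding x0 by (simp add: H0[OF p.H_carrier] H0[OF p.u_carrier])
    then have "b \<cdot>\<^sub>v (u2 0 *\<^sub>v (H2 *\<^sub>v w)) = 0\<^sub>v m"
      using e3 cv(6) by simp
    then have "u2 0 *\<^sub>v (H2 *\<^sub>v w) = 0\<^sub>v m" by (rule smult_eq_zero_vec[OF False])
    then show ?thesis
      using q.pencil_observable[OF w smult_eq_smult_vec[OF False e2]] x0 by blast
  qed
qed

section \<open>Assembling the two parts\<close>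

text \<open>\<open>H\<close> and \<open>F\<close> exchange places between the two pencils, and the
  base sign \<open>e * s\<close> of the second realization compensates for it: \<open>- H2\<close>
  carries the sign \<open>e * s\<close> and \<open>F2\<close> the sign \<open>e * s * s = e\<close>,
  matching the leading coefficient \<open>F1\<close> and the constant coefficient
  \<open>- H1\<close>. As to offsets, \<open>g1 n\<close> belongs to lambda^(n+2) and
  \<open>g2 n\<close> to lambda^(-(n+1)).\<close>

lemma strongly_minimal_linearization_assembly:
  fixes kind :: conj_kind
  defines "s \<equiv> kind_twist kind" and "e \<equiv> kind_sign kind"
  assumes h1: "hankel_realization m p s e g1 H1 F1 v1 u1" and nil: "\<And>n. n \<ge> k \<Longrightarrow> u1 n = 0\<^sub>m m p"
    and h2: "hankel_realization m q s (e * s) g2 H2 F2 v2 u2"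
    and B: "Bs \<in> carrier_mat p m" "Bsp \<in> carrier_mat q m"
    and poly_blocks: "As = pencil F1 (- H1)" "- Bs = pencil (H1 * v1) (0\<^sub>m p m)"
      "Cs = pencil (u1 0 * H1) (0\<^sub>m m p)" "Ds = pencil D1 D0"
    and sp_blocks: "Asp = pencil (- H2) F2" "- Bsp = pencil (0\<^sub>m q m) (H2 * v2)"
      "Csp = pencil (0\<^sub>m m q) (u2 0 * H2)"
    and D: "D1 \<in> carrier_mat m m" "D0 \<in> carrier_mat m m"
      "mat_adjoint D1 = (e * s) \<cdot>\<^sub>m D1" "mat_adjoint D0 = e \<cdot>\<^sub>m D0"
    and R: "R \<in> carrier_mat m m"
    and coeffs: "\<And>a b j. a < m \<Longrightarrow> b < m \<Longrightarrow> fls_nth (laurent_at_infinity (R $$ (a, b))) j =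
      (if j < -1 then g1 (nat (- j - 2)) a b else if j = -1 then D1 $$ (a, b)
       else if j = 0 then D0 $$ (a, b) else g2 (nat (j - 1)) a b)"
  shows "let A = four_block_mat As (0\<^sub>m p q) (0\<^sub>m q p) Asp;
             B = Bs @\<^sub>r Bsp;
             C = Cs @\<^sub>c Csp;
             L = four_block_mat A (- B) C Ds
         in strongly_minimal_linearization (p + q) m m A B C Ds R \<and> self_conj kind (rat_mat L)"
proof -
  interpret p: hankel_realization m p s e g1 H1 F1 v1 u1 by fact
  interpret q: hankel_realization m q s "e * s" g2 H2 F2 v2 u2 by fact
  have s: "s * s = 1" "cnj s = s" and e: "e \<noteq> 0" by (simp_all add: s_def e_def)
  have ss: "s * (s * c) = c" for c using s by (simp add: mult.assoc[symmetric])
  note carr = p.H_carrier p.F_carrier p.v_carrier p.u_carrier q.H_carrier q.F_carrier q.v_carrier q.u_carrier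
  define A1 where "A1 = four_block_mat F1 (0\<^sub>m p q) (0\<^sub>m q p) (- H2)"
  define A0 where "A0 = four_block_mat (- H1) (0\<^sub>m p q) (0\<^sub>m q p) F2"
  define N1 where "N1 = (H1 * v1) @\<^sub>r 0\<^sub>m q m"
  define N0 where "N0 = 0\<^sub>m p m @\<^sub>r (H2 * v2)"
  define C1 where "C1 = (u1 0 * H1) @\<^sub>c 0\<^sub>m m q"
  define C0 where "C0 = 0\<^sub>m m p @\<^sub>c (u2 0 * H2)"
  define B where "B = Bs @\<^sub>r Bsp"
  have Hv: "H1 * v1 \<in> carrier_mat p m" "H2 * v2 \<in> carrier_mat q m"
    and uH: "u1 0 * H1 \<in> carrier_mat m p" "u2 0 * H2 \<in> carrier_mat m q"
    using carr by (auto intro!: carrier_matI)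
  have A: "A1 \<in> carrier_mat (p + q) (p + q)" "A0 \<in> carrier_mat (p + q) (p + q)"
    using carr by (auto simp: A1_def A0_def intro!: carrier_matI)
  have N: "N1 \<in> carrier_mat (p + q) m" "N0 \<in> carrier_mat (p + q) m"
    using Hv by (auto simp: N1_def N0_def)
  have C: "C1 \<in> carrier_mat m (p + q)" "C0 \<in> carrier_mat m (p + q)"
    using uH by (auto simp: C1_def C0_def)
  have Ac: "four_block_mat As (0\<^sub>m p q) (0\<^sub>m q p) Asp = pencil A1 A0"
    unfolding poly_blocks sp_blocks A1_def A0_def zero_pencil[symmetric]
    by (subst four_block_pencil[of _ p p _ q _ q]) (use carr in \<open>auto simp: zero_pencil\<close>)
  have Bc: "- B = pencil N1 N0"
  proof -
    have "- B = (- Bs) @\<^sub>r (- Bsp)"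
      using \<open>Bs \<in> _\<close> \<open>Bsp \<in> _\<close> unfolding B_def append_rows_def by (intro eq_matI) auto
    also have "\<dots> = pencil N1 N0"
      unfolding poly_blocks sp_blocks N1_def N0_def
      by (rule append_rows_pencil) (use Hv in auto)
    finally show ?thesis .
  qed
  have Bcarr: "B \<in> carrier_mat (p + q) m" unfolding B_def using \<open>Bs \<in> _\<close> \<open>Bsp \<in> _\<close> by simp
  have Cc: "Cs @\<^sub>c Csp = pencil C1 C0"
    unfolding poly_blocks sp_blocks C1_def C0_def by (rule append_pencil) (use uH in auto)
  have smsm: "c \<cdot>\<^sub>m (d \<cdot>\<^sub>m M) = (c * d) \<cdot>\<^sub>m M" for c d and M :: "complex mat"
    by (intro eq_matI) auto
  have "mat_adjoint (H1 * v1) = s \<cdot>\<^sub>m u1 0 * (e \<cdot>\<^sub>m H1)"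
    unfolding mat_adjoint_mult[OF p.H_carrier p.v_carrier] p.adjoint_v p.adjoint_H ..
  then have adjuH1: "mat_adjoint (H1 * v1) = (e * s) \<cdot>\<^sub>m (u1 0 * H1)"
    by (simp add: smult_mat_mult smsm mult.commute)
  have "mat_adjoint (H2 * v2) = s \<cdot>\<^sub>m u2 0 * ((e * s) \<cdot>\<^sub>m H2)"
    unfolding mat_adjoint_mult[OF q.H_carrier q.v_carrier] q.adjoint_v q.adjoint_H ..
  then have adjuH2: "mat_adjoint (H2 * v2) = e \<cdot>\<^sub>m (u2 0 * H2)"
    by (simp add: smult_mat_mult smsm s mult_ac)
  note adjuH = adjuH1 adjuH2
  have adjA: "mat_adjoint A1 = (e * s) \<cdot>\<^sub>m A1" "mat_adjoint A0 = e \<cdot>\<^sub>m A0"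
    unfolding A1_def A0_def
    by (subst mat_adjoint_four_block[of _ p p _ q _ q], (use carr in auto)[4],
        intro eq_matI; use carr in \<open>auto simp: mat_adjoint_uminus p.adjoint_F p.adjoint_H q.adjoint_F q.adjoint_H ss mult_ac\<close>)+
  have adjN: "mat_adjoint N1 = (e * s) \<cdot>\<^sub>m C1" "mat_adjoint N0 = e \<cdot>\<^sub>m C0"
    unfolding N1_def N0_def C1_def C0_def append_rows_def append_cols_def
    by (subst mat_adjoint_four_block[of _ p m _ 0 _ q], (use Hv in auto)[4],
        intro eq_matI; use Hv uH in \<open>auto simp: adjuH simp del: index_mult_mat(1)\<close>)+
  have adjC: "mat_adjoint C1 = (e * s) \<cdot>\<^sub>m N1" "mat_adjoint C0 = e \<cdot>\<^sub>m N0"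
  proof -
    have "N1 = mat_adjoint ((e * s) \<cdot>\<^sub>m C1)" "N0 = mat_adjoint (e \<cdot>\<^sub>m C0)"
      using adjN by (metis mat_adjoint_adjoint)+
    then show "mat_adjoint C1 = (e * s) \<cdot>\<^sub>m N1" "mat_adjoint C0 = e \<cdot>\<^sub>m N0"
      using C by (auto simp: mat_adjoint_smult e_def s_def mult_ac ss[unfolded s_def] intro!: eq_matI)
  qed
  have inj: "y = 0\<^sub>v (p + q)"
    if ab: "(a, b) \<noteq> (0, 0)" and y: "y \<in> carrier_vec (p + q)"
      and yA: "(a \<cdot>\<^sub>m A1 + b \<cdot>\<^sub>m A0) *\<^sub>v y = 0\<^sub>v (p + q)" and yC: "(a \<cdot>\<^sub>m C1 + b \<cdot>\<^sub>m C0) *\<^sub>v y = 0\<^sub>v m" for a b y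
  proof -
    define x where "x = vec_first y p"
    define w where "w = vec_last y q"
    have yxw: "y = x @\<^sub>v w" using y by (simp add: x_def w_def)
    have x: "x \<in> carrier_vec p" and w: "w \<in> carrier_vec q" by (simp_all add: x_def w_def)
    have cv: "F1 *\<^sub>v x \<in> carrier_vec p" "H1 *\<^sub>v x \<in> carrier_vec p" "F2 *\<^sub>v w \<in> carrier_vec q" "H2 *\<^sub>v w \<in> carrier_vec q"
      by (auto intro!: carrier_vecI)
    have blk: "a \<cdot>\<^sub>m A1 + b \<cdot>\<^sub>m A0 =
        four_block_mat (a \<cdot>\<^sub>m F1 + (- b) \<cdot>\<^sub>m H1) (0\<^sub>m p q) (0\<^sub>m q p) (b \<cdot>\<^sub>m F2 + (- a) \<cdot>\<^sub>m H2)"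
      using carr unfolding A1_def A0_def by (intro eq_matI) auto
    have X: "a \<cdot>\<^sub>m F1 + (- b) \<cdot>\<^sub>m H1 \<in> carrier_mat p p" and Z: "b \<cdot>\<^sub>m F2 + (- a) \<cdot>\<^sub>m H2 \<in> carrier_mat q q"
      by (rule carrier_matI; simp)+
    have sv: "(c \<cdot>\<^sub>m M + d \<cdot>\<^sub>m M') *\<^sub>v z = c \<cdot>\<^sub>v (M *\<^sub>v z) + d \<cdot>\<^sub>v (M' *\<^sub>v z)"
      if "M \<in> carrier_mat n n" "M' \<in> carrier_mat n n" "z \<in> carrier_vec n" for c d :: complex and M M' z n
      using add_mult_distrib_mat_vec[of "c \<cdot>\<^sub>m M" n n "d \<cdot>\<^sub>m M'" z] that
        smult_mat_mult_vec[of M z c] smult_mat_mult_vec[of M' z d] by simp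
    have z0: "0\<^sub>m k l *\<^sub>v z = 0\<^sub>v k" if "z \<in> carrier_vec l" for k l and z :: "complex vec"
      using that by (intro eq_vecI) (auto simp: scalar_prod_def)
    have "(a \<cdot>\<^sub>m A1 + b \<cdot>\<^sub>m A0) *\<^sub>v y =
        ((a \<cdot>\<^sub>m F1 + (- b) \<cdot>\<^sub>m H1) *\<^sub>v x + 0\<^sub>m p q *\<^sub>v w) @\<^sub>v (0\<^sub>m q p *\<^sub>v x + (b \<cdot>\<^sub>m F2 + (- a) \<cdot>\<^sub>m H2) *\<^sub>v w)"
      unfolding blk yxw by (rule four_block_mat_mult_vec[OF X zero_carrier_mat zero_carrier_mat Z x w])
    also have "\<dots> = (a \<cdot>\<^sub>v (F1 *\<^sub>v x) + (- b) \<cdot>\<^sub>v (H1 *\<^sub>v x)) @\<^sub>v (b \<cdot>\<^sub>v (F2 *\<^sub>v w) + (- a) \<cdot>\<^sub>v (H2 *\<^sub>v w))"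
      unfolding sv[OF p.F_carrier p.H_carrier x] sv[OF q.F_carrier q.H_carrier w] z0[OF x] z0[OF w]
      using cv by simp
    finally have "(a \<cdot>\<^sub>v (F1 *\<^sub>v x) + (- b) \<cdot>\<^sub>v (H1 *\<^sub>v x)) @\<^sub>v (b \<cdot>\<^sub>v (F2 *\<^sub>v w) + (- a) \<cdot>\<^sub>v (H2 *\<^sub>v w)) = 0\<^sub>v (p + q)"
      using yA by simp
    then have eqs: "a \<cdot>\<^sub>v (F1 *\<^sub>v x) + (- b) \<cdot>\<^sub>v (H1 *\<^sub>v x) = 0\<^sub>v p" "b \<cdot>\<^sub>v (F2 *\<^sub>v w) + (- a) \<cdot>\<^sub>v (H2 *\<^sub>v w) = 0\<^sub>v q"
      using append_eq_zero_vec_iff cv by (metis add_carrier_vec smult_carrier_vec)+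
    have neg: "c \<cdot>\<^sub>v z = d \<cdot>\<^sub>v z'" if "c \<cdot>\<^sub>v z + (- d) \<cdot>\<^sub>v z' = 0\<^sub>v n" "z \<in> carrier_vec n" "z' \<in> carrier_vec n"
      for c d :: complex and z z' n
    proof (rule eq_vecI)
      fix i assume "i < dim_vec (d \<cdot>\<^sub>v z')"
      then have i: "i < n" using that by simp
      then show "(c \<cdot>\<^sub>v z) $ i = (d \<cdot>\<^sub>v z') $ i"
        using arg_cong[OF that(1), of "\<lambda>v. vec_index v i"] that(2,3) by simp
    qed (use that in simp)
    have "a \<cdot>\<^sub>m C1 + b \<cdot>\<^sub>m C0 = (a \<cdot>\<^sub>m (u1 0 * H1)) @\<^sub>c (b \<cdot>\<^sub>m (u2 0 * H2))"
      using uH unfolding C1_def C0_def append_cols_def by (intro eq_matI) auto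
    then have "(a \<cdot>\<^sub>m (u1 0 * H1)) *\<^sub>v x + (b \<cdot>\<^sub>m (u2 0 * H2)) *\<^sub>v w = 0\<^sub>v m"
      using yC mult_append_cols_vec[of "a \<cdot>\<^sub>m (u1 0 * H1)" m p "b \<cdot>\<^sub>m (u2 0 * H2)" q x w] uH x w
      by (simp add: yxw)
    moreover have "(a \<cdot>\<^sub>m (u1 0 * H1)) *\<^sub>v x = a \<cdot>\<^sub>v (u1 0 *\<^sub>v (H1 *\<^sub>v x))"
      using x uH by (subst smult_mat_mult_vec) (auto simp: assoc_mult_mat_vec[OF p.u_carrier p.H_carrier])
    moreover have "(b \<cdot>\<^sub>m (u2 0 * H2)) *\<^sub>v w = b \<cdot>\<^sub>v (u2 0 *\<^sub>v (H2 *\<^sub>v w))"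
      using w uH by (subst smult_mat_mult_vec) (auto simp: assoc_mult_mat_vec[OF q.u_carrier q.H_carrier])
    ultimately have "a \<cdot>\<^sub>v (u1 0 *\<^sub>v (H1 *\<^sub>v x)) + b \<cdot>\<^sub>v (u2 0 *\<^sub>v (H2 *\<^sub>v w)) = 0\<^sub>v m" by simp
    then have "x = 0\<^sub>v p \<and> w = 0\<^sub>v q"
      using block_pencil_injective[OF h1 nil h2 ab x w neg[OF eqs(1) cv(1,2)] neg[OF eqs(2) cv(3,4)]] by blast
    then show ?thesis using yxw append_eq_zero_vec_iff[OF x w] by blast
  qed
  have sm: "strongly_minimal (p + q) (pencil A1 A0) B (pencil C1 C0)"
    by (rule strongly_minimal_pencilI[OF A N C Bc s e adjA adjN inj])
  \<comment> \<open>The first block is nonsingular at 0, where its value is \<open>- H1\<close>; the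
    second has the nonsingular leading coefficient \<open>- H2\<close>.\<close>
  have detA: "det (pencil A1 A0) \<noteq> 0"
  proof -
    have "det (- H1) \<noteq> 0" "det (- H2) \<noteq> 0"
      using p.det_H q.det_H det_0_negate[OF p.H_carrier] det_0_negate[OF q.H_carrier] by blast+
    then have "det (pencil F1 (- H1)) \<noteq> 0" "det (pencil (- H2) F2) \<noteq> 0"
      using det_pencil_neq_0[OF p.F_carrier uminus_carrier_mat[OF p.H_carrier]]
        det_pencil_neq_0'[OF uminus_carrier_mat[OF q.H_carrier] q.F_carrier] by blast+
    moreover have "det (pencil A1 A0) = det (pencil F1 (- H1)) * det (pencil (- H2) F2)"
      unfolding Ac[symmetric] poly_blocks(1) sp_blocks(1)
      by (rule det_four_block_mat_lower_left_zero[OF pencil_carrier[OF p.F_carrier] zero_carrier_mat refl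
            pencil_carrier[OF uminus_carrier_mat[OF q.H_carrier]]])
    ultimately show ?thesis by simp
  qed
  \<comment> \<open>The two series occupy negative and positive indices respectively; each solves
    the equation for its own diagonal block.\<close>
  define k1 where "k1 j = (if j < 0 then u1 (nat (- j - 1)) else 0\<^sub>m m p)" for j :: int
  define k2 where "k2 j = (if j > 0 then u2 (nat (j - 1)) else 0\<^sub>m m q)" for j :: int
  have k12: "k1 j \<in> carrier_mat m p" "k2 j \<in> carrier_mat m q" for j
    using carr by (auto simp: k1_def k2_def)
  have tf: "transfer_function (pencil A1 A0) B (pencil C1 C0) (pencil D1 D0) = R"
  proof (rule transfer_function_pencil[OF A C N D(1,2) detA Bcarr Bc _ _ _ R])
    show "k1 j @\<^sub>c k2 j \<in> carrier_mat m (p + q)" for j using k12 by auto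
    \<comment> \<open>For such \<open>j\<close> the argument \<open>- j - 1\<close> exceeds
      \<open>k\<close>, so nilpotency supplies the lower bound that a Laurent series
      requires.\<close>
    show "k1 j @\<^sub>c k2 j = 0\<^sub>m m (p + q)" if "j < - int k - 1" for j
    proof -
      have "k1 j = 0\<^sub>m m p" using that by (auto simp: k1_def intro!: nil)
      moreover have "k2 j = 0\<^sub>m m q" using that by (auto simp: k2_def)
      ultimately show ?thesis unfolding append_cols_def by (intro eq_matI) auto
    qed
    show "(k1 j @\<^sub>c k2 j) * A0 + (k1 (j + 1) @\<^sub>c k2 (j + 1)) * A1 =
      - (if j = -1 then C1 else if j = 0 then C0 else 0\<^sub>m m (p + q))" for j
    proof -
      have "(k1 j @\<^sub>c k2 j) * A0 + (k1 (j + 1) @\<^sub>c k2 (j + 1)) * A1 =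
          (k1 j * (- H1) + k1 (j + 1) * F1) @\<^sub>c (k2 j * F2 + k2 (j + 1) * (- H2))"
        unfolding A0_def A1_def
          append_cols_mult_four_block[OF k12 uminus_carrier_mat[OF p.H_carrier] zero_carrier_mat zero_carrier_mat q.F_carrier]
          append_cols_mult_four_block[OF k12 p.F_carrier zero_carrier_mat zero_carrier_mat uminus_carrier_mat[OF q.H_carrier]]
        using k12[of j] k12[of "j + 1"] carr unfolding append_cols_def
        by (intro eq_matI) (auto simp: scalar_prod_def)
      also have "\<dots> = (- (if j = -1 then u1 0 * H1 else 0\<^sub>m m p)) @\<^sub>c (- (if j = 0 then u2 0 * H2 else 0\<^sub>m m q))"
        unfolding k1_def k2_def p.nilpotent_coeffs q.causal_coeffs ..
      also have "\<dots> = - (if j = -1 then C1 else if j = 0 then C0 else 0\<^sub>m m (p + q))"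
        unfolding C1_def C0_def append_cols_def using uH by (intro eq_matI) auto
      finally show ?thesis .
    qed
    show "fls_nth (laurent_at_infinity (R $$ (a, b))) j =
        ((k1 j @\<^sub>c k2 j) * N0 + (k1 (j + 1) @\<^sub>c k2 (j + 1)) * N1) $$ (a, b) +
        (if j = -1 then D1 $$ (a, b) else if j = 0 then D0 $$ (a, b) else 0)"
      if ab: "a < m" "b < m" for a b j
    proof -
      \<comment> \<open>\<open>N0\<close> lives on the second block and \<open>N1\<close> on the
        first, so \<open>k2 j\<close> and \<open>k1 (j + 1)\<close> survive. For j < -1 the latter
        is \<open>u1\<close> at \<open>- j - 2\<close>, the offset in \<open>coeffs\<close>.\<close>
      have "(k1 j @\<^sub>c k2 j) * N0 + (k1 (j + 1) @\<^sub>c k2 (j + 1)) * N1 = k2 j * (H2 * v2) + k1 (j + 1) * (H1 * v1)"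
        unfolding N0_def N1_def append_cols_mult_append_rows[OF k12 zero_carrier_mat Hv(2)]
          append_cols_mult_append_rows[OF k12 Hv(1) zero_carrier_mat]
        using k12[of j] k12[of "j + 1"] Hv by (intro eq_matI) (auto simp: scalar_prod_def)
      moreover have "(k2 j * (H2 * v2)) $$ (a, b) = (if j > 0 then g2 (nat (j - 1)) a b else 0)"
        using q.val[OF ab, of "nat (j - 1)"] ab carr
        by (auto simp: k2_def mult_mat_assoc simp del: index_mult_mat(1))
      moreover have "(k1 (j + 1) * (H1 * v1)) $$ (a, b) = (if j < -1 then g1 (nat (- j - 2)) a b else 0)"
      proof (cases "j < -1")
        case True
        have "nat (- (j + 1) - 1) = nat (- j - 2)" by simp
        moreover have "j + 1 < 0" using True by simp
        ultimately have "k1 (j + 1) = u1 (nat (- j - 2))" unfolding k1_def by (simp only: if_True)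
        then have "k1 (j + 1) * (H1 * v1) = u1 (nat (- j - 2)) * H1 * v1" by (simp add: mult_mat_assoc)
        then show ?thesis using p.val[OF ab, of "nat (- j - 2)"] True by (simp only: if_True)
      next
        case False
        then have "k1 (j + 1) = 0\<^sub>m m p" unfolding k1_def by simp
        then show ?thesis using ab False left_mult_zero_mat[OF Hv(1)] by simp
      qed
      ultimately show ?thesis
        unfolding coeffs[OF ab] using ab k12[of j] k12[of "j + 1"] Hv
        by (simp del: index_mult_mat(1))
    qed
  qed
  have L: "four_block_mat (pencil A1 A0) (- B) (pencil C1 C0) (pencil D1 D0) =
      pencil (four_block_mat A1 N1 C1 D1) (four_block_mat A0 N0 C0 D0)"
    unfolding Bc by (rule four_block_pencil[OF A(1) N(1) C(1) D(1) A(2) N(2) C(2) D(2)])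
  have sc: "self_conj kind (rat_mat (pencil (four_block_mat A1 N1 C1 D1) (four_block_mat A0 N0 C0 D0)))"
  proof (rule self_conj_pencil)
    show "four_block_mat A1 N1 C1 D1 \<in> carrier_mat (p + q + m) (p + q + m)"
      "four_block_mat A0 N0 C0 D0 \<in> carrier_mat (p + q + m) (p + q + m)"
      using A D by auto
    show "mat_adjoint (four_block_mat A1 N1 C1 D1) = (kind_sign kind * kind_twist kind) \<cdot>\<^sub>m four_block_mat A1 N1 C1 D1"
      unfolding mat_adjoint_four_block[OF A(1) N(1) C(1) D(1)] adjA adjN adjC D(3)
        smult_four_block_mat[OF A(1) N(1) C(1) D(1)] e_def s_def ..
    show "mat_adjoint (four_block_mat A0 N0 C0 D0) = kind_sign kind \<cdot>\<^sub>m four_block_mat A0 N0 C0 D0"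
      unfolding mat_adjoint_four_block[OF A(2) N(2) C(2) D(2)] adjA adjN adjC D(4)
        smult_four_block_mat[OF A(2) N(2) C(2) D(2)] e_def ..
  qed
  have "linear_system_matrix (p + q) m m (pencil A1 A0) B (pencil C1 C0) (pencil D1 D0)"
    unfolding linear_system_matrix_def L using A Bcarr C D detA poly_mat_degree_pencil_le by auto
  then show ?thesis
    unfolding Let_def B_def[symmetric] Ac Cc poly_blocks(4) L strongly_minimal_linearization_def
    using sm R tf sc by blast
qed

section \<open>The polynomial part\<close>

text \<open>These are columns c, ..., c + r - 1 of the identity when they fit. They turn deletion of
  rows and columns into matrix products: c = N - r for the polynomial part, whose nonzero block is
  at the bottom right, and c = 0 for the strictly proper part.\<close>

definition selection_mat :: "nat \<Rightarrow> nat \<Rightarrow> nat \<Rightarrow> complex mat" where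
  "selection_mat N r c = mat N r (\<lambda>(x, w). if x = w + c then 1 else 0)"

lemma selection_mat_carrier [simp]: "selection_mat N r c \<in> carrier_mat N r"
  and dim_selection_mat [simp]: "dim_row (selection_mat N r c) = N" "dim_col (selection_mat N r c) = r"
  by (simp_all add: selection_mat_def)

lemma index_selection_mat [simp]:
  "x < N \<Longrightarrow> w < r \<Longrightarrow> selection_mat N r c $$ (x, w) = (if x = w + c then 1 else 0)"
  by (simp add: selection_mat_def)

lemma index_mult_selection:
  assumes "A \<in> carrier_mat n N" "x < n" "w < r" "c + r \<le> N"
  shows "(A * selection_mat N r c) $$ (x, w) = A $$ (x, w + c)"
proof -
  have "(A * selection_mat N r c) $$ (x, w) = (\<Sum>y = 0..<N. A $$ (x, y) * (if y = w + c then 1 else 0))"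
    using assms by (simp add: scalar_prod_def selection_mat_def)
  also have "\<dots> = (\<Sum>y = 0..<N. if y = w + c then A $$ (x, w + c) else 0)" by (intro sum.cong) auto
  also have "\<dots> = A $$ (x, w + c)" using assms by simp
  finally show ?thesis .
qed

lemma index_adjoint_selection_mult:
  assumes "A \<in> carrier_mat N n" "w < r" "x < n" "c + r \<le> N"
  shows "(mat_adjoint (selection_mat N r c) * A) $$ (w, x) = A $$ (w + c, x)"
proof -
  have "(mat_adjoint (selection_mat N r c) * A) $$ (w, x) = (\<Sum>y = 0..<N. (if y = w + c then 1 else 0) * A $$ (y, x))"
    using assms by (auto simp: scalar_prod_def selection_mat_def intro!: sum.cong)
  also have "\<dots> = (\<Sum>y = 0..<N. if y = w + c then A $$ (w + c, x) else 0)" by (intro sum.cong) auto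
  also have "\<dots> = A $$ (w + c, x)" using assms by simp
  finally show ?thesis .
qed

lemma adjoint_selection_mult_selection:
  assumes "c + r \<le> N"
  shows "mat_adjoint (selection_mat N r c) * selection_mat N r c = 1\<^sub>m r"
  by (rule eq_matI)
    (use assms in \<open>auto simp: index_adjoint_selection_mult[of _ N r] simp del: index_mult_mat(1)\<close>)

lemma index_selection_mult:
  assumes "A \<in> carrier_mat r n" "x < N" "y < n"
  shows "(selection_mat N r c * A) $$ (x, y) = (if c \<le> x \<and> x < c + r then A $$ (x - c, y) else 0)"
proof -
  have "(selection_mat N r c * A) $$ (x, y) = (\<Sum>w = 0..<r. (if x = w + c then 1 else 0) * A $$ (w, y))"
    using assms by (simp add: scalar_prod_def selection_mat_def)
  also have "\<dots> = (\<Sum>w = 0..<r. if w = x - c then (if c \<le> x then A $$ (x - c, y) else 0) else 0)"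
    by (intro sum.cong) auto
  also have "\<dots> = (if c \<le> x \<and> x < c + r then A $$ (x - c, y) else 0)" by auto
  finally show ?thesis .
qed

lemma index_mult_adjoint_selection:
  assumes "A \<in> carrier_mat n r" "y < N" "x < n"
  shows "(A * mat_adjoint (selection_mat N r c)) $$ (x, y) = (if c \<le> y \<and> y < c + r then A $$ (x, y - c) else 0)"
proof -
  have "(A * mat_adjoint (selection_mat N r c)) $$ (x, y) = (\<Sum>w = 0..<r. A $$ (x, w) * (if y = w + c then 1 else 0))"
    using assms by (auto simp: scalar_prod_def selection_mat_def intro!: sum.cong)
  also have "\<dots> = (\<Sum>w = 0..<r. if w = y - c then (if c \<le> y then A $$ (x, y - c) else 0) else 0)"
    by (intro sum.cong) auto
  also have "\<dots> = (if c \<le> y \<and> y < c + r then A $$ (x, y - c) else 0)" by auto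
  finally show ?thesis .
qed

lemma selection_conj_eq_diag2:
  assumes K: "K \<in> carrier_mat r r" and r: "r \<le> N"
  shows "selection_mat N r (N - r) * K * mat_adjoint (selection_mat N r (N - r)) = diag2 (0\<^sub>m (N - r) (N - r)) K"
    and "selection_mat N r 0 * K * mat_adjoint (selection_mat N r 0) = diag2 K (0\<^sub>m (N - r) (N - r))"
proof -
  have SK: "selection_mat N r c * K \<in> carrier_mat N r" for c using K by (intro mult_carrier_mat) auto
  note idx = index_mult_adjoint_selection[OF SK] index_selection_mult[OF K]
  show "selection_mat N r (N - r) * K * mat_adjoint (selection_mat N r (N - r)) = diag2 (0\<^sub>m (N - r) (N - r)) K"
    by (rule eq_matI) (use K r in \<open>auto simp: idx diag2_def simp del: index_mult_mat(1)\<close>)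
  show "selection_mat N r 0 * K * mat_adjoint (selection_mat N r 0) = diag2 K (0\<^sub>m (N - r) (N - r))"
    by (rule eq_matI) (use K r in \<open>auto simp: idx diag2_def simp del: index_mult_mat(1)\<close>)
qed

text \<open>Undoing the unitary factors gives \<open>T = (U E) K (V E)^*\<close> with isometries
  \<open>U E\<close> and \<open>V E\<close>, so the compression to \<open>K\<close> loses no
  information about \<open>T\<close>. The one-sided identities are what
  \<open>hankel_realizationI\<close> asks for.\<close>

lemma unitary_compression:
  assumes U: "unitary_mat U" "U \<in> carrier_mat N N" and V: "unitary_mat V" "V \<in> carrier_mat N N"
    and T: "T \<in> carrier_mat N N" and E: "E \<in> carrier_mat N r" "mat_adjoint E * E = 1\<^sub>m r"
    and K: "K \<in> carrier_mat r r" and UTV: "mat_adjoint U * T * V = E * K * mat_adjoint E"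
  shows "mat_adjoint (U * E) * (U * E) = 1\<^sub>m r" "mat_adjoint (V * E) * (V * E) = 1\<^sub>m r"
    "T * (V * E) = U * E * K" "mat_adjoint (U * E) * T = K * mat_adjoint (V * E)"
    "T = U * E * K * mat_adjoint (V * E)"
proof -
  note [simp] = carrier_matD[OF U(2)] carrier_matD[OF V(2)] carrier_matD[OF T] carrier_matD[OF E(1)] carrier_matD[OF K]
  note assoc = mult_mat_assoc
  have adj: "mat_adjoint (U * E) = mat_adjoint E * mat_adjoint U" "mat_adjoint (V * E) = mat_adjoint E * mat_adjoint V"
    by (rule mat_adjoint_mult[OF U(2) E(1)], rule mat_adjoint_mult[OF V(2) E(1)])
  have iso: "mat_adjoint (W * E) * (W * E) = 1\<^sub>m r" if W: "unitary_mat W" "W \<in> carrier_mat N N" for W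
  proof -
    note [simp] = carrier_matD[OF W(2)]
    have "mat_adjoint (W * E) * (W * E) = mat_adjoint E * ((mat_adjoint W * W) * E)"
      by (simp add: mat_adjoint_mult[OF W(2) E(1)] assoc)
    also have "\<dots> = 1\<^sub>m r" unfolding unitary_mat_mult_adjoint(2)[OF W] using E by simp
    finally show ?thesis .
  qed
  show "mat_adjoint (U * E) * (U * E) = 1\<^sub>m r" by (rule iso[OF U])
  show VE: "mat_adjoint (V * E) * (V * E) = 1\<^sub>m r" by (rule iso[OF V])
  have "T = (U * mat_adjoint U) * T * (V * mat_adjoint V)"
    unfolding unitary_mat_mult_adjoint(1)[OF U] unitary_mat_mult_adjoint(1)[OF V] using T by simp
  also have "\<dots> = U * (mat_adjoint U * T * V) * mat_adjoint V" by (simp add: assoc)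
  also have "\<dots> = U * E * K * mat_adjoint (V * E)" unfolding UTV adj by (simp add: assoc)
  finally show TT: "T = U * E * K * mat_adjoint (V * E)" .
  have "U * E * K * mat_adjoint (V * E) * (V * E) = U * E * K * (mat_adjoint (V * E) * (V * E))"
    by (simp add: assoc)
  also have "\<dots> = U * E * K" unfolding VE using K by (simp add: assoc)
  finally show "T * (V * E) = U * E * K" using TT by simp
  have "mat_adjoint (U * E) * (U * E * K * mat_adjoint (V * E)) =
      mat_adjoint (U * E) * (U * E) * (K * mat_adjoint (V * E))"
    by (simp add: assoc)
  also have "\<dots> = K * mat_adjoint (V * E)" unfolding iso[OF U]
    by (rule left_mult_one_mat) (auto intro!: carrier_matI)
  finally show "mat_adjoint (U * E) * T = K * mat_adjoint (V * E)" using TT by simp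
qed

text \<open>\<open>inverts_mat\<close> speaks of products only, so the size of the inverse is
  recovered from the dimensions of both products.\<close>

lemma invertible_mat_det:
  assumes "invertible_mat (K :: complex mat)" "K \<in> carrier_mat r r"
  shows "det K \<noteq> 0"
proof
  assume "det K = 0"
  obtain B where "inverts_mat K B" "inverts_mat B K"
    using assms unfolding invertible_mat_def by blast
  then have KB: "K * B = 1\<^sub>m r" and BK: "B * K = 1\<^sub>m (dim_row B)"
    using assms by (auto simp: inverts_mat_def)
  have "dim_col B = r" using arg_cong[OF KB, of dim_col] by simp
  moreover have "dim_row B = r" using arg_cong[OF BK, of dim_col] assms by simp
  ultimately have "B \<in> carrier_mat r r" by auto
  then have "det K * det B = 1" using det_mult[OF assms(2)] KB by (metis det_one)
  then show False using \<open>det K = 0\<close> by simp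
qed

lemma delete_leading_four_block:
  assumes M: "M11 \<in> carrier_mat N N" "M12 \<in> carrier_mat N m" "M21 \<in> carrier_mat m N" "M22 \<in> carrier_mat m m"
    and r: "r \<le> N" and E: "E = selection_mat N r (N - r)"
  shows "delete_leading (N - r) (four_block_mat M11 M12 M21 M22) =
    four_block_mat (mat_adjoint E * M11 * E) (mat_adjoint E * M12) (M21 * E) M22"
proof -
  have EM: "mat_adjoint E * M11 \<in> carrier_mat r N" using M by (auto simp: E intro!: carrier_matI)
  note idx = index_mult_selection[OF EM[unfolded E]] index_mult_selection[OF M(3)]
    index_adjoint_selection_mult[OF M(1)] index_adjoint_selection_mult[OF M(2)]
  show ?thesis
    by (rule eq_matI)
      (use M r in \<open>auto simp: E idx delete_leading_def simp del: index_mult_mat(1)\<close>)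
qed

lemma delete_leading_pencil:
  assumes "dim_row M0 = dim_row M1" "dim_col M0 = dim_col M1"
  shows "delete_leading c (pencil M1 M0) = pencil (delete_leading c M1) (delete_leading c M0)"
  using assms by (intro eq_matI) (auto simp: delete_leading_def)

lemma four_block_mat_inject:
  assumes "A \<in> carrier_mat n p" "B \<in> carrier_mat n q" "C \<in> carrier_mat m p" "D \<in> carrier_mat m q"
    and "A' \<in> carrier_mat n p" "B' \<in> carrier_mat n q" "C' \<in> carrier_mat m p" "D' \<in> carrier_mat m q"
    and eq: "four_block_mat A B C D = four_block_mat A' B' C' D'"
  shows "A = A'" "B = B'" "C = C'" "D = D'"
proof -
  have e: "four_block_mat A B C D $$ (i, j) = four_block_mat A' B' C' D' $$ (i, j)" for i j by (simp add: eq)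
  show "A = A'"
  proof (rule eq_matI)
    fix i j assume "i < dim_row A'" "j < dim_col A'"
    then show "A $$ (i, j) = A' $$ (i, j)" using e[of i j] assms(1-8) by auto
  qed (use assms in auto)
  show "B = B'"
  proof (rule eq_matI)
    fix i j assume "i < dim_row B'" "j < dim_col B'"
    then show "B $$ (i, j) = B' $$ (i, j)" using e[of i "j + p"] assms(1-8) by auto
  qed (use assms in auto)
  show "C = C'"
  proof (rule eq_matI)
    fix i j assume "i < dim_row C'" "j < dim_col C'"
    then show "C $$ (i, j) = C' $$ (i, j)" using e[of "i + n" j] assms(1-8) by auto
  qed (use assms in auto)
  show "D = D'"
  proof (rule eq_matI)
    fix i j assume "i < dim_row D'" "j < dim_col D'"
    then show "D $$ (i, j) = D' $$ (i, j)" using e[of "i + n" "j + p"] assms(1-8) by auto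
  qed (use assms in auto)
qed

lemma const_mult_pencil:
  assumes "X \<in> carrier_mat k n" "M1 \<in> carrier_mat n l" "M0 \<in> carrier_mat n l" "Y \<in> carrier_mat l q"
  shows "const_mat X * pencil M1 M0 = pencil (X * M1) (X * M0)"
    and "pencil M1 M0 * const_mat Y = pencil (M1 * Y) (M0 * Y)"
proof -
  have sum: "(\<Sum>i\<in>A. [:f i, g i:]) = [:\<Sum>i\<in>A. f i, \<Sum>i\<in>A. g i:]" for A :: "nat set" and f g :: "nat \<Rightarrow> complex"
    by (induction A rule: infinite_finite_induct) auto
  show "const_mat X * pencil M1 M0 = pencil (X * M1) (X * M0)"
    using assms by (intro eq_matI) (auto simp: scalar_prod_def sum mult.commute)
  show "pencil M1 M0 * const_mat Y = pencil (M1 * Y) (M0 * Y)"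
    using assms by (intro eq_matI) (auto simp: scalar_prod_def sum mult.commute)
qed

lemma coeff_above_poly_mat_degree:
  assumes "P \<in> carrier_mat n k" "a < n" "b < k" "poly_mat_degree P < j"
  shows "coeff (P $$ (a, b)) j = 0"
proof -
  have "P $$ (a, b) \<in> elements_mat P" using assms by auto
  then have "degree (P $$ (a, b)) \<le> poly_mat_degree P"
    unfolding poly_mat_degree_def by (intro Max_ge[OF finite_degrees]) auto
  then show ?thesis using assms by (intro coeff_eq_0) simp
qed

text \<open>Blocks are numbered from 1 in \<open>sign_diag\<close> and from 0 in
  \<open>twist_diag\<close>, hence \<open>f (Suc i)\<close> against
  \<open>Suc (\<beta> i)\<close>.\<close>

lemma twist_diag_eq_sign_diag:
  assumes "\<And>i. i < k \<Longrightarrow> f (Suc i) = Suc (\<beta> i)"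
  shows "twist_diag m k \<beta> (-1) = sign_diag k m f"
proof (rule eq_matI)
  fix x y assume "x < dim_row (sign_diag k m f)" "y < dim_col (sign_diag k m f)"
  then have xy: "x < k * m" "y < k * m" by (auto simp: sign_diag_def mat_of_blocks_def)
  have "x = y \<longleftrightarrow> x div m = y div m \<and> x mod m = y mod m" by (metis div_mult_mod_eq)
  then show "twist_diag m k \<beta> (-1) $$ (x, y) = sign_diag k m f $$ (x, y)"
    using xy index_block_mat[OF xy(1)] index_block_mat[OF xy(2)] assms
    by (auto simp: twist_diag_def sign_diag_def mat_of_blocks_def)
qed (auto simp: sign_diag_def mat_of_blocks_def)

lemma twist_diag_one: "twist_diag m k \<beta> 1 = 1\<^sub>m (k * m)"
  by (rule eq_matI) (auto simp: twist_diag_def)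


lemma diag2_mult_four_block:
  fixes X Y :: "complex mat"
  assumes X: "X \<in> carrier_mat N N" and Y: "Y \<in> carrier_mat N N"
    and M: "M11 \<in> carrier_mat N N" "M12 \<in> carrier_mat N m" "M21 \<in> carrier_mat m N" "M22 \<in> carrier_mat m m"
  shows "diag2 X (1\<^sub>m m) * four_block_mat M11 M12 M21 M22 * diag2 Y (1\<^sub>m m) =
    four_block_mat (X * M11 * Y) (X * M12) (M21 * Y) M22"
proof -
  have d: "diag2 W (1\<^sub>m m) = four_block_mat W (0\<^sub>m N m) (0\<^sub>m m N) (1\<^sub>m m)" if "W \<in> carrier_mat N N" for W :: "complex mat"
    using that by (simp add: diag2_def)
  have XM: "X * M11 \<in> carrier_mat N N" "X * M12 \<in> carrier_mat N m" using X M by auto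
  have "diag2 X (1\<^sub>m m) * four_block_mat M11 M12 M21 M22 = four_block_mat (X * M11) (X * M12) M21 M22"
    unfolding d[OF X] mult_four_block_mat[OF X zero_carrier_mat zero_carrier_mat one_carrier_mat M]
    using X M by (intro cong_four_block_mat) auto
  moreover have "four_block_mat (X * M11) (X * M12) M21 M22 * diag2 Y (1\<^sub>m m) =
      four_block_mat (X * M11 * Y) (X * M12) (M21 * Y) M22"
    unfolding d[OF Y] mult_four_block_mat[OF XM M(3,4) Y zero_carrier_mat zero_carrier_mat one_carrier_mat]
    using X Y M XM by (intro cong_four_block_mat) auto
  ultimately show ?thesis by simp
qed

text \<open>\<open>L_poly\<close> is a pencil whose coefficients are bordered Hankel matrices.
  Multiplying by the unitary factors and deleting leading rows and columns amounts to compressing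
  with \<open>U E\<close> and \<open>V E\<close>, where \<open>E\<close> selects the last p
  coordinates.\<close>

lemma poly_part_realization:
  fixes kind :: conj_kind
  defines "s \<equiv> kind_twist kind" and "e \<equiv> kind_sign kind"
  assumes P: "P \<in> carrier_mat m m"
    and sym: "\<And>a b n. a < m \<Longrightarrow> b < m \<Longrightarrow> cnj (coeff (P $$ (a, b)) n) = e * s ^ n * coeff (P $$ (b, a)) n"
    and con: "constructed_from_poly_part kind m P p As Bs Cs Ds"
  obtains H F v u k where
    "hankel_realization m p s e (\<lambda>n a b. coeff (P $$ (a, b)) (n + 2)) H F v u"
    "\<And>n. n \<ge> k \<Longrightarrow> u n = 0\<^sub>m m p"
    "As = pencil F (- H)" "- Bs = pencil (H * v) (0\<^sub>m p m)" "Cs = pencil (u 0 * H) (0\<^sub>m m p)"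
    "Ds = pencil (coeff_mat P 1) (coeff_mat P 0)"
proof -
  have s: "s * s = 1" "cnj s = s" by (simp_all add: s_def)
  define d where "d = poly_mat_degree P"
  define h where "h n a b = coeff (P $$ (a, b)) (n + 2)" for n a b
  have h: "cnj (h n a b) = e * s ^ n * h n b a" if "a < m" "b < m" for n a b
    using sym[OF that, of "n + 2"] s by (simp add: h_def power_add)
  have carr: "As \<in> carrier_mat p p" "Bs \<in> carrier_mat p m" "Cs \<in> carrier_mat m p" "Ds \<in> carrier_mat m m"
    using con by (simp_all add: constructed_from_poly_part_def)
  note zero = coeff_above_poly_mat_degree[OF P, folded d_def]
  note con = con[unfolded constructed_from_poly_part_def Let_def, folded d_def]
  show thesis
  proof (cases "d \<le> 1")
    case True
    then have p: "p = 0" and Ds: "Ds = P" using con by auto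
    \<comment> \<open>Degree at most 1 is covered by an empty realization: every Hankel datum
      vanishes because \<open>n + 2\<close> exceeds the degree.\<close>
    show thesis
    proof (rule that[of "0\<^sub>m 0 0" "0\<^sub>m 0 0" "0\<^sub>m 0 m" "\<lambda>_. 0\<^sub>m m 0" 0])
      show "hankel_realization m p s e (\<lambda>n a b. coeff (P $$ (a, b)) (n + 2)) (0\<^sub>m 0 0) (0\<^sub>m 0 0) (0\<^sub>m 0 m) (\<lambda>_. 0\<^sub>m m 0)"
        unfolding p
      proof (rule hankel_realization.intro)
        show "coeff (P $$ (a, b)) (n + 2) = (0\<^sub>m m 0 * 0\<^sub>m 0 0 * 0\<^sub>m 0 m) $$ (a, b)" if "a < m" "b < m" for a b n
          using zero[OF that, of "n + 2"] True that by (simp add: scalar_prod_def)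
      qed (auto simp: det_def intro!: eq_matI)
      show "Ds = pencil (coeff_mat P 1) (coeff_mat P 0)"
        unfolding Ds
      proof (rule eq_matI)
        fix a b assume "a < dim_row (pencil (coeff_mat P 1) (coeff_mat P 0))"
          "b < dim_col (pencil (coeff_mat P 1) (coeff_mat P 0))"
        then have ab: "a < m" "b < m" using P by auto
        show "P $$ (a, b) = pencil (coeff_mat P 1) (coeff_mat P 0) $$ (a, b)"
        proof (rule poly_eqI)
          fix n
          show "coeff (P $$ (a, b)) n = coeff (pencil (coeff_mat P 1) (coeff_mat P 0) $$ (a, b)) n"
            using ab P zero[OF ab, of n] True by (auto simp: coeff_pCons split: nat.splits)
        qed
      qed (use P in auto)
    qed (use carr p in \<open>auto intro!: eq_matI\<close>)
  next
    case False
    define k where "k = d - 1"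
    \<comment> \<open>With blocks numbered from 0, block (i, j) of \<open>T\<close> is the
      coefficient at 2d - 2 - i - j = \<beta> i + \<beta> j + 2. The last block \<open>z\<close> is
      the one where \<beta> is 0.\<close>
    define \<beta> where "\<beta> i = k - 1 - i" for i
    define z where "z = k - 1"
    have k: "z < k" "\<beta> z = 0" "d = Suc k" using False by (auto simp: z_def k_def \<beta>_def)
    have \<beta>\<beta>: "\<beta> (\<beta> n) = n" if "n < k" for n using that by (simp add: \<beta>_def)
    define N where "N = k * m"
    have N': "m * (d - 1) = N" by (simp add: N_def k_def)
    define E where "E = selection_mat N p (N - p)"
    define T where "T = block_hankel m k \<beta> h"
    define Ts where "Ts = block_hankel m k \<beta> (\<lambda>n. h (Suc n))"
    \<comment> \<open>The last block column and block row of \<open>T\<close> consist of P_d, ...,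
      P_2, the coefficients of lambda in the border of \<open>L_poly\<close>.\<close>
    define Tc where "Tc = mat N m (\<lambda>(x, b). T $$ (x, z * m + b))"
    define Tr where "Tr = mat m N (\<lambda>(a, y). T $$ (z * m + a, y))"
    have T: "T \<in> carrier_mat N N" and Ts: "Ts \<in> carrier_mat N N"
      and Tc: "Tc \<in> carrier_mat N m" and Tr: "Tr \<in> carrier_mat m N"
      by (simp_all add: T_def Ts_def Tc_def Tr_def N_def)
    note idx = index_block_mat
    have zb: "z * m + b < N" "(z * m + b) div m = z" "(z * m + b) mod m = b" if "b < m" for b
    proof -
      have "z * m + b < Suc z * m" using that by simp
      also have "\<dots> \<le> N" unfolding N_def using k by (intro mult_right_mono) auto
      finally show "z * m + b < N" .
    qed (use that in auto)
    have TP: "T_poly m d P = T"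
      by (rule eq_matI)
        (use P in \<open>auto simp: T_poly_def T_def mat_of_blocks_def block_hankel_def h_def idx \<beta>_def k k_def[symmetric]
          intro!: arg_cong[of _ _ "coeff _"] dest!: idx(1)\<close>)
    obtain U V K where UV: "U \<in> carrier_mat N N" "V \<in> carrier_mat N N" "unitary_mat U" "unitary_mat V"
      and US: "if is_para kind then U = sign_diag (d - 1) m (\<lambda>i. d - i) * V else U = V"
      and K: "K \<in> carrier_mat p p" "invertible_mat K"
      and UTV: "mat_adjoint U * T * V = diag2 (0\<^sub>m (N - p) (N - p)) K"
      and L: "four_block_mat As (- Bs) Cs Ds = delete_leading (N - p)
        (const_mat (diag2 (mat_adjoint U) (1\<^sub>m m)) * L_poly m d P * const_mat (diag2 V (1\<^sub>m m)))"
      using con False unfolding N' TP by auto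
    have pN: "p \<le> N"
    proof -
      have "dim_row (mat_adjoint U * T * V) = N" using UV by simp
      then have "N - p + p = N" unfolding UTV using K by (simp add: diag2_def)
      then show ?thesis by simp
    qed
    have E: "E \<in> carrier_mat N p" "mat_adjoint E * E = 1\<^sub>m p"
      using adjoint_selection_mult_selection[of "N - p" p N] pN by (simp_all add: E_def)
    have UTV': "mat_adjoint U * T * V = E * K * mat_adjoint E"
      unfolding UTV E_def selection_conj_eq_diag2(1)[OF K(1) pN] ..
    note comp = unitary_compression[OF UV(3,1) UV(4,2) T E K(1) UTV']
    have UE: "U * E \<in> carrier_mat N p" and VE: "V * E \<in> carrier_mat N p" using UV E by auto
    have US': "U = twist_diag m k \<beta> s * V"
    proof (cases "is_para kind")
      case True
      have "twist_diag m k \<beta> (-1) = sign_diag k m (\<lambda>i. d - i)"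
        by (rule twist_diag_eq_sign_diag) (auto simp: \<beta>_def k)
      then show ?thesis using US True by (simp add: s_def kind_twist_def k_def)
    next
      case False
      then show ?thesis using US UV by (simp add: s_def kind_twist_def twist_diag_one N_def[symmetric])
    qed
    have US1: "U * E = twist_diag m k \<beta> s * (V * E)"
      unfolding US' by (rule mult_mat_assoc) (use UV E in \<open>auto simp: N_def\<close>)
    define W where "W = K * mat_adjoint (V * E)"
    \<comment> \<open>\<open>T\<close> already contains every nonzero block of the infinite Hankel
      matrix, so its own factorization, padded by zeros from k on, factors the infinite matrix. The
      padding also gives \<open>u n = 0\<close> for n \<ge> k.\<close>
    define o' where "o' n a w = (if n < k then (U * E) $$ (\<beta> n * m + a, w) else 0)" for n a w
    define c where "c w n b = (if n < k then W $$ (w, \<beta> n * m + b) else 0)" for w n b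
    have W: "W \<in> carrier_mat p N" unfolding W_def using K VE by auto
    have \<beta>b: "\<beta> n * m + b < N" "(\<beta> n * m + b) div m = \<beta> n" "(\<beta> n * m + b) mod m = b" if "b < m" "n < k" for b n
    proof -
      have "\<beta> n < k" using that by (simp add: \<beta>_def)
      have "\<beta> n * m + b < Suc (\<beta> n) * m" using that by simp
      also have "\<dots> \<le> N" unfolding N_def using \<open>\<beta> n < k\<close> by (intro mult_right_mono) auto
      finally show "\<beta> n * m + b < N" .
    qed (use that in auto)
    have factor: "h (n + n') a b = (\<Sum>w = 0..<p. o' n a w * c w n' b)" if ab: "a < m" "b < m" for n n' a b
    proof (cases "n < k \<and> n' < k")
      case True
      have "h (n + n') a b = T $$ (\<beta> n * m + a, \<beta> n' * m + b)"
        using True ab \<beta>b by (simp add: T_def block_hankel_def N_def \<beta>\<beta>)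
      also have "T = U * E * W"
        unfolding W_def by (subst comp(5)) (rule mult_mat_assoc; use UE K VE in auto)
      finally show ?thesis
        using True ab \<beta>b UE W by (simp add: scalar_prod_def o'_def c_def del: index_mult_mat(2,3) flip: N_def)
    next
      case False
      \<comment> \<open>One of n, n' is at least k = d - 1.\<close>
      then have "d < n + n' + 2" by (auto simp: k)
      then show ?thesis using False zero[OF ab] by (auto simp: h_def o'_def c_def)
    qed
    define F where "F = mat_adjoint (U * E) * Ts * (V * E)"
    define v where "v = mat p m (\<lambda>(w, b). cnj ((V * E) $$ (z * m + b, w)))"
    obtain u where u: "hankel_realization m p s e h K F v u"
      and uU: "\<And>x w. x < N \<Longrightarrow> w < p \<Longrightarrow> (U * E) $$ (x, w) = u (\<beta> (x div m)) $$ (x mod m, w)"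
      and u0: "\<And>n. (\<And>a w. a < m \<Longrightarrow> w < p \<Longrightarrow> o' n a w = 0) \<Longrightarrow> u n = 0\<^sub>m m p"
      using hankel_realizationI[OF s h factor VE[unfolded N_def] US1 comp(1,2) K(1) invertible_mat_det[OF K(2,1)]
          comp(3,4)[unfolded T_def] F_def[unfolded Ts_def] k(1,2) v_def]
      unfolding N_def by blast
    interpret hankel_realization m p s e h K F v u by (rule u)
    let ?P1 = "coeff_mat P 1" and ?P0 = "coeff_mat P 0"
    have P10: "?P1 \<in> carrier_mat m m" "?P0 \<in> carrier_mat m m" using P by auto
    have Lp: "L_poly m d P = pencil (four_block_mat Ts Tc Tr ?P1) (four_block_mat (- T) (0\<^sub>m N m) (0\<^sub>m m N) ?P0)"
    proof -
      have "mat_of_blocks (d - 1) (d - 1) m m (\<lambda>i j.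
          lam \<cdot>\<^sub>m const_mat (coeff_mat P (2 * d + 1 - i - j)) - const_mat (coeff_mat P (2 * d - i - j))) =
          pencil Ts (- T)"
      proof (rule eq_matI)
        fix x y assume "x < dim_row (pencil Ts (- T))" "y < dim_col (pencil Ts (- T))"
        then have xy: "x < k * m" "y < k * m" using Ts by (auto simp: N_def)
        note i = idx[OF xy(1)] idx[OF xy(2)]
        have n: "2 * d - Suc (x div m + y div m) = Suc (Suc (Suc (\<beta> (x div m) + \<beta> (y div m))))"
          "2 * d - Suc (Suc (x div m + y div m)) = Suc (Suc (\<beta> (x div m) + \<beta> (y div m)))" "d - Suc 0 = k"
          using i by (auto simp: \<beta>_def k)
        show "mat_of_blocks (d - 1) (d - 1) m m (\<lambda>i j.
          lam \<cdot>\<^sub>m const_mat (coeff_mat P (2 * d + 1 - i - j)) - const_mat (coeff_mat P (2 * d - i - j))) $$ (x, y) =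
          pencil Ts (- T) $$ (x, y)"
          using xy i P Ts T
          by (simp add: mat_of_blocks_def n Ts_def T_def block_hankel_def h_def)
      qed (use Ts in \<open>auto simp: mat_of_blocks_def N_def k_def\<close>)
      moreover have "mat_of_blocks (d - 1) 1 m m (\<lambda>i j. lam \<cdot>\<^sub>m const_mat (coeff_mat P (d + 1 - i))) = pencil Tc (0\<^sub>m N m)"
      proof (rule eq_matI)
        fix x b assume "x < dim_row (pencil Tc (0\<^sub>m N m))" "b < dim_col (pencil Tc (0\<^sub>m N m))"
        then have xb: "x < k * m" "b < m" using Tc by (auto simp: N_def)
        note i = idx[OF xb(1)]
        have n: "Suc k - x div m = Suc (Suc (\<beta> (x div m)))" using i by (auto simp: \<beta>_def k)
        show "mat_of_blocks (d - 1) 1 m m (\<lambda>i j. lam \<cdot>\<^sub>m const_mat (coeff_mat P (d + 1 - i))) $$ (x, b) =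
            pencil Tc (0\<^sub>m N m) $$ (x, b)"
          using xb i P zb[OF xb(2)] k
          by (simp add: mat_of_blocks_def n Tc_def T_def block_hankel_def h_def N_def)
      qed (use Tc in \<open>auto simp: mat_of_blocks_def N_def k_def\<close>)
      moreover have "mat_of_blocks 1 (d - 1) m m (\<lambda>i j. lam \<cdot>\<^sub>m const_mat (coeff_mat P (d + 1 - j))) = pencil Tr (0\<^sub>m m N)"
      proof (rule eq_matI)
        fix a y assume "a < dim_row (pencil Tr (0\<^sub>m m N))" "y < dim_col (pencil Tr (0\<^sub>m m N))"
        then have ay: "a < m" "y < k * m" using Tr by (auto simp: N_def)
        note i = idx[OF ay(2)]
        have n: "Suc k - y div m = Suc (Suc (\<beta> (y div m)))" using i by (auto simp: \<beta>_def k)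
        show "mat_of_blocks 1 (d - 1) m m (\<lambda>i j. lam \<cdot>\<^sub>m const_mat (coeff_mat P (d + 1 - j))) $$ (a, y) =
            pencil Tr (0\<^sub>m m N) $$ (a, y)"
          using ay i P zb[OF ay(1)] k
          by (simp add: mat_of_blocks_def n Tr_def T_def block_hankel_def h_def N_def)
      qed (use Tr in \<open>auto simp: mat_of_blocks_def N_def k_def\<close>)
      moreover have "lam \<cdot>\<^sub>m const_mat ?P1 + const_mat ?P0 = pencil ?P1 ?P0"
        using P by (intro eq_matI) auto
      ultimately show ?thesis
        unfolding L_poly_def
        by (simp only: four_block_pencil[OF Ts Tc Tr P10(1) uminus_carrier_mat[OF T] zero_carrier_mat zero_carrier_mat P10(2)])
    qed
    have Ua: "mat_adjoint U \<in> carrier_mat N N" using UV by simp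
    have M1: "four_block_mat Ts Tc Tr ?P1 \<in> carrier_mat (N + m) (N + m)"
      and M0: "four_block_mat (- T) (0\<^sub>m N m) (0\<^sub>m m N) ?P0 \<in> carrier_mat (N + m) (N + m)"
      using Ts T P10 by auto
    have D: "diag2 (mat_adjoint U) (1\<^sub>m m) \<in> carrier_mat (N + m) (N + m)" "diag2 V (1\<^sub>m m) \<in> carrier_mat (N + m) (N + m)"
      using UV by (auto simp: diag2_def)
    define X1 where "X1 = four_block_mat (mat_adjoint U * Ts * V) (mat_adjoint U * Tc) (Tr * V) ?P1"
    define X0 where "X0 = four_block_mat (mat_adjoint U * (- T) * V) (mat_adjoint U * 0\<^sub>m N m) (0\<^sub>m m N * V) ?P0"
    have prod: "const_mat (diag2 (mat_adjoint U) (1\<^sub>m m)) * L_poly m d P * const_mat (diag2 V (1\<^sub>m m)) = pencil X1 X0"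
      unfolding Lp const_mult_pencil(1)[OF D(1) M1 M0 D(2)]
        const_mult_pencil(2)[OF D(1) mult_carrier_mat[OF D(1) M1] mult_carrier_mat[OF D(1) M0] D(2)]
        diag2_mult_four_block[OF Ua UV(2) Ts Tc Tr P10(1)]
        diag2_mult_four_block[OF Ua UV(2) uminus_carrier_mat[OF T] zero_carrier_mat zero_carrier_mat P10(2)]
        X1_def X0_def ..
    have Kv: "K * v \<in> carrier_mat p m" and uK: "u 0 * K \<in> carrier_mat m p"
      by (rule carrier_matI; simp)+
    have "four_block_mat As (- Bs) Cs Ds = delete_leading (N - p) (pencil X1 X0)"
      unfolding L prod ..
    also have "\<dots> = pencil (delete_leading (N - p) X1) (delete_leading (N - p) X0)"
      by (rule delete_leading_pencil) (use UV Ts T in \<open>auto simp: X1_def X0_def\<close>)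
    also have "delete_leading (N - p) X1 = four_block_mat F (K * v) (u 0 * K) ?P1"
    proof -
      have "delete_leading (N - p) X1 =
          four_block_mat (mat_adjoint E * (mat_adjoint U * Ts * V) * E) (mat_adjoint E * (mat_adjoint U * Tc)) (Tr * V * E) ?P1"
        unfolding X1_def
        by (rule delete_leading_four_block[OF _ _ _ P10(1) pN E_def]) (use UV Ts Tc Tr in auto)
      also have "mat_adjoint E * (mat_adjoint U * Ts * V) * E = F"
        unfolding F_def mat_adjoint_mult[OF UV(1) E(1)]
        using UV(1,2) E(1) Ts by (simp add: mult_mat_assoc)
      also have "mat_adjoint E * (mat_adjoint U * Tc) = mat_adjoint (U * E) * Tc"
        unfolding mat_adjoint_mult[OF UV(1) E(1)] using UV(1,2) E(1) Tc by (simp add: mult_mat_assoc)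
      \<comment> \<open>The identity \<open>(U E)^* T = K (V E)^*\<close> at the last block
        column.\<close>
      also have "mat_adjoint (U * E) * Tc = K * v"
      proof (rule eq_matI)
        fix w b assume "w < dim_row (K * v)" "b < dim_col (K * v)"
        then have wb: "w < p" "b < m" by auto
        have "(mat_adjoint (U * E) * Tc) $$ (w, b) = (mat_adjoint (U * E) * T) $$ (w, z * m + b)"
          using wb zb[OF wb(2)] E(1) UV(1) T by (simp add: scalar_prod_def Tc_def)
        also have "\<dots> = (K * v) $$ (w, b)"
          unfolding comp(4) using wb zb[OF wb(2)] VE K(1) by (simp add: scalar_prod_def v_def del: index_mult_mat(2,3))
        finally show "(mat_adjoint (U * E) * Tc) $$ (w, b) = (K * v) $$ (w, b)" .
      qed (use UE Tc in auto)
      also have "Tr * V * E = Tr * (V * E)"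
        by (rule mult_mat_assoc) (use UV E Tr in auto)
      \<comment> \<open>The identity \<open>T (V E) = U E K\<close> at the last block row, where
        \<beta> is 0 and \<open>U E\<close> agrees with \<open>u 0\<close>.\<close>
      also have "Tr * (V * E) = u 0 * K"
      proof (rule eq_matI)
        fix a w assume "a < dim_row (u 0 * K)" "w < dim_col (u 0 * K)"
        then have aw: "a < m" "w < p" by auto
        have "(Tr * (V * E)) $$ (a, w) = (T * (V * E)) $$ (z * m + a, w)"
          using aw zb[OF aw(1)] VE T by (simp add: scalar_prod_def Tr_def del: index_mult_mat(2,3))
        also have "\<dots> = (u 0 * K) $$ (a, w)"
          unfolding comp(3) using aw zb[OF aw(1)] UE K(1) uU k
          by (simp add: scalar_prod_def del: index_mult_mat(2,3))
        finally show "(Tr * (V * E)) $$ (a, w) = (u 0 * K) $$ (a, w)" .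
      qed (use VE Tr in auto)
      finally show ?thesis .
    qed
    also have "delete_leading (N - p) X0 = four_block_mat (- K) (0\<^sub>m p m) (0\<^sub>m m p) ?P0"
    proof -
      have "delete_leading (N - p) X0 =
          four_block_mat (mat_adjoint E * (mat_adjoint U * (- T) * V) * E) (mat_adjoint E * (mat_adjoint U * 0\<^sub>m N m))
            (0\<^sub>m m N * V * E) ?P0"
        unfolding X0_def
        by (rule delete_leading_four_block[OF _ _ _ P10(2) pN E_def]) (use UV T in auto)
      also have "mat_adjoint E * (mat_adjoint U * 0\<^sub>m N m) = 0\<^sub>m p m" using UV E by simp
      also have "0\<^sub>m m N * V * E = 0\<^sub>m m p" using UV E by simp
      also have "mat_adjoint U * (- T) * V = - (mat_adjoint U * T * V)" using UV T by simp
      also have "mat_adjoint E * - (mat_adjoint U * T * V) * E = - ((mat_adjoint E * E) * K * (mat_adjoint E * E))"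
        unfolding UTV' using E(1) K(1) by (simp add: mult_mat_assoc)
      also have "\<dots> = - K" unfolding E(2) using K(1) by simp
      finally show ?thesis .
    qed
    also have "pencil (four_block_mat F (K * v) (u 0 * K) ?P1) (four_block_mat (- K) (0\<^sub>m p m) (0\<^sub>m m p) ?P0) =
        four_block_mat (pencil F (- K)) (pencil (K * v) (0\<^sub>m p m)) (pencil (u 0 * K) (0\<^sub>m m p)) (pencil ?P1 ?P0)"
      by (rule four_block_pencil[OF F_carrier Kv uK P10(1) uminus_carrier_mat[OF K(1)] zero_carrier_mat zero_carrier_mat P10(2),
            symmetric])
    finally have blocks: "four_block_mat As (- Bs) Cs Ds =
        four_block_mat (pencil F (- K)) (pencil (K * v) (0\<^sub>m p m)) (pencil (u 0 * K) (0\<^sub>m m p)) (pencil ?P1 ?P0)" .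
    note pc = pencil_carrier[OF F_carrier, of "- K"] pencil_carrier[OF Kv, of "0\<^sub>m p m"]
      pencil_carrier[OF uK, of "0\<^sub>m m p"] pencil_carrier[OF P10(1), of ?P0]
    note inj = four_block_mat_inject[OF carr(1) uminus_carrier_mat[OF carr(2)] carr(3,4) pc blocks]
    show thesis
    proof (rule that[of K F v u k])
      show "hankel_realization m p s e (\<lambda>n a b. coeff (P $$ (a, b)) (n + 2)) K F v u"
        using u unfolding h_def[abs_def] .
      show "u n = 0\<^sub>m m p" if "n \<ge> k" for n using that by (intro u0) (simp add: o'_def)
    qed (fact inj)+
  qed
qed

section \<open>The strictly proper part\<close>

lemma fls_of_poly_lam_power: "fls_of_poly (lam ^ n) = fls_X_inv ^ n"
  by (induction n) (simp_all add: fls_of_poly_mult)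

text \<open>Reducing \<open>\<lambda>\<^bsup>n\<^esup> x\<close> modulo \<open>psi\<close> changes \<open>\<lambda>\<^bsup>n+n'\<^esup> x y / psi\<close> only by a polynomial, hence the Hankel
  matrix of \<open>x y / psi\<close> factors through dimension \<open>degree psi\<close>.\<close>

lemma fls_nth_rational_factor:
  assumes psi: "psi \<noteq> 0"
  shows "fls_nth (fls_of_poly (x * y) / fls_of_poly psi) (int (n + n') + 1) =
    (\<Sum>t<degree psi. coeff ((lam ^ n * x) mod psi) t *
      fls_nth (fls_of_poly y / fls_of_poly psi) (int (t + n') + 1))"
proof -
  define g where "g = 1 / fls_of_poly psi"
  have g: "fls_of_poly psi * g = 1" using psi by (simp add: g_def)
  have shift: "fls_nth (fls_of_poly (lam ^ l) * f) j = fls_nth f (j + int l)" for l f j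
    by (simp add: fls_of_poly_lam_power fls_X_inv_power_times_conv_shift)
  define q where "q = (lam ^ n * x) div psi"
  define rm where "rm = (lam ^ n * x) mod psi"
  have dec: "lam ^ n * x = psi * q + rm" by (simp add: q_def rm_def)
  have "fls_nth (fls_of_poly (x * y) / fls_of_poly psi) (int (n + n') + 1) =
      fls_nth (fls_of_poly (lam ^ (n + n')) * (fls_of_poly (x * y) / fls_of_poly psi)) 1"
    by (simp only: shift add.commute)
  also have "fls_of_poly (lam ^ (n + n')) * (fls_of_poly (x * y) / fls_of_poly psi) =
      fls_of_poly (lam ^ n * x) * (fls_of_poly (lam ^ n' * y) * g)"
    by (simp add: g_def fls_of_poly_mult power_add mult_ac)
  also have "\<dots> = fls_of_poly psi * g * fls_of_poly (q * (lam ^ n' * y)) + fls_of_poly rm * (fls_of_poly (lam ^ n' * y) * g)"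
    unfolding dec fls_of_poly_add fls_of_poly_mult by (simp only: distrib_left distrib_right mult_ac)
  also have "\<dots> = fls_of_poly (q * (lam ^ n' * y)) + fls_of_poly rm * (fls_of_poly (lam ^ n' * y) * g)"
    by (simp only: g mult_1)
  \<comment> \<open>Polynomials have no coefficient at index 1, so the quotient drops out.\<close>
  also have "fls_nth \<dots> 1 = fls_nth (fls_of_poly rm * (fls_of_poly (lam ^ n' * y) * g)) 1"
    by (simp add: fls_nth_fls_of_poly)
  also have "\<dots> = (\<Sum>t<degree psi. coeff rm t * fls_nth (fls_of_poly (lam ^ n' * y) * g) (1 + int t))"
  proof (cases "rm = 0")
    case False
    then have "degree rm < degree psi"
      using degree_mod_less[OF psi, of "lam ^ n * x"] by (simp add: rm_def)
    then show ?thesis by (rule fls_nth_fls_of_poly_mult)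
  qed simp
  also have "\<dots> = (\<Sum>t<degree psi. coeff rm t * fls_nth (fls_of_poly y / fls_of_poly psi) (int (t + n') + 1))"
  proof (rule sum.cong)
    fix t
    have "fls_of_poly (lam ^ n' * y) * g = fls_of_poly (lam ^ n') * (fls_of_poly y / fls_of_poly psi)"
      by (simp add: g_def fls_of_poly_mult)
    then show "coeff rm t * fls_nth (fls_of_poly (lam ^ n' * y) * g) (1 + int t) =
        coeff rm t * fls_nth (fls_of_poly y / fls_of_poly psi) (int (t + n') + 1)"
      by (simp only: shift) (simp add: algebra_simps)
  qed simp
  finally show ?thesis by (simp only: rm_def)
qed

text \<open>Flattens the index pairs (i, t) with t < d i into one list, so that a sum over several
  denominators becomes a single inner index of a matrix factorization.\<close>

definition dependent_pairs :: "(nat \<Rightarrow> nat) \<Rightarrow> nat \<Rightarrow> (nat \<times> nat) list" where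
  "dependent_pairs d L = concat (map (\<lambda>i. map (Pair i) [0..<d i]) [0..<L])"

lemma length_dependent_pairs: "length (dependent_pairs d L) = (\<Sum>i<L. d i)"
  unfolding dependent_pairs_def by (induction L) simp_all

lemma sum_dependent_pairs:
  fixes f :: "nat \<times> nat \<Rightarrow> 'a :: comm_monoid_add"
  shows "(\<Sum>w<length (dependent_pairs d L). f (dependent_pairs d L ! w)) = (\<Sum>i<L. \<Sum>t<d i. f (i, t))"
proof -
  have inner: "sum_list (map (\<lambda>t. f (i, t)) [0..<n]) = (\<Sum>t<n. f (i, t))" for i n
    by (induction n) simp_all
  have "(\<Sum>w<length (dependent_pairs d L). f (dependent_pairs d L ! w)) = sum_list (map f (dependent_pairs d L))"
    by (simp add: sum_list_sum_nth atLeast0LessThan)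
  also have "\<dots> = (\<Sum>i<L. \<Sum>t<d i. f (i, t))"
    unfolding dependent_pairs_def by (induction L) (simp_all add: comp_def inner)
  finally show ?thesis .
qed

text \<open>The determinant is a unit, so the adjugate divided by it is again a polynomial
  matrix.\<close>

lemma unimodular_left_inverse:
  assumes "unimodular W" "W \<in> carrier_mat n n"
  obtains X where "X \<in> carrier_mat n n" "X * W = 1\<^sub>m n" "W * X = 1\<^sub>m n"
proof -
  have "det W dvd 1" using assms unfolding unimodular_def by blast
  then obtain k where k: "1 = det W * k" by (rule dvdE)
  note adj = adj_mat[OF assms(2)]
  show thesis
  proof
    show "k \<cdot>\<^sub>m adj_mat W \<in> carrier_mat n n" using adj by simp
    have "(k \<cdot>\<^sub>m adj_mat W) * W = k \<cdot>\<^sub>m (det W \<cdot>\<^sub>m 1\<^sub>m n)"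
      using adj assms by (simp add: smult_mat_mult)
    also have "\<dots> = 1\<^sub>m n" using k by (intro eq_matI) (auto simp: mult.commute)
    finally show "(k \<cdot>\<^sub>m adj_mat W) * W = 1\<^sub>m n" .
    have "W * (k \<cdot>\<^sub>m adj_mat W) = k \<cdot>\<^sub>m (det W \<cdot>\<^sub>m 1\<^sub>m n)"
      using adj assms by (simp add: smult_mat_mult)
    also have "\<dots> = 1\<^sub>m n" using k by (intro eq_matI) (auto simp: mult.commute)
    finally show "W * (k \<cdot>\<^sub>m adj_mat W) = 1\<^sub>m n" .
  qed
qed

text \<open>With polynomial inverses \<open>X\<close>, \<open>Y\<close> of the unimodular factors,
  each entry of \<open>R\<close> is a sum of terms x y / psi_i, and each term factors through
  dimension degree psi_i. The factorization holds for all n, n' at once, and this extends control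
  from the finite matrix \<open>H\<close> to the coefficients beyond it.\<close>

lemma smith_mcmillan_hankel_factor:
  assumes R: "R \<in> carrier_mat m m" and sm: "smith_mcmillan_form R eps psi"
    and r: "r = sum_list (map degree psi)"
  obtains o' c where "\<And>n n' a b. a < m \<Longrightarrow> b < m \<Longrightarrow>
    laurent_coeff_mat R (n + n' + 1) $$ (a, b) = (\<Sum>w = 0..<r. o' n a w * c w n' b)"
proof -
  interpret to_fract: comm_ring_hom "to_fract :: complex poly \<Rightarrow> complex poly fract"
    by unfold_locales auto
  define L where "L = length psi"
  define Dg where "Dg = mat m m (\<lambda>(i, j). if i = j \<and> i < L then Fract (eps ! i) (psi ! i) else 0)"
  obtain W Z where WZ: "W \<in> carrier_mat m m" "Z \<in> carrier_mat m m" "unimodular W" "unimodular Z"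
    and D: "rat_mat W * R * rat_mat Z = Dg"
    using sm R unfolding smith_mcmillan_form_def Dg_def L_def by auto
  have L: "L \<le> m" and nz: "\<And>i. i < L \<Longrightarrow> psi ! i \<noteq> 0"
    using sm R unfolding smith_mcmillan_form_def L_def by auto
  obtain X where X: "X \<in> carrier_mat m m" "X * W = 1\<^sub>m m" by (rule unimodular_left_inverse[OF WZ(3,1)])
  obtain Y where Y: "Y \<in> carrier_mat m m" "Z * Y = 1\<^sub>m m" by (rule unimodular_left_inverse[OF WZ(4,2)])
  have Dc: "Dg \<in> carrier_mat m m" by (simp add: Dg_def)
  have XW: "rat_mat X * rat_mat W = 1\<^sub>m m"
    unfolding to_fract.mat_hom_mult[OF X(1) WZ(1), symmetric] X(2) by (rule to_fract.mat_hom_one)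
  have ZY: "rat_mat Z * rat_mat Y = 1\<^sub>m m"
    unfolding to_fract.mat_hom_mult[OF WZ(2) Y(1), symmetric] Y(2) by (rule to_fract.mat_hom_one)
  note [simp] = carrier_matD[OF X(1)] carrier_matD[OF Y(1)] carrier_matD[OF WZ(1)] carrier_matD[OF WZ(2)] carrier_matD[OF R] carrier_matD[OF Dc]
  have "rat_mat X * Dg * rat_mat Y = (rat_mat X * rat_mat W) * R * (rat_mat Z * rat_mat Y)"
    unfolding D[symmetric] by (simp add: mult_mat_assoc)
  also have "\<dots> = R" unfolding XW ZY using R by simp
  finally have RX: "R = rat_mat X * Dg * rat_mat Y" ..
  have entry: "laurent_at_infinity (R $$ (a, b)) =
      (\<Sum>i<L. fls_of_poly (X $$ (a, i) * eps ! i * Y $$ (i, b)) / fls_of_poly (psi ! i))"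
    if ab: "a < m" "b < m" for a b
  proof -
    have XD: "(rat_mat X * Dg) $$ (a, i) = (if i < L then to_fract (X $$ (a, i)) * Fract (eps ! i) (psi ! i) else 0)"
      if "i < m" for i
    proof -
      have "(rat_mat X * Dg) $$ (a, i) = (\<Sum>j = 0..<m. to_fract (X $$ (a, j)) *
          (if j = i \<and> j < L then Fract (eps ! j) (psi ! j) else 0))"
        using ab that by (simp add: scalar_prod_def Dg_def)
      also have "\<dots> = (\<Sum>j = 0..<m. if j = i then (if i < L then to_fract (X $$ (a, i)) * Fract (eps ! i) (psi ! i) else 0) else 0)"
        by (intro sum.cong) auto
      finally show ?thesis using that by simp
    qed
    have "R $$ (a, b) = (\<Sum>i = 0..<m. (rat_mat X * Dg) $$ (a, i) * to_fract (Y $$ (i, b)))"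
      unfolding RX using ab by (subst index_mult_mat(1)) (auto simp: scalar_prod_def simp del: index_mult_mat(1) intro!: sum.cong)
    also have "\<dots> = (\<Sum>i = 0..<m. if i < L then to_fract (X $$ (a, i)) * Fract (eps ! i) (psi ! i) * to_fract (Y $$ (i, b)) else 0)"
      by (intro sum.cong) (auto simp: XD simp del: index_mult_mat(1))
    also have "\<dots> = (\<Sum>i<L. to_fract (X $$ (a, i)) * Fract (eps ! i) (psi ! i) * to_fract (Y $$ (i, b)))"
      using L by (intro sum.mono_neutral_cong_right) auto
    finally have "laurent_at_infinity (R $$ (a, b)) =
        (\<Sum>i<L. laurent_at_infinity (to_fract (X $$ (a, i)) * Fract (eps ! i) (psi ! i) * to_fract (Y $$ (i, b))))"
      by (simp only: laurent.hom_sum)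
    also have "\<dots> = (\<Sum>i<L. fls_of_poly (X $$ (a, i) * eps ! i * Y $$ (i, b)) / fls_of_poly (psi ! i))"
      by (intro sum.cong) (auto simp: laurent.hom_mult laurent_at_infinity_Fract nz fls_of_poly_mult)
    finally show ?thesis .
  qed
  define xs where "xs = dependent_pairs (\<lambda>i. degree (psi ! i)) L"
  have len: "length xs = r"
    unfolding xs_def length_dependent_pairs r L_def by (simp add: sum_list_sum_nth atLeast0LessThan)
  show thesis
  proof (rule that)
    fix n n' a b assume ab: "a < m" "b < m"
    have "laurent_coeff_mat R (n + n' + 1) $$ (a, b) = fls_nth (laurent_at_infinity (R $$ (a, b))) (int (n + n') + 1)"
      using ab by (simp add: laurent_coeff_mat_def algebra_simps)
    also have "\<dots> = (\<Sum>i<L. fls_nth (fls_of_poly (X $$ (a, i) * eps ! i * Y $$ (i, b)) / fls_of_poly (psi ! i)) (int (n + n') + 1))"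
      by (simp only: entry[OF ab] fls_nth_sum)
    also have "\<dots> = (\<Sum>i<L. \<Sum>t<degree (psi ! i). (\<lambda>(i, t). coeff ((lam ^ n * (X $$ (a, i) * eps ! i)) mod (psi ! i)) t *
        fls_nth (fls_of_poly (Y $$ (i, b)) / fls_of_poly (psi ! i)) (int (t + n') + 1)) (i, t))"
      by (intro sum.cong) (auto simp only: lessThan_iff fls_nth_rational_factor[OF nz] prod.case)
    also have "\<dots> = (\<Sum>w<length xs. (\<lambda>(i, t). coeff ((lam ^ n * (X $$ (a, i) * eps ! i)) mod (psi ! i)) t *
        fls_nth (fls_of_poly (Y $$ (i, b)) / fls_of_poly (psi ! i)) (int (t + n') + 1)) (xs ! w))"
      unfolding xs_def by (rule sum_dependent_pairs[symmetric])
    also have "\<dots> = (\<Sum>w = 0..<r. (\<lambda>(i, t). coeff ((lam ^ n * (X $$ (a, i) * eps ! i)) mod (psi ! i)) t) (xs ! w) *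
        (\<lambda>(i, t). fls_nth (fls_of_poly (Y $$ (i, b)) / fls_of_poly (psi ! i)) (int (t + n') + 1)) (xs ! w))"
      unfolding len by (auto simp: atLeast0LessThan split: prod.splits intro!: sum.cong)
    finally show "laurent_coeff_mat R (n + n' + 1) $$ (a, b) =
      (\<Sum>w = 0..<r. (\<lambda>n a w. (\<lambda>(i, t). coeff ((lam ^ n * (X $$ (a, i) * eps ! i)) mod (psi ! i)) t) (xs ! w)) n a w *
        (\<lambda>w n' b. (\<lambda>(i, t). fls_nth (fls_of_poly (Y $$ (i, b)) / fls_of_poly (psi ! i)) (int (t + n') + 1)) (xs ! w)) w n' b)" .
  qed
qed


text \<open>Hankel index n stands for the Laurent index n + 1, so one more factor s appears and the
  base sign is \<open>e * s\<close>. The blocks keep their order, so \<beta> is the identity and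
  vanishes at block 0.\<close>

lemma strictly_proper_part_realization:
  fixes kind :: conj_kind
  defines "s \<equiv> kind_twist kind" and "e \<equiv> kind_sign kind"
  assumes R: "R \<in> carrier_mat m m"
    and sym: "\<And>a b n. a < m \<Longrightarrow> b < m \<Longrightarrow> 0 < n \<Longrightarrow>
      cnj (laurent_coeff_mat R n $$ (a, b)) = e * s ^ n * laurent_coeff_mat R n $$ (b, a)"
    and con: "constructed_from_sp_part kind m R q A B C"
  obtains H F v u where
    "hankel_realization m q s (e * s) (\<lambda>n a b. laurent_coeff_mat R (n + 1) $$ (a, b)) H F v u"
    "A = pencil (- H) F" "- B = pencil (0\<^sub>m q m) (H * v)" "C = pencil (0\<^sub>m m q) (u 0 * H)"
proof -
  have s: "s * s = 1" "cnj s = s" by (simp_all add: s_def)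
  define h where "h n a b = laurent_coeff_mat R (n + 1) $$ (a, b)" for n a b
  have h: "cnj (h n a b) = (e * s) * s ^ n * h n b a" if "a < m" "b < m" for n a b
    using sym[OF that, of "n + 1"] by (simp add: h_def)
  obtain k eps psi U V K where k: "1 \<le> k" and sm: "smith_mcmillan_form R eps psi" "q = sum_list (map degree psi)"
    and UV: "U \<in> carrier_mat (k * m) (k * m)" "V \<in> carrier_mat (k * m) (k * m)" "unitary_mat U" "unitary_mat V"
    and US: "if is_para kind then U = sign_diag k m (\<lambda>i. i) * V else U = V"
    and K: "K \<in> carrier_mat q q" "invertible_mat K"
    and UHV: "mat_adjoint U * H_sp m k R * V = diag2 K (0\<^sub>m (k * m - q) (k * m - q))"
    and A: "A = const_mat (mat_adjoint (leading_block (k * m) q V) *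
        (if is_para kind then sign_diag k m (\<lambda>i. i) * H_sigma_sp m k R else H_sigma_sp m k R) *
        leading_block (k * m) q V) - lam \<cdot>\<^sub>m const_mat K"
    and B: "- B = const_mat (K * mat_adjoint (leading_block m q V))"
    and C: "C = const_mat (if is_para kind then - (leading_block m q V * K) else leading_block m q V * K)"
    using con unfolding constructed_from_sp_part_def Let_def by blast
  define N where "N = k * m"
  note UV = UV[folded N_def] and UHV = UHV[folded N_def] and A = A[folded N_def]
  define E where "E = selection_mat N q 0"
  define T where "T = block_hankel m k (\<lambda>i. i) h"
  define Ts where "Ts = block_hankel m k (\<lambda>i. i) (\<lambda>n. h (Suc n))"
  define S where "S = twist_diag m k (\<lambda>i. i) s"
  have T: "T \<in> carrier_mat N N" and Ts: "Ts \<in> carrier_mat N N" and S: "S \<in> carrier_mat N N"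
    by (simp_all add: T_def Ts_def S_def N_def)
  note idx = index_block_mat
  have mN: "m \<le> N" using k by (cases k) (auto simp: N_def)
  have HT: "H_sp m k R = T"
    by (rule eq_matI) (auto simp: H_sp_def T_def mat_of_blocks_def block_hankel_def h_def idx)
  have HTs: "H_sigma_sp m k R = Ts"
    by (rule eq_matI) (auto simp: H_sigma_sp_def Ts_def mat_of_blocks_def block_hankel_def h_def idx)
  have qN: "q \<le> N"
  proof -
    have "dim_row (mat_adjoint U * H_sp m k R * V) = N" using UV by simp
    then have "q + (N - q) = N" unfolding UHV using K by (simp add: diag2_def)
    then show ?thesis by simp
  qed
  have E: "E \<in> carrier_mat N q" "mat_adjoint E * E = 1\<^sub>m q"
    using adjoint_selection_mult_selection[of 0 q N] qN by (simp_all add: E_def)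
  have UHV': "mat_adjoint U * T * V = E * K * mat_adjoint E"
    unfolding UHV[unfolded HT] E_def selection_conj_eq_diag2(2)[OF K(1) qN] ..
  note comp = unitary_compression[OF UV(3,1) UV(4,2) T E K(1) UHV']
  have VE: "V * E \<in> carrier_mat N q" using UV E by auto
  have sgn: "S = (if is_para kind then sign_diag k m (\<lambda>i. i) else 1\<^sub>m N)"
    by (simp add: S_def s_def kind_twist_def twist_diag_one N_def twist_diag_eq_sign_diag[where f = "\<lambda>i. i"])
  have US': "U = S * V" using US UV by (auto simp: sgn split: if_splits)
  have US1: "U * E = S * (V * E)"
    unfolding US' by (rule mult_mat_assoc) (use UV E S in auto)
  have V1: "leading_block N q V = V * E"
    by (rule eq_matI)
      (use UV E qN in \<open>auto simp: leading_block_def E_def index_mult_selection simp del: index_mult_mat(1)\<close>)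
  have V11: "leading_block m q V $$ (a, w) = (V * E) $$ (a, w)" if "a < m" "w < q" for a w
    unfolding V1[symmetric] using that mN by (simp add: leading_block_def)
  obtain o' c where oc: "\<And>n n' a b. a < m \<Longrightarrow> b < m \<Longrightarrow>
      laurent_coeff_mat R (n + n' + 1) $$ (a, b) = (\<Sum>w = 0..<q. o' n a w * c w n' b)"
    using smith_mcmillan_hankel_factor[OF R sm] by blast
  then have factor: "h (n + n') a b = (\<Sum>w = 0..<q. o' n a w * c w n' b)" if "a < m" "b < m" for n n' a b
    using that by (simp add: h_def)
  define F where "F = mat_adjoint (U * E) * Ts * (V * E)"
  \<comment> \<open>The summand \<open>0 * m\<close> is the offset of block \<open>z = 0\<close>,
    kept so that \<open>hankel_realizationI\<close> applies verbatim.\<close>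
  define v where "v = mat q m (\<lambda>(w, b). cnj ((V * E) $$ (0 * m + b, w)))"
  obtain u where u: "hankel_realization m q s (e * s) h K F v u"
    using hankel_realizationI[OF s h factor VE[unfolded N_def] US1[unfolded S_def] comp(1,2) K(1) invertible_mat_det[OF K(2,1)]
        comp(3,4)[unfolded T_def] F_def[unfolded Ts_def] _ _ v_def] k
    unfolding N_def by force
  interpret hankel_realization m q s "e * s" h K F v u by (rule u)
  have Kv: "K * v \<in> carrier_mat q m" and uK: "u 0 * K \<in> carrier_mat m q"
    by (rule carrier_matI; simp)+
  have vV: "mat_adjoint (leading_block m q V) = v"
  proof (rule eq_matI)
    have dim: "dim_row (leading_block m q V) = m" "dim_col (leading_block m q V) = q"
      by (simp_all add: leading_block_def)
    then show "dim_row (mat_adjoint (leading_block m q V)) = dim_row v"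
      "dim_col (mat_adjoint (leading_block m q V)) = dim_col v" by simp_all
    fix w a assume "w < dim_row v" "a < dim_col v"
    then show "mat_adjoint (leading_block m q V) $$ (w, a) = v $$ (w, a)"
      by (simp add: dim V11 v_def)
  qed
  have Aeq: "A = pencil (- K) F"
  proof -
    \<comment> \<open>\<open>S\<close> is real and diagonal, so \<open>U^* = V^* S\<close>; this is
      how \<open>S\<close> comes to stand before the shifted Hankel matrix in the para
      cases.\<close>
    have "mat_adjoint S = S" using s by (intro eq_matI) (auto simp: S_def twist_diag_def)
    then have "F = mat_adjoint (V * E) * (S * Ts) * (V * E)"
      unfolding F_def US1 mat_adjoint_mult[OF S VE] using S Ts VE UV E by (simp add: mult_mat_assoc)
    moreover have "S * Ts = (if is_para kind then sign_diag k m (\<lambda>i. i) * Ts else Ts)"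
      using Ts by (simp add: sgn)
    ultimately have "A = const_mat F - lam \<cdot>\<^sub>m const_mat K"
      unfolding A V1 HTs by simp
    then show ?thesis using F_carrier K(1) by (auto intro!: eq_matI)
  qed
  have Beq: "- B = pencil (0\<^sub>m q m) (K * v)"
    unfolding B vV using Kv by (intro eq_matI) (auto simp del: index_mult_mat(1))
  have "leading_block m q V \<in> carrier_mat m q" by (simp add: leading_block_def)
  \<comment> \<open>The first diagonal block of \<open>S\<close> is \<open>s\<close> times the
    identity; for the para structures this is the minus sign in \<open>C\<close>.\<close>
  moreover have "u 0 = s \<cdot>\<^sub>m leading_block m q V"
  proof -
    have "mat_adjoint v = leading_block m q V" using vV by (metis mat_adjoint_adjoint)
    then have "s \<cdot>\<^sub>m u 0 = leading_block m q V" using adjoint_v by simp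
    then have "s \<cdot>\<^sub>m leading_block m q V = s \<cdot>\<^sub>m (s \<cdot>\<^sub>m u 0)" by simp
    also have "\<dots> = u 0" using s by (intro eq_matI) (auto simp: mult.assoc[symmetric])
    finally show ?thesis ..
  qed
  ultimately have "u 0 * K = s \<cdot>\<^sub>m (leading_block m q V * K)"
    using K(1) by (simp add: smult_mat_mult)
  then have "(if is_para kind then - (leading_block m q V * K) else leading_block m q V * K) = u 0 * K"
    by (auto simp: s_def kind_twist_def intro!: eq_matI)
  then have Ceq: "C = pencil (0\<^sub>m m q) (u 0 * K)"
    unfolding C using uK by (simp only:) (intro eq_matI; auto simp del: index_mult_mat(1))
  show thesis
    by (rule that[of K F v u]) (use u Aeq Beq Ceq in \<open>simp_all only: h_def[abs_def]\<close>)
qed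

theorem theorem7p2:
  fixes R Rsp :: "complex poly fract mat"
    and P :: "complex poly mat"
    and As Bs Cs Ds Asp Bsp Csp :: "complex poly mat"
    and kind :: conj_kind and m p q :: nat
  assumes "R \<in> carrier_mat m m"
    and "self_conj kind R"
    and "P \<in> carrier_mat m m"
    and "Rsp \<in> carrier_mat m m" and "strictly_proper Rsp"
    and "R = rat_mat P + Rsp"
    and "constructed_from_poly_part kind m P p As Bs Cs Ds"
    and "constructed_from_sp_part kind m Rsp q Asp Bsp Csp"
  shows "let A = four_block_mat As (0\<^sub>m p q) (0\<^sub>m q p) Asp;
             B = Bs @\<^sub>r Bsp;
             C = Cs @\<^sub>c Csp;
             L = four_block_mat A (- B) C Ds
         in strongly_minimal_linearization (p + q) m m A B C Ds R \<and> self_conj kind (rat_mat L)"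
proof -
  note R = assms(1) and P = assms(3) and Rsp = assms(4) and sp = assms(5) and dec = assms(6)
  note sc = assms(2)[unfolded dec]
  note symP = coeff_self_conj[OF P Rsp sp sc] and symR = laurent_coeff_self_conj[OF P Rsp sc]
  obtain H1 F1 v1 u1 k where h1: "hankel_realization m p (kind_twist kind) (kind_sign kind)
      (\<lambda>n a b. coeff (P $$ (a, b)) (n + 2)) H1 F1 v1 u1"
    and nil: "\<And>n. n \<ge> k \<Longrightarrow> u1 n = 0\<^sub>m m p"
    and poly_blocks: "As = pencil F1 (- H1)" "- Bs = pencil (H1 * v1) (0\<^sub>m p m)"
      "Cs = pencil (u1 0 * H1) (0\<^sub>m m p)" "Ds = pencil (coeff_mat P 1) (coeff_mat P 0)"
    using poly_part_realization[OF P symP assms(7)] by blast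
  obtain H2 F2 v2 u2 where h2: "hankel_realization m q (kind_twist kind) (kind_sign kind * kind_twist kind)
      (\<lambda>n a b. laurent_coeff_mat Rsp (n + 1) $$ (a, b)) H2 F2 v2 u2"
    and sp_blocks: "Asp = pencil (- H2) F2" "- Bsp = pencil (0\<^sub>m q m) (H2 * v2)"
      "Csp = pencil (0\<^sub>m m q) (u2 0 * H2)"
    using strictly_proper_part_realization[OF Rsp symR assms(8)] by blast
  have B: "Bs \<in> carrier_mat p m" "Bsp \<in> carrier_mat q m"
    using assms(7,8) by (simp_all add: constructed_from_poly_part_def constructed_from_sp_part_def)
  have D: "coeff_mat P 1 \<in> carrier_mat m m" "coeff_mat P 0 \<in> carrier_mat m m"
    "mat_adjoint (coeff_mat P 1) = (kind_sign kind * kind_twist kind) \<cdot>\<^sub>m coeff_mat P 1"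
    "mat_adjoint (coeff_mat P 0) = kind_sign kind \<cdot>\<^sub>m coeff_mat P 0"
    using P by (auto intro!: eq_matI simp: symP)
  \<comment> \<open>P_1 and P_0 belong to the block \<open>Ds\<close>, so the Hankel data begin at
    lambda^2 on one side and at lambda^(-1) on the other.\<close>
  have coeffs: "fls_nth (laurent_at_infinity (R $$ (a, b))) j =
      (if j < -1 then coeff (P $$ (a, b)) (nat (- j - 2) + 2) else if j = -1 then coeff_mat P 1 $$ (a, b)
       else if j = 0 then coeff_mat P 0 $$ (a, b) else laurent_coeff_mat Rsp (nat (j - 1) + 1) $$ (a, b))"
    if ab: "a < m" "b < m" for a b j
  proof -
    have "Rsp $$ (a, b) \<in> elements_mat Rsp" using Rsp ab by auto
    then have z: "fls_nth (laurent_at_infinity (Rsp $$ (a, b))) j = 0" if "j \<le> 0"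
      using sp that by (intro fls_nth_laurent_strictly_proper) (auto simp: strictly_proper_def)
    have n: "nat (- j - 2) + 2 = nat (- j)" if "j < -1" using that by simp
    have n': "1 + int (nat (j - 1)) = j" if "j > 0" using that by simp
    have "fls_nth (laurent_at_infinity (R $$ (a, b))) j =
        (if j \<le> 0 then coeff (P $$ (a, b)) (nat (- j)) else 0) + fls_nth (laurent_at_infinity (Rsp $$ (a, b))) j"
      unfolding dec using P Rsp ab by (simp add: laurent.hom_add fls_nth_fls_of_poly)
    then show ?thesis
      using P Rsp ab z n n' by (cases "j < -1"; cases "j = -1"; cases "j = 0") (auto simp: laurent_coeff_mat_def)
  qed
  show ?thesis
    by (rule strongly_minimal_linearization_assembly[OF h1 nil h2 B poly_blocks sp_blocks D R coeffs])
qed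

end
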